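(* Let $n\ge 2$ be an integer, $1<p<\infty$, $a_1,\dots,a_n>0$, and $\mathbb B_p^n(a)=\{x\in\mathbb R^n:\sum_{r=1}^n|a_rx_r|^p\le 1\}$. For every $m=1,\dots,n$, the curvature measure $\Phi_{n-m}(\mathbb B_p^n(a),\cdot)$ is absolutely continuous with respect to the surface measure $\mathcal H^{n-1}$ restricted to $\partial\mathbb B_p^n(a)$, and its density is $$ \frac{d\Phi_{n-m}(\mathbb B_p^n(a),x)}{d\mathcal H^{n-1}(x)}=\frac{(p-1)^{m-1}}{m\,\kappa_m}\sum_{i=1}^n\ \sum_{\substack{I\subseteq\{1,\dots,n\}\setminus\{i\}\\|I|=m-1}}\frac{a_i^{2p}|x_i|^{2p-2}\prod_{j\in I}a_j^p|x_j|^{p-2}}{\left(\sum_{r=1}^na_r^{2p}|x_r|^{2p-2}\right)^{(m+1)/2}} . $$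
   Context: $\mathcal H^{n-1}$ is the $(n-1)$-dimensional Hausdorff measure and $\kappa_m=\pi^{m/2}/\Gamma(1+\frac m2)$ is the volume of the $m$-dimensional Euclidean unit ball. Empty products equal $1$. Curvature measures: let $K\subseteq\mathbb R^n$ be a convex body, $p_K(y)$ the metric projection of $y$ onto $K$, and $\mathbb B_2^n$ the Euclidean unit ball. For Borel $B\subseteq\partial K$ and $\rho\ge 0$ put $A_\rho(K,B)=\{y\in(K+\rho\mathbb B_2^n)\setminus K:\ p_K(y)\in B\}$. The curvature measures $\Phi_0(K,\cdot),\dots,\Phi_{n-1}(K,\cdot)$ are the unique finite Borel measures on $\partial K$ satisfying $\mathrm{Vol}_n(A_\rho(K,B))=\sum_{j=0}^{n-1}\kappa_{n-j}\rho^{n-j}\Phi_j(K,B)$ for all $\rho\ge 0$ and all Borel $B\subseteq\partial K$. *)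

theory Defs
  imports "HOL-Analysis.Analysis"
begin

text \<open>The normalising constant makes the d-dimensional Hausdorff measure agree with Lebesgue
  measure in dimension d, so that in codimension one it is the usual surface measure. The case
  distinction only matters for d = 0, where the empty set must still have weight 0.\<close>

definition hausdorff_weight :: "nat \<Rightarrow> 'a::metric_space set \<Rightarrow> ennreal" where
  "hausdorff_weight d U =
     (if U = {} then 0 else ennreal (unit_ball_vol (real d) * (diameter U / 2) ^ d))"

text \<open>Boundedness is demanded explicitly because \<^const>\<open>diameter\<close> is a real number and
  carries no information for unbounded sets.\<close>

definition hausdorff_outer :: "nat \<Rightarrow> 'a::metric_space set \<Rightarrow> ennreal" where
  "hausdorff_outer d A =
     (SUP \<delta>\<in>{0<..}. INF U\<in>{U :: nat \<Rightarrow> 'a set.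
        A \<subseteq> (\<Union>i. U i) \<and> (\<forall>i. bounded (U i) \<and> diameter (U i) \<le> \<delta>)}.
        (\<Sum>i. hausdorff_weight d (U i)))"

text \<open>The set function above is a metric outer measure, hence countably additive on the Borel sets
  by Caratheodory's criterion, so \<^const>\<open>measure_of\<close> retains its values there.\<close>

definition hausdorff_measure :: "nat \<Rightarrow> 'a::metric_space measure" where
  "hausdorff_measure d = measure_of UNIV (sets borel) (hausdorff_outer d)"

definition local_parallel_set ::
    "'a::euclidean_space set \<Rightarrow> 'a set \<Rightarrow> real \<Rightarrow> 'a set" where
  "local_parallel_set K B \<rho> =
     {y \<in> {u + v | u v. u \<in> K \<and> v \<in> cball 0 \<rho>} - K. closest_point K y \<in> B}"

definition local_steiner ::
    "'a::euclidean_space set \<Rightarrow> (nat \<Rightarrow> 'a measure) \<Rightarrow> bool" where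
  "local_steiner K \<Phi> \<longleftrightarrow>
     (\<forall>j<DIM('a). sets (\<Phi> j) = sets (restrict_space borel (frontier K)) \<and> finite_measure (\<Phi> j)) \<and>
     (\<forall>\<rho>\<ge>0. \<forall>B\<in>sets borel. B \<subseteq> frontier K \<longrightarrow>
        emeasure lborel (local_parallel_set K B \<rho>) =
        ennreal (\<Sum>j<DIM('a). unit_ball_vol (real (DIM('a) - j)) * \<rho> ^ (DIM('a) - j) *
                   measure (\<Phi> j) B))"

text \<open>The family is determined by the local Steiner formula only at indices below the dimension,
  hence the description of a single member rather than of the whole family. It is meaningful for
  a convex body K and j below the dimension.\<close>

definition curvature_measure :: "'a::euclidean_space set \<Rightarrow> nat \<Rightarrow> 'a measure" where
  "curvature_measure K j = (THE M. \<exists>\<Phi>. local_steiner K \<Phi> \<and> M = \<Phi> j)"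

definition weighted_lp_ball :: "real \<Rightarrow> real ^ 'n \<Rightarrow> (real ^ 'n) set" where
  "weighted_lp_ball p a = {x. (\<Sum>r\<in>UNIV. \<bar>a $ r * x $ r\<bar> powr p) \<le> 1}"

definition surface_measure :: "(real ^ 'n) set \<Rightarrow> (real ^ 'n) measure" where
  "surface_measure K = restrict_space (hausdorff_measure (CARD('n) - 1)) (frontier K)"

text \<open>Since \<open>0 powr s = 0\<close> for every s, a factor with vanishing coordinate is read as 0 here, also
  when \<open>p \<le> 2\<close> (where the formula would say 1 or infinity). The points of the boundary of the ball
  with a vanishing coordinate have surface measure zero, so the density is not affected.\<close>

definition lp_curvature_density :: "real \<Rightarrow> real ^ 'n \<Rightarrow> nat \<Rightarrow> real ^ 'n \<Rightarrow> real" where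
  "lp_curvature_density p a m x =
     (p - 1) ^ (m - 1) / (real m * unit_ball_vol (real m)) *
     (\<Sum>i\<in>UNIV. \<Sum>I\<in>{I. I \<subseteq> UNIV - {i} \<and> card I = m - 1}.
        ((a $ i) powr (2 * p) * \<bar>x $ i\<bar> powr (2 * p - 2) *
           (\<Prod>j\<in>I. (a $ j) powr p * \<bar>x $ j\<bar> powr (p - 2))) /
        (\<Sum>r\<in>UNIV. (a $ r) powr (2 * p) * \<bar>x $ r\<bar> powr (2 * p - 2)) powr ((real m + 1) / 2))"

end

theory Submission
  imports Defs
begin

text \<open>
  Off the coordinate hyperplanes the boundary of the ball \<open>K\<close> is a smooth hypersurface with normal
  \<open>q = \<nabla>g / p\<close>, where \<open>g x = (\<Sum>r. \<bar>a r * x r\<bar> powr p)\<close>, and the points whose nearest point lies in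
  \<open>B\<close> form the set of all \<open>x + t q(x)\<close> with \<open>x \<in> B\<close> and \<open>0 < t \<le> \<rho> / \<bar>q(x)\<bar>\<close>. Because the derivative of
  \<open>q\<close> is diagonal, say with entries \<open>D i\<close>, the Jacobian determinant of \<open>(x, t) \<mapsto> x + t q(x)\<close> in a graph
  chart is a rank-one perturbation of a diagonal one and equals, up to sign,
  \<open>(\<Sum>i. q i ^ 2 * (\<Prod>j\<noteq>i. 1 + t * D j)) / q k\<close>, whereas the area factor of the chart is \<open>\<bar>q\<bar> / \<bar>q k\<bar>\<close>.
  Integrating over \<open>t\<close> gives the local Steiner polynomial with the asserted densities, and comparing
  coefficients identifies the curvature measures.

  The surface measure is a Hausdorff measure normalised by diameters, so the area formula for charts
  rests on the equality of Hausdorff and Lebesgue measure in full dimension. One inequality is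
  Vitali's covering theorem. The other is the isodiametric inequality, which follows from the midpoint
  Brunn--Minkowski inequality \<open>\<bar>A - A\<bar> \<ge> 2^d \<bar>A\<bar>\<close>, itself obtained by the Hadwiger--Ohmann cutting
  argument for unions of boxes.
\<close>

subsection \<open>Hausdorff measure\<close>

text \<open>The density refers to surface measure itself, so no unknown constant may survive between
  Hausdorff and Lebesgue measure; this forces the isodiametric inequality. Once the two agree, one
  area formula serves twice: for the graph charts, which map into a larger space, and for the normal
  flow, a map of full dimension whose Hausdorff measure is volume.

  The obstacle on the ball is a vanishing coordinate: for p < 2 the normal field is not
  differentiable there. On the boundary such points form a surface null set, in space a null set of
  hyperplanes, and the flow keeps the sign of every coordinate, so both exceptional sets correspond
  and can be removed.

  The square root form of Brunn--Minkowski is homogeneous of degree one when both volumes are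
  multiplied by the same factor, so cutting both bodies in one ratio adds up exactly.

  The curvature measures are defined by a description, so the existence of a local Steiner family is
  part of the claim; the computed densities supply it.\<close>

definition hausdorff_content :: "nat \<Rightarrow> real \<Rightarrow> 'a::metric_space set \<Rightarrow> ennreal" where
  "hausdorff_content d \<delta> A =
     (INF U\<in>{U :: nat \<Rightarrow> 'a set. A \<subseteq> (\<Union>i. U i) \<and> (\<forall>i. bounded (U i) \<and> diameter (U i) \<le> \<delta>)}.
        (\<Sum>i. hausdorff_weight d (U i)))"

lemma hausdorff_outer_eq_SUP_content: "hausdorff_outer d A = (SUP \<delta>\<in>{0<..}. hausdorff_content d \<delta> A)"
  unfolding hausdorff_outer_def hausdorff_content_def ..

lemma hausdorff_content_le:
  assumes "A \<subseteq> (\<Union>i. U i)" "\<And>i::nat. bounded (U i)" "\<And>i. diameter (U i) \<le> \<delta>"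
  shows "hausdorff_content d \<delta> A \<le> (\<Sum>i. hausdorff_weight d (U i))"
  unfolding hausdorff_content_def by (rule INF_lower) (use assms in auto)

lemma hausdorff_weight_mono:
  assumes "U \<subseteq> V" "bounded V"
  shows "hausdorff_weight d U \<le> hausdorff_weight d V"
  using assms diameter_subset[OF assms] diameter_ge_0[of U] bounded_subset[OF assms(2,1)]
  by (auto simp: hausdorff_weight_def intro!: ennreal_leI mult_left_mono power_mono)

text \<open>Giving oversized sets infinite weight turns the content into an outer measure generated
  by a monotone set function on all subsets, which makes countable subadditivity available. Only
  disjoint covers enter \<open>outer_measure\<close>; monotonicity of \<open>f\<close> is what makes
  arbitrary covers give the same infimum.\<close>

lemma hausdorff_content_eq_outer_measure:
  fixes \<delta> :: real and d :: nat
  assumes "0 \<le> \<delta>"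
  defines "f \<equiv> (\<lambda>X :: 'a::metric_space set.
     if bounded X \<and> diameter X \<le> \<delta> then hausdorff_weight d X else \<infinity>)"
  shows "hausdorff_content d \<delta> = outer_measure (Pow UNIV) f"
    and "positive (Pow UNIV) f" and "increasing (Pow UNIV) f"
proof -
  interpret algebra "UNIV::'a set" "Pow UNIV" by (rule algebra_Pow)
  show pos: "positive (Pow UNIV) f"
    using assms by (auto simp: positive_def f_def hausdorff_weight_def)
  show inc: "increasing (Pow UNIV) f"
  proof (unfold increasing_def, intro ballI impI)
    fix x y :: "'a set" assume "x \<subseteq> y"
    then show "f x \<le> f y"
      using hausdorff_weight_mono[of x y d] diameter_subset[of x y] bounded_subset[of y x]
      by (auto simp: f_def)
  qed
  show "hausdorff_content d \<delta> = outer_measure (Pow UNIV) f"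
  proof (rule ext, rule antisym)
    fix X :: "'a set"
    show "outer_measure (Pow UNIV) f X \<le> hausdorff_content d \<delta> X"
      unfolding hausdorff_content_def
    proof (rule INF_greatest)
      fix U assume "U \<in> {U :: nat \<Rightarrow> 'a set. X \<subseteq> (\<Union>i. U i) \<and> (\<forall>i. bounded (U i) \<and> diameter (U i) \<le> \<delta>)}"
      then show "outer_measure (Pow UNIV) f X \<le> (\<Sum>i. hausdorff_weight d (U i))"
        using outer_measure_le[OF pos inc, of U X] by (auto simp: f_def)
    qed
    show "hausdorff_content d \<delta> X \<le> outer_measure (Pow UNIV) f X"
      unfolding outer_measure_def
    proof (rule INF_greatest)
      fix U :: "nat \<Rightarrow> 'a set"
      assume U: "U \<in> {A. range A \<subseteq> Pow UNIV \<and> disjoint_family A \<and> X \<subseteq> (\<Union>i. A i)}"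
      show "hausdorff_content d \<delta> X \<le> (\<Sum>i. f (U i))"
      proof (cases "\<forall>i. bounded (U i) \<and> diameter (U i) \<le> \<delta>")
        case True
        then show ?thesis
          using U hausdorff_content_le[of X U \<delta> d] by (auto simp: f_def)
      next
        case False
        then obtain i where "\<not> (bounded (U i) \<and> diameter (U i) \<le> \<delta>)" by blast
        then have "f (U i) = \<infinity>" by (simp only: f_def if_False)
        then have "(\<Sum>i. f (U i)) = \<infinity>"
          using sum_le_suminf[of "\<lambda>i. f (U i)" "{i}"] by (auto simp: top_unique)
        then show ?thesis by simp
      qed
    qed
  qed
qed

lemma hausdorff_content_empty [simp]: "0 \<le> \<delta> \<Longrightarrow> hausdorff_content d \<delta> {} = 0"
  using hausdorff_content_le[of "{}" "\<lambda>_. {}" \<delta> d] by (simp add: hausdorff_weight_def)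

lemma hausdorff_content_mono: "A \<subseteq> B \<Longrightarrow> hausdorff_content d \<delta> A \<le> hausdorff_content d \<delta> B"
  unfolding hausdorff_content_def by (rule INF_superset_mono) auto

lemma hausdorff_content_countably_subadditive:
  assumes "0 \<le> \<delta>"
  shows "hausdorff_content d \<delta> (\<Union>i::nat. A i) \<le> (\<Sum>i. hausdorff_content d \<delta> (A i))"
proof -
  interpret algebra "UNIV::'a set" "Pow UNIV" by (rule algebra_Pow)
  have "countably_subadditive (Pow UNIV) (hausdorff_content d \<delta> :: 'a set \<Rightarrow> ennreal)"
    unfolding hausdorff_content_eq_outer_measure(1)[OF assms]
    by (intro countably_subadditive_outer_measure hausdorff_content_eq_outer_measure assms)
  \<comment> \<open>\<open>countably_subadditive\<close> speaks of disjoint families only;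
    disjointing keeps the union and can only shrink the members.\<close>
  then have "hausdorff_content d \<delta> (\<Union>i. disjointed A i) \<le> (\<Sum>i. hausdorff_content d \<delta> (disjointed A i))"
    unfolding countably_subadditive_def using disjoint_family_disjointed[of A] by blast
  also have "\<dots> \<le> (\<Sum>i. hausdorff_content d \<delta> (A i))"
    by (intro suminf_le hausdorff_content_mono disjointed_subset) auto
  finally show ?thesis by (simp add: UN_disjointed_eq)
qed

lemma hausdorff_content_le_outer: "0 < \<delta> \<Longrightarrow> hausdorff_content d \<delta> A \<le> hausdorff_outer d A"
  unfolding hausdorff_outer_eq_SUP_content by (rule SUP_upper) auto

lemma hausdorff_outer_leI:
  "(\<And>\<delta>. 0 < \<delta> \<Longrightarrow> hausdorff_content d \<delta> A \<le> c) \<Longrightarrow> hausdorff_outer d A \<le> c"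
  unfolding hausdorff_outer_eq_SUP_content by (rule SUP_least) auto

lemma hausdorff_outer_empty [simp]: "hausdorff_outer d {} = 0"
  by (rule antisym[OF hausdorff_outer_leI]) auto

lemma hausdorff_outer_mono: "A \<subseteq> B \<Longrightarrow> hausdorff_outer d A \<le> hausdorff_outer d B"
  by (meson hausdorff_outer_leI hausdorff_content_mono hausdorff_content_le_outer order_trans)

lemma hausdorff_outer_countably_subadditive:
  "hausdorff_outer d (\<Union>i::nat. A i) \<le> (\<Sum>i. hausdorff_outer d (A i))"
proof (rule hausdorff_outer_leI)
  fix \<delta> :: real assume \<delta>: "0 < \<delta>"
  have "hausdorff_content d \<delta> (\<Union>i. A i) \<le> (\<Sum>i. hausdorff_content d \<delta> (A i))"
    using \<delta> by (intro hausdorff_content_countably_subadditive) auto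
  also have "\<dots> \<le> (\<Sum>i. hausdorff_outer d (A i))"
    using \<delta> by (intro suminf_le hausdorff_content_le_outer) auto
  finally show "hausdorff_content d \<delta> (\<Union>i. A i) \<le> (\<Sum>i. hausdorff_outer d (A i))" .
qed

lemma hausdorff_outer_subadditive:
  "hausdorff_outer d (A \<union> B) \<le> hausdorff_outer d A + hausdorff_outer d B"
proof -
  have "hausdorff_outer d (\<Union>i. binaryset A B i) \<le> (\<Sum>i. hausdorff_outer d (binaryset A B i))"
    by (rule hausdorff_outer_countably_subadditive)
  then show ?thesis
    by (subst (asm) suminf_binaryset_eq) (auto simp: UN_binaryset_eq)
qed

lemma hausdorff_outer_space: "outer_measure_space (Pow UNIV) (hausdorff_outer d)"
  by (auto simp: outer_measure_space_def positive_def increasing_def countably_subadditive_def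
        intro: hausdorff_outer_mono hausdorff_outer_countably_subadditive)

text \<open>A cover by sets of diameter below the distance of \<open>A\<close> and \<open>B\<close> splits into a cover of \<open>A\<close> and
  one of \<open>B\<close>.\<close>

lemma hausdorff_outer_separated:
  assumes "0 < \<eta>" and sep: "\<And>x y. x \<in> A \<Longrightarrow> y \<in> B \<Longrightarrow> \<eta> \<le> dist x y"
  shows "hausdorff_outer d A + hausdorff_outer d B \<le> hausdorff_outer d (A \<union> B)"
proof -
  \<comment> \<open>The two scales are independent, so that the two suprema can be pulled out of the
    sum one after the other.\<close>
  have *: "hausdorff_content d \<delta> A + hausdorff_content d \<delta>' B \<le> hausdorff_outer d (A \<union> B)"
    if \<delta>: "0 < \<delta>" "0 < \<delta>'" for \<delta> \<delta>'
  proof -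
    define \<gamma> where "\<gamma> = min (min \<delta> \<delta>') (\<eta>/2)"
    have \<gamma>: "0 < \<gamma>" "\<gamma> < \<eta>" "\<gamma> \<le> \<delta>" "\<gamma> \<le> \<delta>'" using \<delta> assms(1) by (auto simp: \<gamma>_def)
    have "hausdorff_content d \<delta> A + hausdorff_content d \<delta>' B \<le> hausdorff_content d \<gamma> (A \<union> B)"
      unfolding hausdorff_content_def[of d \<gamma>]
    proof (rule INF_greatest, clarify)
      fix U :: "nat \<Rightarrow> 'a set"
      assume cov: "A \<union> B \<subseteq> (\<Union>i. U i)" and U: "\<forall>i. bounded (U i) \<and> diameter (U i) \<le> \<gamma>"
      define V where "V i = (if U i \<inter> A = {} then {} else U i)" for i
      define W where "W i = (if U i \<inter> B = {} then {} else U i)" for i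
      have excl: "U i \<inter> A = {} \<or> U i \<inter> B = {}" for i
      proof (rule ccontr)
        assume "\<not> ?thesis"
        then obtain x y where xy: "x \<in> U i" "x \<in> A" "y \<in> U i" "y \<in> B" by auto
        then have "dist x y \<le> diameter (U i)"
          using U diameter_bounded_bound by blast
        moreover have "diameter (U i) \<le> \<gamma>" using U by auto
        ultimately show False using sep[OF xy(2,4)] \<gamma> by linarith
      qed
      have "hausdorff_content d \<delta> A \<le> (\<Sum>i. hausdorff_weight d (V i))"
      proof (rule hausdorff_content_le)
        show "A \<subseteq> (\<Union>i. V i)" using cov by (fastforce simp: V_def)
        show "bounded (V i)" "diameter (V i) \<le> \<delta>" for i
          using U[rule_format, of i] \<gamma> that by (auto simp: V_def)
      qed
      moreover have "hausdorff_content d \<delta>' B \<le> (\<Sum>i. hausdorff_weight d (W i))"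
      proof (rule hausdorff_content_le)
        show "B \<subseteq> (\<Union>i. W i)" using cov by (fastforce simp: W_def)
        show "bounded (W i)" "diameter (W i) \<le> \<delta>'" for i
          using U[rule_format, of i] \<gamma> that by (auto simp: W_def)
      qed
      ultimately have "hausdorff_content d \<delta> A + hausdorff_content d \<delta>' B \<le>
        (\<Sum>i. hausdorff_weight d (V i)) + (\<Sum>i. hausdorff_weight d (W i))"
        by (rule add_mono)
      also have "\<dots> = (\<Sum>i. hausdorff_weight d (V i) + hausdorff_weight d (W i))"
        by (rule suminf_add) auto
      also have "\<dots> \<le> (\<Sum>i. hausdorff_weight d (U i))"
        using excl by (intro suminf_le) (auto simp: V_def W_def hausdorff_weight_def)
      finally show "hausdorff_content d \<delta> A + hausdorff_content d \<delta>' B \<le> (\<Sum>i. hausdorff_weight d (U i))" .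
    qed
    also have "\<dots> \<le> hausdorff_outer d (A \<union> B)" using \<gamma> by (intro hausdorff_content_le_outer)
    finally show ?thesis .
  qed
  have **: "hausdorff_content d \<delta> A + hausdorff_outer d B \<le> hausdorff_outer d (A \<union> B)" if "0 < \<delta>" for \<delta>
    unfolding hausdorff_outer_eq_SUP_content[of d B]
    by (subst ennreal_SUP_add_right) (use * that in \<open>auto intro!: SUP_least\<close>)
  show ?thesis
    unfolding hausdorff_outer_eq_SUP_content[of d A]
    by (subst ennreal_SUP_add_left[symmetric]) (use ** in \<open>auto intro!: SUP_least\<close>)
qed

section \<open>Caratheodory's criterion for closed sets\<close>

text \<open>The sets \<open>R i\<close> are rings around \<open>F\<close>. Rings whose indices
  differ by at least two have positive distance, since a whole ring lies between them, so the outer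
  measure is additive along each parity class \<open>b\<close>.\<close>

lemma hausdorff_outer_rings:
  fixes X F :: "'a::metric_space set"
  assumes "F \<noteq> {}"
  defines "R \<equiv> (\<lambda>i::nat. {x\<in>X. 1 / (real i + 2) \<le> infdist x F \<and> infdist x F < 1 / (real i + 1)})"
  shows "(\<Sum>i<n. hausdorff_outer d (R (2*i+b))) \<le> hausdorff_outer d (\<Union>i<n. R (2*i+b))"
proof (induction n)
  case (Suc n)
  show ?case
  \<comment> \<open>For \<open>n = 0\<close> the union is empty; it is treated apart because with
    \<open>b = 0\<close> the distance bound below would divide by zero.\<close>
  proof (cases "n = 0")
    case False
    have "hausdorff_outer d (\<Union>i<n. R (2*i+b)) + hausdorff_outer d (R (2*n+b))
        \<le> hausdorff_outer d ((\<Union>i<n. R (2*i+b)) \<union> R (2*n+b))"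
    proof (rule hausdorff_outer_separated)
      show "0 < 1 / (2 * real n + b) - 1 / (2 * real n + b + 1)"
        using False by (simp add: divide_strict_left_mono)
    next
      fix x y assume x: "x \<in> (\<Union>i<n. R (2*i+b))" and y: "y \<in> R (2*n+b)"
      then obtain i where i: "i < n" "x \<in> R (2*i+b)" by auto
      have "1 / (2 * real n + b) \<le> 1 / (real (2*i+b) + 2)"
        using i(1) by (intro divide_left_mono) auto
      also have "\<dots> \<le> infdist x F" using i by (auto simp: R_def)
      finally have "1 / (2 * real n + b) \<le> infdist x F" .
      moreover have "infdist y F < 1 / (2 * real n + b + 1)"
        using y by (auto simp: R_def)
      moreover have "infdist x F \<le> infdist y F + dist x y" by (rule infdist_triangle)
      ultimately show "1 / (2 * real n + b) - 1 / (2 * real n + b + 1) \<le> dist x y" by linarith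
    qed
    then show ?thesis
      using Suc.IH by (simp add: lessThan_Suc Un_commute add.commute)
        (meson add_left_mono order_trans)
  qed (auto simp: lessThan_Suc)
qed simp

text \<open>If \<open>X\<close> has finite measure, the rings around \<open>F\<close> have a
  convergent sum of measures, each parity class contributing at most \<open>?H X\<close>. Up to a
  tail of small measure, \<open>X - F\<close> is therefore the set \<open>Y\<close> at positive
  distance from \<open>F\<close>, where additivity is already known.\<close>

lemma closed_in_hausdorff_lambda_system:
  fixes F :: "'a::metric_space set"
  assumes "closed F"
  shows "F \<in> lambda_system UNIV (Pow UNIV) (hausdorff_outer d)"
proof -
  interpret algebra "UNIV::'a set" "Pow UNIV" by (rule algebra_Pow)
  let ?H = "hausdorff_outer d"
  have "?H (X \<inter> F) + ?H (X - F) = ?H X" for X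
  proof (rule antisym)
    show "?H X \<le> ?H (X \<inter> F) + ?H (X - F)"
      using hausdorff_outer_subadditive[of d "X \<inter> F" "X - F"] by (simp add: Int_Diff_Un)
    show "?H (X \<inter> F) + ?H (X - F) \<le> ?H X"
    proof (cases "F = {} \<or> ?H X = top")
      case True
      then show ?thesis by auto
    next
      case False
      then have F: "F \<noteq> {}" and fin: "?H X < top" by (auto simp: less_top)
      define R where "R = (\<lambda>i::nat. {x\<in>X. 1 / (real i + 2) \<le> infdist x F \<and> infdist x F < 1 / (real i + 1)})"
      have Rsum: "(\<Sum>i. ?H (R (2*i+b))) \<le> ?H X" for b
      proof (rule suminf_le_const)
        fix n
        have "(\<Sum>i<n. ?H (R (2*i+b))) \<le> ?H (\<Union>i<n. R (2*i+b))"
          unfolding R_def by (rule hausdorff_outer_rings[OF F])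
        also have "\<dots> \<le> ?H X" by (rule hausdorff_outer_mono) (auto simp: R_def)
        finally show "(\<Sum>i<n. ?H (R (2*i+b))) \<le> ?H X" .
      qed simp
      have Rfin: "?H (R i) < top" for i
        using fin by (rule le_less_trans[rotated]) (auto simp: R_def intro: hausdorff_outer_mono)
      have Rsum2: "(\<Sum>i<n. ?H (R i)) \<le> ?H X + ?H X" for n
      proof -
        have "(\<Sum>i<n. ?H (R i)) \<le> (\<Sum>i<2*n. ?H (R i))"
          by (rule sum_mono2) auto
        also have "\<dots> = (\<Sum>i<n. ?H (R (2*i+0))) + (\<Sum>i<n. ?H (R (2*i+1)))"
          by (induction n) (auto simp: algebra_simps)
        also have "\<dots> \<le> (\<Sum>i. ?H (R (2*i+0))) + (\<Sum>i. ?H (R (2*i+1)))"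
          by (intro add_mono sum_le_suminf) auto
        also have "\<dots> \<le> ?H X + ?H X" using Rsum by (intro add_mono) blast+
        finally show ?thesis .
      qed
      define g where "g i = enn2real (?H (R i))" for i
      have g: "?H (R i) = ennreal (g i)" "0 \<le> g i" for i
        using Rfin[of i] by (auto simp: g_def)
      have summ: "summable g"
      proof (rule summableI_nonneg_bounded)
        fix n
        have "(\<Sum>i<n. ennreal (g i)) \<le> ?H X + ?H X"
          using Rsum2[of n] unfolding g(1) .
        moreover have "?H X + ?H X = ennreal (enn2real (?H X + ?H X))"
          using fin by (simp add: less_top[symmetric])
        ultimately have "ennreal (\<Sum>i<n. g i) \<le> ennreal (enn2real (?H X + ?H X))"
          using g(2) by (simp add: sum_ennreal)
        then show "(\<Sum>i<n. g i) \<le> enn2real (?H X + ?H X)"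
          by (rule ennreal_le_iff[THEN iffD1, rotated]) simp
      qed (use g in auto)
      show ?thesis
      proof (rule ennreal_le_epsilon)
        fix e :: real assume "0 < e"
        then obtain N where N: "\<bar>\<Sum>i. g (i + N)\<bar> < e"
          using suminf_exist_split[OF _ summ, of e] by (auto simp: real_norm_def)
        define Y where "Y = {x\<in>X. 1 / (real N + 1) \<le> infdist x F}"
        have cov: "X - F \<subseteq> Y \<union> (\<Union>i. R (i + N))"
        proof
          fix x assume x: "x \<in> X - F"
          then have pos: "0 < infdist x F"
            using in_closed_iff_infdist_zero[OF assms F, of x] infdist_nonneg[of x F] by auto
          show "x \<in> Y \<union> (\<Union>i. R (i + N))"
          proof (cases "1 / (real N + 1) \<le> infdist x F")
            case False
            \<comment> \<open>The index of the ring containing \<open>x\<close>: minimality of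
              \<open>k\<close> gives the upper bound of the ring, except for \<open>k = N\<close>,
              where the bound is the case assumption.\<close>
            define k where "k = (LEAST k. 1 / (real k + 2) \<le> infdist x F)"
            obtain k0 where "inverse (real (Suc k0)) < infdist x F" using reals_Archimedean[OF pos] by auto
            moreover have "1 / (real k0 + 2) \<le> inverse (real (Suc k0))"
              by (simp add: field_simps)
            ultimately have k0: "1 / (real k0 + 2) \<le> infdist x F" by linarith
            then have k: "1 / (real k + 2) \<le> infdist x F" unfolding k_def by (rule LeastI)
            have "k \<ge> N"
            proof (rule ccontr)
              assume "\<not> ?thesis"
              then have "1 / (real N + 1) \<le> 1 / (real k + 2)" by (intro divide_left_mono) auto
              then show False using k False by linarith
            qed
            moreover have "infdist x F < 1 / (real k + 1)"
            proof (cases "k = N")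
              case True then show ?thesis using False by simp
            next
              case neq: False
              with \<open>k \<ge> N\<close> have "k - 1 < k" "real (k - 1) + 2 = real k + 1" by auto
              have "\<not> 1 / (real (k - 1) + 2) \<le> infdist x F"
                using not_less_Least[of "k - 1" "\<lambda>k. 1 / (real k + 2) \<le> infdist x F"] \<open>k - 1 < k\<close>
                unfolding k_def[symmetric] by blast
              then show ?thesis unfolding \<open>real (k - 1) + 2 = real k + 1\<close> by linarith
            qed
            ultimately have "x \<in> R (k - N + N)" using k x by (auto simp: R_def)
            then show ?thesis by blast
          qed (use x in \<open>auto simp: Y_def\<close>)
        qed
        have "?H (X - F) \<le> ?H (Y \<union> (\<Union>i. R (i + N)))" by (rule hausdorff_outer_mono[OF cov])
        also have "\<dots> \<le> ?H Y + ?H (\<Union>i. R (i + N))" by (rule hausdorff_outer_subadditive)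
        also have "\<dots> \<le> ?H Y + (\<Sum>i. ?H (R (i + N)))"
          by (intro add_left_mono hausdorff_outer_countably_subadditive)
        also have "(\<Sum>i. ?H (R (i + N))) = ennreal (\<Sum>i. g (i + N))"
          unfolding g(1) by (rule suminf_ennreal2) (use g(2) summ in \<open>auto simp: summable_ignore_initial_segment\<close>)
        also have "?H Y + \<dots> \<le> ?H Y + ennreal e" using N by (intro add_left_mono ennreal_leI) auto
        finally have "?H (X \<inter> F) + ?H (X - F) \<le> ?H (X \<inter> F) + (?H Y + ennreal e)"
          by (rule add_left_mono)
        also have "\<dots> = (?H (X \<inter> F) + ?H Y) + ennreal e" by (simp add: add.assoc)
        also have "\<dots> \<le> ?H (X \<inter> F \<union> Y) + ennreal e"
        proof (intro add_right_mono hausdorff_outer_separated)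
          show "0 < 1 / (real N + 1)" by simp
          show "1 / (real N + 1) \<le> dist x y" if "x \<in> X \<inter> F" "y \<in> Y" for x y
            using that infdist_le[of x F y] by (auto simp: Y_def dist_commute)
        qed
        also have "\<dots> \<le> ?H X + ennreal e"
          by (intro add_right_mono hausdorff_outer_mono) (auto simp: Y_def)
        finally show "?H (X \<inter> F) + ?H (X - F) \<le> ?H X + ennreal e" .
      qed
    qed
  qed
  then show ?thesis unfolding lambda_system_eq by (intro CollectI conjI ballI) simp_all
qed

lemma sets_hausdorff_measure [simp, measurable_cong]:
  "sets (hausdorff_measure d :: 'a::metric_space measure) = sets borel"
proof -
  have "sets (hausdorff_measure d :: 'a measure) = sigma_sets UNIV (sets borel)"
    unfolding hausdorff_measure_def by (rule sets_measure_of) auto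
  also have "\<dots> = sets borel"
    using sets.sigma_sets_eq[of "borel :: 'a measure"] unfolding space_borel .
  finally show ?thesis .
qed

lemma space_hausdorff_measure [simp]: "space (hausdorff_measure d) = UNIV"
  using sets_eq_imp_space_eq[OF sets_hausdorff_measure] by simp

text \<open>Caratheodory's lemma yields a measure on the lambda system, a sigma-algebra that
  contains the closed sets and hence the Borel sets. Restricted to these it is a genuine measure,
  the condition under which \<open>measure_of\<close> keeps the given values.\<close>

lemma emeasure_hausdorff_measure:
  fixes A :: "'a::metric_space set"
  assumes "A \<in> sets borel"
  shows "emeasure (hausdorff_measure d) A = hausdorff_outer d A"
proof -
  interpret sigma_algebra "UNIV::'a set" "Pow UNIV" by (rule sigma_algebra_Pow)
  define L where "L = lambda_system UNIV (Pow (UNIV::'a set)) (hausdorff_outer d)"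
  have L: "measure_space UNIV L (hausdorff_outer d)"
    unfolding L_def by (rule caratheodory_lemma[OF hausdorff_outer_space])
  then have sL: "sigma_algebra UNIV L" by (simp add: measure_space_def)
  have "sigma_sets UNIV (Collect closed) \<subseteq> L"
    using closed_in_hausdorff_lambda_system[of _ d]
    by (intro sigma_algebra.sigma_sets_subset[OF sL]) (auto simp: L_def)
  then have "sets borel \<subseteq> L"
    by (simp add: borel_eq_closed)
  then have "measure_space UNIV (sets (borel::'a measure)) (hausdorff_outer d)"
    using measure_down[OF L] sets.sigma_algebra_axioms[of "borel :: 'a measure"] by simp
  then have "sigma_algebra UNIV (sets (borel::'a measure))"
    "positive (sets (borel::'a measure)) (hausdorff_outer d)"
    "countably_additive (sets (borel::'a measure)) (hausdorff_outer d)"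
    unfolding measure_space_def by blast+
  then show ?thesis
    unfolding hausdorff_measure_def by (rule emeasure_measure_of_sigma) (rule assms)
qed

text \<open>A cover of \<open>S\<close> by sets \<open>U i\<close> is turned into a cover of the
  image by the images of \<open>S \<inter> U i\<close>, because the Lipschitz bound holds on
  \<open>S\<close> only. Diameters grow by at most \<open>L\<close>, weights by
  \<open>L ^ d\<close>.\<close>

lemma hausdorff_outer_Lipschitz:
  fixes f :: "'a::metric_space \<Rightarrow> 'b::metric_space"
  assumes "0 < L" and lip: "\<And>x y. x \<in> S \<Longrightarrow> y \<in> S \<Longrightarrow> dist (f x) (f y) \<le> L * dist x y"
  shows "hausdorff_outer d (f ` S) \<le> ennreal (L ^ d) * hausdorff_outer d S"
proof (rule hausdorff_outer_leI)
  fix \<delta> :: real assume \<delta>: "0 < \<delta>"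
  have "hausdorff_content d \<delta> (f ` S) \<le> ennreal (L ^ d) * hausdorff_content d (\<delta> / L) S"
  proof -
    have "hausdorff_content d \<delta> (f ` S) \<le> ennreal (L ^ d) * (\<Sum>i. hausdorff_weight d (U i))"
      if U: "S \<subseteq> (\<Union>i. U i)" "\<And>i. bounded (U i)" "\<And>i. diameter (U i) \<le> \<delta> / L" for U :: "nat \<Rightarrow> 'a set"
    proof -
      have dist: "dist x y \<le> L * diameter (U i)" if xy: "x \<in> f ` (S \<inter> U i)" "y \<in> f ` (S \<inter> U i)" for x y i
      proof -
        obtain x' y' where *: "x' \<in> S" "x' \<in> U i" "y' \<in> S" "y' \<in> U i" "x = f x'" "y = f y'"
          using xy by blast
        then have "dist x y \<le> L * dist x' y'" using lip[of x' y'] by simp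
        also have "\<dots> \<le> L * diameter (U i)"
          using * U(2) assms(1) by (intro mult_left_mono diameter_bounded_bound) simp_all
        finally show ?thesis .
      qed
      have bdd: "bounded (f ` (S \<inter> U i))" for i
        unfolding bounded_two_points using dist by blast
      have diam: "diameter (f ` (S \<inter> U i)) \<le> L * diameter (U i)" for i
      proof (cases "f ` (S \<inter> U i) = {}")
        case True
        then show ?thesis using assms(1) U(2) diameter_ge_0[of "U i"] by simp
      next
        case False
        then show ?thesis using dist unfolding diameter_def[of "f ` (S \<inter> U i)"]
          by (simp only: if_False) (rule cSUP_least, blast, simp add: case_prod_beta mem_Times_iff)
      qed
      have "hausdorff_content d \<delta> (f ` S) \<le> (\<Sum>i. hausdorff_weight d (f ` (S \<inter> U i)))"
      proof (rule hausdorff_content_le)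
        show "f ` S \<subseteq> (\<Union>i. f ` (S \<inter> U i))" using U(1) by blast
        show "diameter (f ` (S \<inter> U i)) \<le> \<delta>" for i
          using diam[of i] mult_left_mono[OF U(3)[of i], of L] assms(1) by simp
      qed (use bdd in auto)
      also have "\<dots> \<le> (\<Sum>i. ennreal (L ^ d) * hausdorff_weight d (U i))"
      proof (rule suminf_le)
        fix i
        have "unit_ball_vol (real d) * (diameter (f ` (S \<inter> U i)) / 2) ^ d
           \<le> unit_ball_vol (real d) * (L * diameter (U i) / 2) ^ d"
          using diam[of i] bdd[of i] diameter_ge_0[of "f ` (S \<inter> U i)"]
          by (intro mult_left_mono power_mono divide_right_mono) auto
        also have "\<dots> = L ^ d * (unit_ball_vol (real d) * (diameter (U i) / 2) ^ d)"
          by (simp add: power_mult_distrib power_divide)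
        finally show "hausdorff_weight d (f ` (S \<inter> U i)) \<le> ennreal (L ^ d) * hausdorff_weight d (U i)"
          using assms(1) by (auto simp: hausdorff_weight_def ennreal_mult'[symmetric] intro!: ennreal_leI)
      qed auto
      finally show ?thesis by simp
    qed
    \<comment> \<open>The constant is moved to the left so that the infimum over covers can be taken
      on a bare right-hand side.\<close>
    then have "ennreal (1 / L ^ d) * hausdorff_content d \<delta> (f ` S) \<le> ennreal (1 / L ^ d) * (ennreal (L ^ d) * (\<Sum>i. hausdorff_weight d (U i)))"
      if "S \<subseteq> (\<Union>i. U i)" "\<And>i. bounded (U i)" "\<And>i. diameter (U i) \<le> \<delta> / L" for U :: "nat \<Rightarrow> 'a set"
      using that by (intro mult_left_mono) auto
    moreover have inv: "ennreal (1 / L ^ d) * (ennreal (L ^ d) * x) = x" "ennreal (L ^ d) * (ennreal (1 / L ^ d) * x) = x" for x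
      using assms(1) by (simp_all add: mult.assoc[symmetric] ennreal_mult'[symmetric])
    ultimately have "ennreal (1 / L ^ d) * hausdorff_content d \<delta> (f ` S) \<le> hausdorff_content d (\<delta> / L) S"
      unfolding hausdorff_content_def[of d "\<delta> / L"] by (intro INF_greatest) auto
    then show ?thesis
      by (metis inv(2) mult_left_mono zero_le)
  qed
  also have "\<dots> \<le> ennreal (L ^ d) * hausdorff_outer d S"
    using \<delta> assms(1) by (intro mult_left_mono hausdorff_content_le_outer) auto
  finally show "hausdorff_content d \<delta> (f ` S) \<le> ennreal (L ^ d) * hausdorff_outer d S" .
qed

lemma hausdorff_outer_isometry:
  assumes "\<And>x y. x \<in> S \<Longrightarrow> y \<in> S \<Longrightarrow> dist (f x) (f y) = dist x y"
  shows "hausdorff_outer d (f ` S) = hausdorff_outer d S"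
proof (rule antisym)
  show "hausdorff_outer d (f ` S) \<le> hausdorff_outer d S"
    using hausdorff_outer_Lipschitz[of 1 S f d] assms by simp
  have "inj_on f S" using assms by (metis dist_eq_0_iff inj_onI)
  then have S: "S = inv_into S f ` f ` S" by (simp add: inv_into_image_cancel)
  have "hausdorff_outer d (inv_into S f ` f ` S) \<le> ennreal (1 ^ d) * hausdorff_outer d (f ` S)"
  proof (rule hausdorff_outer_Lipschitz)
    fix x y assume "x \<in> f ` S" "y \<in> f ` S"
    then show "dist (inv_into S f x) (inv_into S f y) \<le> 1 * dist x y"
      using assms[of "inv_into S f x" "inv_into S f y"] by (simp add: inv_into_into f_inv_into_f)
  qed simp
  then show "hausdorff_outer d S \<le> hausdorff_outer d (f ` S)" using S by simp
qed

subsection \<open>The isodiametric inequality\<close>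

text \<open>Written as a union of translates of \<open>B\<close>, so that openness of
  \<open>B\<close> alone makes the sum open.\<close>

definition minkowski_sum :: "'a::euclidean_space set \<Rightarrow> 'a set \<Rightarrow> 'a set" where
  "minkowski_sum A B = (\<Union>x\<in>A. (+) x ` B)"

text \<open>The cardinality of a family is the induction measure for Brunn--Minkowski. Nonempty
  members guarantee positive volume; open members make the union open.\<close>

definition box_family :: "'a::euclidean_space set set \<Rightarrow> bool" where
  "box_family \<A> \<longleftrightarrow> finite \<A> \<and> (\<forall>Q\<in>\<A>. Q \<noteq> {} \<and> (\<exists>a b. Q = box a b)) \<and> pairwise disjnt \<A>"

lemma minkowski_sum_iff: "z \<in> minkowski_sum A B \<longleftrightarrow> (\<exists>x\<in>A. \<exists>y\<in>B. z = x + y)"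
  by (auto simp: minkowski_sum_def)

lemma minkowski_sum_commute: "minkowski_sum A B = minkowski_sum B A"
  by (auto simp: minkowski_sum_iff set_eq_iff add.commute) (metis add.commute)+

lemma open_minkowski_sum: "open B \<Longrightarrow> open (minkowski_sum A B)"
  by (auto simp: minkowski_sum_def intro: open_translation)

lemma bounded_minkowski_sum: "bounded A \<Longrightarrow> bounded B \<Longrightarrow> bounded (minkowski_sum A B)"
proof -
  assume "bounded A" "bounded B"
  then obtain a b where "\<forall>x\<in>A. norm x \<le> a" "\<forall>x\<in>B. norm x \<le> b" by (auto simp: bounded_iff)
  then show ?thesis
    unfolding bounded_iff by (intro exI[of _ "a + b"]) (auto simp: minkowski_sum_iff intro!: norm_triangle_mono)
qed

section \<open>Cutting boxes by coordinate hyperplanes\<close>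

lemma box_Int_halfspace_le:
  assumes "i \<in> Basis"
  shows "box a b \<inter> {x. x \<bullet> i < c} = box a (b + (min (b \<bullet> i) c - b \<bullet> i) *\<^sub>R i)"
proof -
  have "x \<bullet> j < (b + (min (b \<bullet> i) c - b \<bullet> i) *\<^sub>R i) \<bullet> j \<longleftrightarrow> x \<bullet> j < b \<bullet> j \<and> (j = i \<longrightarrow> x \<bullet> i < c)"
    if "j \<in> Basis" for x j
    using assms that by (auto simp: inner_add_left inner_Basis)
  then show ?thesis
    using assms by (auto simp: mem_box set_eq_iff)
qed

lemma box_Int_halfspace_ge:
  assumes "i \<in> Basis"
  shows "box a b \<inter> {x. x \<bullet> i > c} = box (a + (max (a \<bullet> i) c - a \<bullet> i) *\<^sub>R i) b"
proof -
  have "(a + (max (a \<bullet> i) c - a \<bullet> i) *\<^sub>R i) \<bullet> j < x \<bullet> j \<longleftrightarrow> a \<bullet> j < x \<bullet> j \<and> (j = i \<longrightarrow> c < x \<bullet> i)"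
    if "j \<in> Basis" for x j
    using assms that by (auto simp: inner_add_left inner_Basis)
  then show ?thesis
    using assms by (auto simp: mem_box set_eq_iff)
qed

text \<open>The value is explicit in \<open>t\<close>, so that continuity of the cut-off volume,
  required by the intermediate value theorem, can be read off.\<close>

lemma measure_box_Int_halfspace:
  assumes i: "i \<in> Basis" and ne: "box a b \<noteq> {}"
  shows "measure lborel (box a b \<inter> {x. x \<bullet> i < t}) =
    max 0 (min (b \<bullet> i) t - a \<bullet> i) * (\<Prod>j\<in>Basis - {i}. (b - a) \<bullet> j)"
proof -
  let ?b = "b + (min (b \<bullet> i) t - b \<bullet> i) *\<^sub>R i"
  have ab: "a \<bullet> j < b \<bullet> j" if "j \<in> Basis" for j using ne that by (auto simp: box_ne_empty)
  have b: "?b \<bullet> j = (if j = i then min (b \<bullet> i) t else b \<bullet> j)" if "j \<in> Basis" for j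
    using i that by (auto simp: inner_add_left inner_Basis)
  show ?thesis
  proof (cases "a \<bullet> i \<le> min (b \<bullet> i) t")
    case True
    then have "\<forall>j\<in>Basis. a \<bullet> j \<le> ?b \<bullet> j" using ab b by (simp add: less_imp_le)
    then have "measure lborel (box a ?b) = (\<Prod>j\<in>Basis. (?b - a) \<bullet> j)"
      by (simp add: measure_lborel_box_eq)
    also have "\<dots> = (?b - a) \<bullet> i * (\<Prod>j\<in>Basis - {i}. (?b - a) \<bullet> j)"
      using i by (simp add: prod.remove)
    also have "(\<Prod>j\<in>Basis - {i}. (?b - a) \<bullet> j) = (\<Prod>j\<in>Basis - {i}. (b - a) \<bullet> j)"
      by (intro prod.cong refl) (use b in \<open>auto simp: inner_diff_left\<close>)
    also have "(?b - a) \<bullet> i = max 0 (min (b \<bullet> i) t - a \<bullet> i)"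
      using True b i by (simp add: inner_diff_left)
    finally show ?thesis unfolding box_Int_halfspace_le[OF i] .
  next
    case False
    then have "box a ?b = {}" using b[OF i] i unfolding box_eq_empty by (intro bexI[of _ i]) auto
    then have "measure lborel (box a ?b) = 0" by simp
    moreover have "max 0 (min (b \<bullet> i) t - a \<bullet> i) = 0" using False by linarith
    ultimately show ?thesis unfolding box_Int_halfspace_le[OF i] by simp
  qed
qed

lemma box_familyE:
  assumes "box_family \<A>" "Q \<in> \<A>"
  obtains a b where "Q = box a b" "box a b \<noteq> {}"
  using assms unfolding box_family_def by blast

lemma box_family_bounded: "box_family \<A> \<Longrightarrow> bounded (\<Union>\<A>)"
  by (rule bounded_Union) (auto simp: box_family_def)

lemma box_family_open: "box_family \<A> \<Longrightarrow> open (\<Union>\<A>)"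
  by (rule open_Union) (auto simp: box_family_def)

lemma bounded_borel_fmeasurable:
  "bounded S \<Longrightarrow> S \<in> sets borel \<Longrightarrow> S \<in> fmeasurable (lborel :: 'a::euclidean_space measure)"
  using emeasure_bounded_finite[of S] by (simp add: fmeasurable_def)

lemma box_family_measure_pos:
  assumes "box_family \<A>" "\<A> \<noteq> {}"
  shows "0 < measure lborel (\<Union>\<A>)"
proof -
  obtain Q where Q: "Q \<in> \<A>" using assms by auto
  then obtain a b where ab: "Q = box a b" "box a b \<noteq> {}" using assms(1) by (elim box_familyE)
  have lt: "a \<bullet> j < b \<bullet> j" if "j \<in> Basis" for j using ab that by (auto simp: box_ne_empty)
  then have "0 < measure lborel Q"
    unfolding ab(1) measure_lborel_box_eq by (auto intro!: prod_pos simp: inner_diff_left less_imp_le)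
  also have "\<dots> \<le> measure lborel (\<Union>\<A>)"
    using assms Q box_family_open[OF assms(1)] box_family_bounded[OF assms(1)]
    by (intro measure_mono_fmeasurable bounded_borel_fmeasurable) (auto simp: ab(1))
  finally show ?thesis .
qed

lemma continuous_measure_box_family_halfspace:
  assumes "box_family \<A>" "i \<in> Basis"
  shows "continuous_on UNIV (\<lambda>t. measure lborel (\<Union>\<A> \<inter> {x. x \<bullet> i < t}))"
proof -
  have fin: "finite \<A>" and disj: "pairwise disjnt \<A>" using assms by (auto simp: box_family_def)
  have "measure lborel (\<Union>\<A> \<inter> {x. x \<bullet> i < t}) = (\<Sum>Q\<in>\<A>. measure lborel (Q \<inter> {x. x \<bullet> i < t}))" for t
  proof -
    have "measure lborel (\<Union>Q\<in>\<A>. Q \<inter> {x. x \<bullet> i < t}) = (\<Sum>Q\<in>\<A>. measure lborel (Q \<inter> {x. x \<bullet> i < t}))"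
    proof (rule measure_finite_Union[OF fin])
      show "(\<lambda>Q. Q \<inter> {x. x \<bullet> i < t}) ` \<A> \<subseteq> sets lborel"
        using assms(1) by (auto simp: box_family_def)
      show "disjoint_family_on (\<lambda>Q. Q \<inter> {x. x \<bullet> i < t}) \<A>"
        using disj by (auto simp: disjoint_family_on_def pairwise_def disjnt_def)
      show "emeasure lborel (Q \<inter> {x. x \<bullet> i < t}) \<noteq> \<infinity>" if "Q \<in> \<A>" for Q
      proof -
        have "bounded (Q \<inter> {x. x \<bullet> i < t})"
          using that assms(1) by (auto simp: box_family_def intro!: bounded_Int)
        then show ?thesis using emeasure_bounded_finite[of "Q \<inter> {x. x \<bullet> i < t}"] by auto
      qed
    qed
    also have "(\<Union>Q\<in>\<A>. Q \<inter> {x. x \<bullet> i < t}) = \<Union>\<A> \<inter> {x. x \<bullet> i < t}" by blast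
    finally show ?thesis .
  qed
  moreover have "continuous_on UNIV (\<lambda>t. measure lborel (Q \<inter> {x. x \<bullet> i < t}))" if Q: "Q \<in> \<A>" for Q
  proof -
    obtain a b where ab: "Q = box a b" "box a b \<noteq> {}" using assms(1) Q by (elim box_familyE)
    then show ?thesis unfolding ab(1) measure_box_Int_halfspace[OF assms(2) ab(2)]
      by (intro continuous_intros)
  qed
  ultimately show ?thesis by (simp add: continuous_on_sum)
qed

section \<open>The midpoint Brunn--Minkowski inequality for unions of boxes\<close>

lemma box_plus_box:
  fixes a b c d :: "'a::euclidean_space"
  assumes "box a b \<noteq> {}" "box c d \<noteq> {}"
  shows "box (a + c) (b + d) \<subseteq> minkowski_sum (box a b) (box c d)"
proof
  fix z assume z: "z \<in> box (a + c) (b + d)"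
  have ab: "a \<bullet> j < b \<bullet> j" "c \<bullet> j < d \<bullet> j" if "j \<in> Basis" for j using assms that by (auto simp: box_ne_empty)
  \<comment> \<open>The relative position of \<open>z\<close> along each axis; \<open>x\<close> and
    \<open>y\<close> take this same position in their own boxes, and their sum is then
    \<open>z\<close>.\<close>
  define w where "w j = (z - a - c) \<bullet> j / ((b - a + d - c) \<bullet> j)" for j
  have w: "0 < w j" "w j < 1" if "j \<in> Basis" for j
    using z ab[OF that] that by (auto simp: w_def mem_box inner_diff_left inner_add_left)
  have zj: "z \<bullet> j = a \<bullet> j + w j * ((b - a) \<bullet> j) + (c \<bullet> j + w j * ((d - c) \<bullet> j))" if "j \<in> Basis" for j
  proof -
    have "w j * ((b - a + d - c) \<bullet> j) = (z - a - c) \<bullet> j"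
      using ab[OF that] unfolding w_def by (simp add: inner_diff_left inner_add_left)
    then show ?thesis by (simp add: inner_diff_left inner_add_left algebra_simps)
  qed
  define x where "x = (\<Sum>j\<in>Basis. (a \<bullet> j + w j * ((b - a) \<bullet> j)) *\<^sub>R j)"
  define y where "y = (\<Sum>j\<in>Basis. (c \<bullet> j + w j * ((d - c) \<bullet> j)) *\<^sub>R j)"
  have xj: "x \<bullet> j = a \<bullet> j + w j * ((b - a) \<bullet> j)" "y \<bullet> j = c \<bullet> j + w j * ((d - c) \<bullet> j)" if "j \<in> Basis" for j
    using that by (simp_all add: x_def y_def)
  have mid: "p < p + s * (q - p) \<and> p + s * (q - p) < q" if "0 < s" "s < 1" "p < q" for p q s :: real
  proof -
    have "0 < s * (q - p)" "s * (q - p) < 1 * (q - p)"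
      using that by (auto intro: mult_strict_right_mono)
    then show ?thesis by simp
  qed
  have "x \<in> box a b" "y \<in> box c d"
    using mid w ab by (simp_all add: mem_box xj inner_diff_left)
  moreover have "z = x + y"
    by (rule euclidean_eqI) (simp add: xj zj inner_add_left)
  ultimately show "z \<in> minkowski_sum (box a b) (box c d)" by (auto simp: minkowski_sum_iff)
qed

text \<open>The inequality of arithmetic and geometric means, applied to the two side lengths in
  every coordinate and multiplied up.\<close>

lemma brunn_minkowski_boxes:
  fixes a b c d :: "'a::euclidean_space"
  assumes "box a b \<noteq> {}" "box c d \<noteq> {}"
  shows "2 ^ DIM('a) * sqrt (measure lborel (box a b) * measure lborel (box c d))
    \<le> measure lborel (minkowski_sum (box a b) (box c d))"
proof -
  have ab: "a \<bullet> j < b \<bullet> j" "c \<bullet> j < d \<bullet> j" if "j \<in> Basis" for j using assms that by (auto simp: box_ne_empty)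
  have sqrt_prod: "sqrt (prod f A) = (\<Prod>x\<in>A. sqrt (f x))" for f and A :: "'a set"
    by (induction A rule: infinite_finite_induct) (auto simp: real_sqrt_mult)
  have "2 ^ DIM('a) * sqrt (measure lborel (box a b) * measure lborel (box c d)) =
     (\<Prod>j\<in>Basis. 2 * sqrt (((b - a) \<bullet> j) * ((d - c) \<bullet> j)))"
    using ab by (simp add: measure_lborel_box_eq less_imp_le prod.distrib real_sqrt_mult sqrt_prod)
  also have "\<dots> \<le> (\<Prod>j\<in>Basis. (b + d - (a + c)) \<bullet> j)"
  proof (intro prod_mono conjI)
    fix j :: 'a assume j: "j \<in> Basis"
    then show "0 \<le> 2 * sqrt (((b - a) \<bullet> j) * ((d - c) \<bullet> j))"
      using ab[of j] by (simp add: inner_diff_left)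
    show "2 * sqrt (((b - a) \<bullet> j) * ((d - c) \<bullet> j)) \<le> (b + d - (a + c)) \<bullet> j"
      using arith_geo_mean_sqrt[of "(b - a) \<bullet> j" "(d - c) \<bullet> j"] ab[OF j]
      by (simp add: inner_diff_left inner_add_left)
  qed
  also have "\<dots> = measure lborel (box (a + c) (b + d))"
    using ab by (simp add: measure_lborel_box_eq less_imp_le inner_add_left add_mono)
  also have "\<dots> \<le> measure lborel (minkowski_sum (box a b) (box c d))"
    using box_plus_box[OF assms]
    by (intro measure_mono_fmeasurable bounded_borel_fmeasurable bounded_minkowski_sum)
      (auto intro: borel_open open_minkowski_sum)
  finally show ?thesis .
qed

text \<open>Empty pieces are dropped, so that the family becomes strictly smaller as soon as
  \<open>H\<close> misses one of its boxes.\<close>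

definition cut_family :: "'a::euclidean_space set \<Rightarrow> 'a set set \<Rightarrow> 'a set set" where
  "cut_family H \<A> = (\<lambda>Q. Q \<inter> H) ` \<A> - {{}}"

lemma Union_cut_family: "\<Union>(cut_family H \<A>) = \<Union>\<A> \<inter> H"
  by (auto simp: cut_family_def)

lemma card_cut_family_le: "finite \<A> \<Longrightarrow> card (cut_family H \<A>) \<le> card \<A>"
  unfolding cut_family_def by (meson card_Diff1_le card_image_le order_trans)

lemma card_cut_family_less:
  assumes "finite \<A>" "Q \<in> \<A>" "Q \<inter> H = {}"
  shows "card (cut_family H \<A>) < card \<A>"
proof -
  have "card (cut_family H \<A>) \<le> card ((\<lambda>Q. Q \<inter> H) ` (\<A> - {Q}))"
    using assms by (intro card_mono) (auto simp: cut_family_def)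
  also have "\<dots> \<le> card (\<A> - {Q})" using assms by (intro card_image_le) auto
  also have "\<dots> < card \<A>" using assms by (intro card_Diff1_less)
  finally show ?thesis .
qed

lemma box_family_cut:
  assumes "box_family \<A>" "i \<in> Basis"
  shows "box_family (cut_family {x. x \<bullet> i < c} \<A>)" "box_family (cut_family {x. x \<bullet> i > c} \<A>)"
proof -
  have "pairwise disjnt (cut_family H \<A>)" for H
    using assms(1) unfolding cut_family_def pairwise_def box_family_def disjnt_def by blast
  then show "box_family (cut_family {x. x \<bullet> i < c} \<A>)" "box_family (cut_family {x. x \<bullet> i > c} \<A>)"
    using assms(1) box_Int_halfspace_le[OF assms(2)] box_Int_halfspace_ge[OF assms(2)]
    unfolding box_family_def by (auto simp: cut_family_def) metis+
qed

lemma measure_split_hyperplane: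
  fixes S :: "'a::euclidean_space set"
  assumes "i \<in> Basis" "S \<in> fmeasurable lborel"
  shows "measure lborel (S \<inter> {x. x \<bullet> i < c}) + measure lborel (S \<inter> {x. x \<bullet> i > c}) = measure lborel S"
proof -
  have "negligible {x::'a. i \<bullet> x = c}"
    using assms by (intro negligible_hyperplane) auto
  then have null: "{x::'a. x \<bullet> i = c} \<in> null_sets lborel"
    by (auto simp: negligible_iff_null_sets null_sets_completion_iff inner_commute borel_closed closed_hyperplane)
  have "S \<in> sets borel" using assms(2) by (auto simp: fmeasurable_def)
  then have sets: "S \<inter> {x. x \<bullet> i < c} \<in> sets borel" "S \<inter> {x. x \<bullet> i > c} \<in> sets borel"
    by (auto intro!: sets.Int borel_open simp: open_halfspace_component_lt open_halfspace_component_gt)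
  have "measure lborel S = measure lborel (S \<inter> {x. x \<bullet> i < c} \<union> S \<inter> {x. x \<bullet> i > c} \<union> S \<inter> {x. x \<bullet> i = c})"
    by (rule arg_cong[where f="measure lborel"]) auto
  also have "\<dots> = measure lborel (S \<inter> {x. x \<bullet> i < c} \<union> S \<inter> {x. x \<bullet> i > c})"
  proof (rule measure_Un_null_set)
    show "S \<inter> {x. x \<bullet> i = c} \<in> null_sets lborel"
      using null \<open>S \<in> sets borel\<close> by (intro null_set_Int1) auto
    show "S \<inter> {x. x \<bullet> i < c} \<union> S \<inter> {x. x \<bullet> i > c} \<in> sets lborel"
      using sets by (metis sets.Un sets_lborel)
  qed
  also have "\<dots> = measure lborel (S \<inter> {x. x \<bullet> i < c}) + measure lborel (S \<inter> {x. x \<bullet> i > c})"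
  proof -
    have "S \<inter> {x. x \<bullet> i < c} \<in> fmeasurable lborel" "S \<inter> {x. x \<bullet> i > c} \<in> fmeasurable lborel"
      using sets by (auto intro!: fmeasurableI2[OF assms(2)])
    moreover have "S \<inter> {x. x \<bullet> i > c} - S \<inter> {x. x \<bullet> i < c} = S \<inter> {x. x \<bullet> i > c}" by force
    ultimately show ?thesis by (simp only: measure_Un2)
  qed
  finally show ?thesis ..
qed

text \<open>The hyperplane separates two boxes of \<open>\<A>\<close>; a parallel one divides the volume of \<open>\<B>\<close> in the same
  ratio. The sums of corresponding halves lie on different sides of a third hyperplane.\<close>

lemma brunn_minkowski_cut:
  fixes \<A> \<B> :: "'a::euclidean_space set set"
  assumes \<A>: "box_family \<A>" "2 \<le> card \<A>" and \<B>: "box_family \<B>" "\<B> \<noteq> {}"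
    and IH: "\<And>\<A>' \<B>' :: 'a set set. box_family \<A>' \<Longrightarrow> \<A>' \<noteq> {} \<Longrightarrow> box_family \<B>' \<Longrightarrow> \<B>' \<noteq> {} \<Longrightarrow>
       card \<A>' < card \<A> \<Longrightarrow> card \<B>' \<le> card \<B> \<Longrightarrow>
       2 ^ DIM('a) * sqrt (measure lborel (\<Union>\<A>') * measure lborel (\<Union>\<B>'))
         \<le> measure lborel (minkowski_sum (\<Union>\<A>') (\<Union>\<B>'))"
  shows "2 ^ DIM('a) * sqrt (measure lborel (\<Union>\<A>) * measure lborel (\<Union>\<B>))
         \<le> measure lborel (minkowski_sum (\<Union>\<A>) (\<Union>\<B>))"
proof -
  have fin: "finite \<A>" "finite \<B>" using \<A> \<B> by (auto simp: box_family_def)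
  obtain P Q where PQ: "P \<in> \<A>" "Q \<in> \<A>" "P \<noteq> Q"
    using \<A>(2) by (metis One_nat_def Suc_1 card_le_Suc0_iff_eq fin(1) not_less_eq_eq)
  obtain a b where ab1: "P = box a b" "P \<noteq> {}" using \<A>(1) PQ(1) by (metis box_familyE)
  obtain a' b' where "Q = box a' b'" "Q \<noteq> {}" using \<A>(1) PQ(2) by (metis box_familyE)
  note ab = ab1 this
  have "P \<inter> Q = {}" using PQ \<A>(1) by (auto simp: box_family_def pairwise_def disjnt_def)
  then obtain i where i: "i \<in> Basis" "b \<bullet> i \<le> a' \<bullet> i \<or> b' \<bullet> i \<le> a \<bullet> i"
    using ab unfolding ab disjoint_interval(4) by (force simp: box_ne_empty)
  \<comment> \<open>Either open side of the hyperplane misses one of the two boxes, so both halves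
    of \<A> have fewer boxes than \<A> itself.\<close>
  obtain c where c: "P \<inter> {x. x \<bullet> i > c} = {} \<and> Q \<inter> {x. x \<bullet> i < c} = {} \<or>
      Q \<inter> {x. x \<bullet> i > c} = {} \<and> P \<inter> {x. x \<bullet> i < c} = {}"
  proof (cases "b \<bullet> i \<le> a' \<bullet> i")
    case True
    then show ?thesis using i(1) by (intro that[of "b \<bullet> i"]) (force simp: ab mem_box)
  next
    case False
    then show ?thesis using i by (intro that[of "b' \<bullet> i"]) (force simp: ab mem_box)
  qed
  define L where "L s = {x::'a. x \<bullet> i < s}" for s
  define R where "R s = {x::'a. x \<bullet> i > s}" for s
  let ?\<mu> = "measure (lborel :: 'a measure)"
  define \<alpha> where "\<alpha> = ?\<mu> (\<Union>\<A>)"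
  define \<beta> where "\<beta> = ?\<mu> (\<Union>\<B>)"
  have AL: "box_family (cut_family (L c) \<A>)" "box_family (cut_family (R c) \<A>)"
    using box_family_cut[OF \<A>(1) i(1)] by (auto simp: L_def R_def)
  have BL: "box_family (cut_family (L s) \<B>)" "box_family (cut_family (R s) \<B>)" for s
    using box_family_cut[OF \<B>(1) i(1)] by (auto simp: L_def R_def)
  have cards: "card (cut_family (L c) \<A>) < card \<A>" "card (cut_family (R c) \<A>) < card \<A>"
    using c PQ fin by (auto simp: L_def R_def intro: card_cut_family_less)
  have meas: "\<Union>\<A> \<in> fmeasurable lborel" "\<Union>\<B> \<in> fmeasurable lborel"
    using \<A> \<B> by (auto intro!: bounded_borel_fmeasurable box_family_bounded box_family_open borel_open)
  have split: "?\<mu> (\<Union>\<A> \<inter> L c) + ?\<mu> (\<Union>\<A> \<inter> R c) = \<alpha>" "?\<mu> (\<Union>\<B> \<inter> L s) + ?\<mu> (\<Union>\<B> \<inter> R s) = \<beta>" for s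
    unfolding L_def R_def \<alpha>_def \<beta>_def by (intro measure_split_hyperplane i meas)+
  \<comment> \<open>A nonempty open set cannot lie in a hyperplane, so \<open>P\<close> and
    \<open>Q\<close> contribute points to opposite open sides and neither half of \<A> is
    empty.\<close>
  have ne: "T \<inter> {x. x \<bullet> i \<noteq> c} \<noteq> {}" if "open T" "T \<noteq> {}" for T :: "'a set"
  proof
    assume "T \<inter> {x. x \<bullet> i \<noteq> c} = {}"
    then have "T \<subseteq> {x. i \<bullet> x = c}" by (auto simp: inner_commute)
    then have "T \<subseteq> interior {x. i \<bullet> x = c}" using that by (simp add: interior_maximal)
    then show False using that i(1) interior_hyperplane[of i c] by (simp add: nonzero_Basis)
  qed
  obtain x where x: "x \<in> P" "x \<bullet> i \<noteq> c" using ne[of P] ab by auto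
  obtain y where y: "y \<in> Q" "y \<bullet> i \<noteq> c" using ne[of Q] ab by auto
  have "x \<in> L c \<and> y \<in> R c \<or> x \<in> R c \<and> y \<in> L c"
    using x y c unfolding L_def R_def by (auto simp: disjoint_iff neq_iff)
  then have "\<Union>\<A> \<inter> L c \<noteq> {}" "\<Union>\<A> \<inter> R c \<noteq> {}" using x(1) y(1) PQ(1,2) by blast+
  then have neA: "cut_family (L c) \<A> \<noteq> {}" "cut_family (R c) \<A> \<noteq> {}"
    unfolding Union_cut_family[symmetric] by auto
  have posA: "0 < ?\<mu> (\<Union>\<A> \<inter> L c)" "0 < ?\<mu> (\<Union>\<A> \<inter> R c)"
    using box_family_measure_pos[OF AL(1) neA(1)] box_family_measure_pos[OF AL(2) neA(2)]
    by (auto simp: Union_cut_family)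
  have \<beta>: "0 < \<beta>" unfolding \<beta>_def using \<B> by (rule box_family_measure_pos)
  have \<alpha>: "0 < \<alpha>" using split(1) posA by linarith
  \<comment> \<open>The ratio in which the first hyperplane divides \<A>; the intermediate value
    theorem supplies a parallel hyperplane at height \<open>t\<close> dividing \<B> in the same
    ratio.\<close>
  define \<theta> where "\<theta> = ?\<mu> (\<Union>\<A> \<inter> L c) / \<alpha>"
  have \<theta>: "0 < \<theta>" "\<theta> < 1" using posA split(1) \<alpha> by (auto simp: \<theta>_def field_simps)
  obtain t where t: "?\<mu> (\<Union>\<B> \<inter> L t) = \<theta> * \<beta>"
  proof -
    obtain M where M: "\<And>x. x \<in> \<Union>\<B> \<Longrightarrow> norm x \<le> M"
      using box_family_bounded[OF \<B>(1)] by (auto simp: bounded_iff)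
    have bd: "- M \<le> x \<bullet> i" "x \<bullet> i \<le> M" if "x \<in> \<Union>\<B>" for x
      using M[OF that] Basis_le_norm[OF i(1), of x] by auto
    have e: "\<Union>\<B> \<inter> L (-M) = {}" "\<Union>\<B> \<inter> L (M+1) = \<Union>\<B>"
      using bd unfolding L_def by force+
    have "\<exists>t\<ge>-M. t \<le> M + 1 \<and> ?\<mu> (\<Union>\<B> \<inter> L t) = \<theta> * \<beta>"
    proof (rule IVT')
      show "?\<mu> (\<Union>\<B> \<inter> L (-M)) \<le> \<theta> * \<beta>" using \<theta> \<beta> by (simp add: e)
      show "\<theta> * \<beta> \<le> ?\<mu> (\<Union>\<B> \<inter> L (M+1))" using \<theta> \<beta> by (simp add: e flip: \<beta>_def)
      show "-M \<le> M + 1" 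
      proof -
        obtain Q' where "Q' \<in> \<B>" using \<B>(2) by blast
        then obtain z where "z \<in> \<Union>\<B>" using \<B>(1) unfolding box_family_def by blast
        then show ?thesis using bd[of z] by linarith
      qed
      show "continuous_on {-M..M+1} (\<lambda>t. ?\<mu> (\<Union>\<B> \<inter> L t))"
        unfolding L_def using continuous_measure_box_family_halfspace[OF \<B>(1) i(1)]
        by (rule continuous_on_subset) auto
    qed
    then show ?thesis using that by blast
  qed
  have t': "?\<mu> (\<Union>\<B> \<inter> R t) = (1 - \<theta>) * \<beta>" using split(2)[of t] t by (simp add: algebra_simps)
  have A\<theta>: "?\<mu> (\<Union>\<A> \<inter> L c) = \<theta> * \<alpha>" "?\<mu> (\<Union>\<A> \<inter> R c) = (1 - \<theta>) * \<alpha>"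
    using \<alpha> split(1) by (auto simp: \<theta>_def field_simps)
  have neB: "cut_family (L t) \<B> \<noteq> {}" "cut_family (R t) \<B> \<noteq> {}"
  proof -
    have "?\<mu> (\<Union>\<B> \<inter> L t) > 0" "?\<mu> (\<Union>\<B> \<inter> R t) > 0" using t t' \<theta> \<beta> by auto
    then have "\<Union>\<B> \<inter> L t \<noteq> {}" "\<Union>\<B> \<inter> R t \<noteq> {}" by (metis less_irrefl measure_empty)+
    then show "cut_family (L t) \<B> \<noteq> {}" "cut_family (R t) \<B> \<noteq> {}"
      by (metis Union_cut_family Union_empty)+
  qed
  have IHL: "2 ^ DIM('a) * sqrt ((\<theta> * \<alpha>) * (\<theta> * \<beta>)) \<le> ?\<mu> (minkowski_sum (\<Union>\<A> \<inter> L c) (\<Union>\<B> \<inter> L t))"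
    using IH[OF AL(1) neA(1) BL(1)[of t] neB(1) cards(1) card_cut_family_le[OF fin(2), of "L t"]]
    by (simp add: Union_cut_family A\<theta> t)
  have IHR: "2 ^ DIM('a) * sqrt (((1-\<theta>) * \<alpha>) * ((1-\<theta>) * \<beta>)) \<le> ?\<mu> (minkowski_sum (\<Union>\<A> \<inter> R c) (\<Union>\<B> \<inter> R t))"
    using IH[OF AL(2) neA(2) BL(2)[of t] neB(2) cards(2) card_cut_family_le[OF fin(2), of "R t"]]
    by (simp add: Union_cut_family A\<theta> t')
  \<comment> \<open>Equal ratios leave the square root as a plain factor, so the two lower bounds,
    with weights \<theta> and 1 - \<theta>, add up to the full one without loss.\<close>
  have sq: "sqrt ((s * \<alpha>) * (s * \<beta>)) = s * sqrt (\<alpha> * \<beta>)" if "0 \<le> s" for s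
    using that by (simp add: real_sqrt_mult algebra_simps)
  have "2 ^ DIM('a) * sqrt (\<alpha> * \<beta>) = 2 ^ DIM('a) * (\<theta> * sqrt (\<alpha> * \<beta>)) + 2 ^ DIM('a) * ((1 - \<theta>) * sqrt (\<alpha> * \<beta>))"
    by (simp add: algebra_simps)
  also have "\<dots> \<le> ?\<mu> (minkowski_sum (\<Union>\<A> \<inter> L c) (\<Union>\<B> \<inter> L t)) + ?\<mu> (minkowski_sum (\<Union>\<A> \<inter> R c) (\<Union>\<B> \<inter> R t))"
    using IHL IHR \<theta> by (simp add: sq)
  also have "\<dots> = ?\<mu> (minkowski_sum (\<Union>\<A> \<inter> L c) (\<Union>\<B> \<inter> L t) \<union> minkowski_sum (\<Union>\<A> \<inter> R c) (\<Union>\<B> \<inter> R t))"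
  proof -
    have *: "minkowski_sum (\<Union>\<A> \<inter> X) (\<Union>\<B> \<inter> Y) \<in> fmeasurable lborel" if "open Y" for X Y
      using \<A>(1) \<B>(1) that
      by (intro bounded_borel_fmeasurable bounded_minkowski_sum borel_open open_minkowski_sum)
        (auto intro!: bounded_Int box_family_bounded box_family_open)
    have "open (L t)" "open (R t)"
      unfolding L_def R_def by (auto simp: open_halfspace_component_lt open_halfspace_component_gt)
    then have fm: "minkowski_sum (\<Union>\<A> \<inter> L c) (\<Union>\<B> \<inter> L t) \<in> fmeasurable lborel"
      "minkowski_sum (\<Union>\<A> \<inter> R c) (\<Union>\<B> \<inter> R t) \<in> fmeasurable lborel"
      using * by blast+
    have "minkowski_sum (\<Union>\<A> \<inter> L c) (\<Union>\<B> \<inter> L t) \<inter> minkowski_sum (\<Union>\<A> \<inter> R c) (\<Union>\<B> \<inter> R t) = {}"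
    proof -
      have "z \<bullet> i < c + t" if "z \<in> minkowski_sum (\<Union>\<A> \<inter> L c) (\<Union>\<B> \<inter> L t)" for z
        using that by (auto simp: minkowski_sum_iff L_def inner_add_left intro: add_strict_mono)
      moreover have "z \<bullet> i > c + t" if "z \<in> minkowski_sum (\<Union>\<A> \<inter> R c) (\<Union>\<B> \<inter> R t)" for z
        using that by (auto simp: minkowski_sum_iff R_def inner_add_left intro: add_strict_mono)
      ultimately show ?thesis by (meson disjoint_iff less_asym)
    qed
    then show ?thesis using fm by (simp add: measure_Un2 Diff_triv Int_commute)
  qed
  also have "\<dots> \<le> ?\<mu> (minkowski_sum (\<Union>\<A>) (\<Union>\<B>))"
  proof (rule measure_mono_fmeasurable)
    show "minkowski_sum (\<Union>\<A>) (\<Union>\<B>) \<in> fmeasurable lborel"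
      using \<A>(1) \<B>(1)
      by (intro bounded_borel_fmeasurable bounded_minkowski_sum borel_open open_minkowski_sum)
        (auto intro!: box_family_bounded box_family_open)
    show "minkowski_sum (\<Union>\<A> \<inter> L c) (\<Union>\<B> \<inter> L t) \<union> minkowski_sum (\<Union>\<A> \<inter> R c) (\<Union>\<B> \<inter> R t) \<in> sets lborel"
      using \<B>(1) unfolding L_def R_def
      by (auto intro!: borel_open open_Un open_minkowski_sum open_Int box_family_open
          simp: open_halfspace_component_lt open_halfspace_component_gt)
    show "minkowski_sum (\<Union>\<A> \<inter> L c) (\<Union>\<B> \<inter> L t) \<union> minkowski_sum (\<Union>\<A> \<inter> R c) (\<Union>\<B> \<inter> R t)
      \<subseteq> minkowski_sum (\<Union>\<A>) (\<Union>\<B>)"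
      unfolding minkowski_sum_def by blast
  qed
  finally show ?thesis unfolding \<alpha>_def \<beta>_def .
qed

text \<open>Induction on the total number of boxes. A cut strictly shrinks the family that has two
  boxes and does not enlarge the other; commutativity lets either family play the first role. Two
  single boxes are the base case.\<close>

lemma brunn_minkowski_box_families:
  fixes \<A> \<B> :: "'a::euclidean_space set set"
  assumes "box_family \<A>" "\<A> \<noteq> {}" "box_family \<B>" "\<B> \<noteq> {}"
  shows "2 ^ DIM('a) * sqrt (measure lborel (\<Union>\<A>) * measure lborel (\<Union>\<B>))
         \<le> measure lborel (minkowski_sum (\<Union>\<A>) (\<Union>\<B>))"
  using assms
proof (induction "card \<A> + card \<B>" arbitrary: \<A> \<B> rule: less_induct)
  case less
  have fin: "finite \<A>" "finite \<B>" using less.prems by (auto simp: box_family_def)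
  consider "2 \<le> card \<A>" | "2 \<le> card \<B>" | "card \<A> = 1" "card \<B> = 1"
    using fin less.prems by (metis One_nat_def Suc_1 card_0_eq le_less_Suc_eq less_one not_less nat_neq_iff)
  then show ?case
  proof cases
    case 1
    show ?thesis
      by (rule brunn_minkowski_cut[OF less.prems(1) 1 less.prems(3,4)])
        (rule less.hyps, auto)
  next
    case 2
    have "2 ^ DIM('a) * sqrt (measure lborel (\<Union>\<B>) * measure lborel (\<Union>\<A>))
         \<le> measure lborel (minkowski_sum (\<Union>\<B>) (\<Union>\<A>))"
    proof (rule brunn_minkowski_cut[OF less.prems(3) 2 less.prems(1,2)])
      fix \<B>' \<A>' :: "'a set set"
      assume *: "box_family \<A>'" "\<A>' \<noteq> {}" "box_family \<B>'" "\<B>' \<noteq> {}" "card \<A>' < card \<B>" "card \<B>' \<le> card \<A>"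
      show "2 ^ DIM('a) * sqrt (measure lborel (\<Union>\<A>') * measure lborel (\<Union>\<B>'))
         \<le> measure lborel (minkowski_sum (\<Union>\<A>') (\<Union>\<B>'))"
        by (rule less.hyps) (use * in auto)
    qed
    then show ?thesis by (simp add: minkowski_sum_commute mult.commute)
  next
    case 3
    then obtain P Q where PQ: "\<A> = {P}" "\<B> = {Q}" by (auto simp: card_1_singleton_iff)
    obtain a b where P: "P = box a b" "box a b \<noteq> {}" using less.prems(1) PQ(1) by (metis box_familyE insertI1)
    obtain c d where Q: "Q = box c d" "box c d \<noteq> {}" using less.prems(3) PQ(2) by (metis box_familyE insertI1)
    show ?thesis
      using brunn_minkowski_boxes[OF P(2) Q(2)] by (simp add: PQ P(1) Q(1))
  qed
qed

section \<open>From unions of boxes to closed sets\<close>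

lemma measure_lborel_uminus:
  fixes S :: "'a::euclidean_space set"
  assumes "S \<in> sets borel"
  shows "measure lborel (uminus ` S) = measure lborel S"
proof -
  have un: "uminus ` S = uminus -` S" for S :: "'a set"
    by (force simp: image_iff)
  have "lborel = density (distr lborel borel (\<lambda>x::'a. 0 + (-1) *\<^sub>R x)) (\<lambda>_. ennreal (\<bar>-1\<bar>^DIM('a)))"
    by (rule lborel_affine) simp
  then have "lborel = distr lborel borel (uminus :: 'a \<Rightarrow> 'a)"
    by (simp add: density_1)
  then have "measure lborel S = measure (distr lborel borel (uminus :: 'a \<Rightarrow> 'a)) S" by simp
  also have "\<dots> = measure lborel (uminus -` S)"
    using assms by (simp add: measure_distr)
  finally show ?thesis by (simp add: un)
qed

lemma box_family_uminus:
  assumes "box_family \<A>"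
  shows "box_family ((`) uminus ` \<A>)"
proof -
  have box: "uminus ` box a b = box (-b) (-a)" for a b :: 'a
    by (force simp: mem_box image_iff minus_equation_iff[of _ "_ :: 'a"] intro: minus_minus[symmetric])
  have "\<exists>c d. uminus ` Q = box c d" if "Q \<in> \<A>" for Q
    using assms that box by (metis box_familyE)
  moreover have "pairwise disjnt ((`) uminus ` \<A>)"
    using assms unfolding box_family_def pairwise_def disjnt_def by (fastforce simp: inj_image_eq_iff)
  ultimately show ?thesis using assms by (auto simp: box_family_def)
qed

text \<open>Brunn--Minkowski for the union and its reflection bounds the difference set from below;
  that set lies in the ball of radius \<open>diameter U\<close> about 0. Comparing the volumes and
  dividing by the power of 2 halves the diameter.\<close>

lemma isodiametric_box_family:
  fixes U :: "'a::euclidean_space set"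
  assumes \<A>: "box_family \<A>" "\<Union>\<A> \<subseteq> U" and U: "bounded U"
  shows "measure lborel (\<Union>\<A>) \<le> unit_ball_vol DIM('a) * (diameter U / 2) ^ DIM('a)"
proof (cases "\<A> = {}")
  case True
  then show ?thesis using U by (simp add: diameter_ge_0)
next
  case False
  let ?\<B> = "(`) uminus ` \<A>"
  have D: "0 \<le> diameter U" using U by (rule diameter_ge_0)
  have un: "\<Union>?\<B> = uminus ` \<Union>\<A>" by blast
  have "2 ^ DIM('a) * sqrt (measure lborel (\<Union>\<A>) * measure lborel (\<Union>?\<B>))
      \<le> measure lborel (minkowski_sum (\<Union>\<A>) (\<Union>?\<B>))"
    using \<A> False by (intro brunn_minkowski_box_families box_family_uminus) auto
  also have "measure lborel (\<Union>?\<B>) = measure lborel (\<Union>\<A>)"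
    unfolding un by (intro measure_lborel_uminus borel_open box_family_open \<A>)
  also have "measure lborel (minkowski_sum (\<Union>\<A>) (\<Union>?\<B>)) \<le> measure lborel (cball (0::'a) (diameter U))"
  proof (rule measure_mono_fmeasurable)
    have "dist x y \<le> diameter U" if "x \<in> \<Union>\<A>" "y \<in> \<Union>\<A>" for x y
      using that \<A>(2) U by (intro diameter_bounded_bound) auto
    then have "norm (x - y) \<le> diameter U" if "x \<in> \<Union>\<A>" "y \<in> \<Union>\<A>" for x y
      using that unfolding dist_norm by blast
    then show "minkowski_sum (\<Union>\<A>) (\<Union>?\<B>) \<subseteq> cball 0 (diameter U)"
      unfolding un subset_iff minkowski_sum_iff by (auto simp del: Union_iff)
    show "minkowski_sum (\<Union>\<A>) (\<Union>?\<B>) \<in> sets lborel"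
      using box_family_open[OF box_family_uminus[OF \<A>(1)]] by (auto intro!: borel_open open_minkowski_sum)
  qed (auto intro!: bounded_borel_fmeasurable)
  also have "\<dots> = unit_ball_vol DIM('a) * diameter U ^ DIM('a)"
    using D by (rule content_cball)
  finally show ?thesis by (simp add: power_divide field_simps)
qed

text \<open>An open set is a countable union of nonoverlapping boxes. Their boundaries are null, and
  the interiors of finitely many of them form a box family inside \<open>U\<close>, so the bound
  passes to the limit.\<close>

lemma isodiametric_open:
  fixes U :: "'a::euclidean_space set"
  assumes "open U" "bounded U"
  shows "emeasure lborel U \<le> ennreal (unit_ball_vol DIM('a) * (diameter U / 2) ^ DIM('a))"
proof (cases "U = {}")
  case False
  obtain c where c: "U \<subseteq> box (-c) c" using bounded_subset_box_symmetric[OF assms(2)] by metis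
  \<comment> \<open>This gauge forces every box of the covering, which is tagged by a point of
    \<open>U\<close>, to stay inside \<open>U\<close>.\<close>
  have "gauge (\<lambda>x. if x \<in> U then U else UNIV)" using assms(1) by (auto simp: gauge_def)
  moreover have "U \<subseteq> cbox (-c) c" "box (-c) c \<noteq> {}" using c box_subset_cbox False by blast+
  ultimately obtain \<D> where \<D>: "countable \<D>"
    "\<And>K. K \<in> \<D> \<Longrightarrow> interior K \<noteq> {} \<and> (\<exists>c d. K = cbox c d)"
    "pairwise (\<lambda>A B. interior A \<inter> interior B = {}) \<D>"
    "\<And>K. K \<in> \<D> \<Longrightarrow> \<exists>x \<in> U \<inter> K. K \<subseteq> (if x \<in> U then U else UNIV)"
    "U \<subseteq> \<Union>\<D>"
    using covering_lemma[of U "-c" c "\<lambda>x. if x \<in> U then U else UNIV"] by metis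
  have KU: "K \<subseteq> U" if "K \<in> \<D>" for K using \<D>(4)[OF that] by auto
  have "\<D> \<noteq> {}" using \<D>(5) False by auto
  define f where "f = from_nat_into \<D>"
  have f: "range f = \<D>" unfolding f_def using \<D>(1) \<open>\<D> \<noteq> {}\<close> by (rule range_from_nat_into[rotated])
  have fin: "f n \<in> \<D>" for n using f by auto
  define V where "V N = (\<Union>n<N. interior (f n))" for N :: nat
  have "emeasure lborel U = emeasure lborel (\<Union>N. V N)"
  proof (rule antisym)
    have "U \<subseteq> (\<Union>N. V N) \<union> (\<Union>n. f n - interior (f n))"
    proof
      fix x assume "x \<in> U"
      then obtain n where n: "x \<in> f n" using \<D>(5) f by blast
      have "interior (f n) \<subseteq> V (Suc n)" unfolding V_def by blast
      then show "x \<in> (\<Union>N. V N) \<union> (\<Union>n. f n - interior (f n))" using n by blast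
    qed
    moreover have "(\<Union>n. f n - interior (f n)) \<in> null_sets lborel"
    proof (rule null_sets_UN)
      fix n :: nat
      obtain a b where ab: "f n = cbox a b" using \<D>(2)[OF fin] by blast
      have "negligible (cbox a b - box a b)" using negligible_frontier_interval by (simp add: negligible_frontier_interval)
      then show "f n - interior (f n) \<in> null_sets lborel"
        by (simp add: ab negligible_iff_null_sets null_sets_completion_iff)
    qed
    ultimately have "emeasure lborel U \<le> emeasure lborel ((\<Union>N. V N) \<union> (\<Union>n. f n - interior (f n)))"
      by (intro emeasure_mono) (auto simp: V_def)
    also have "\<dots> = emeasure lborel (\<Union>N. V N)"
      by (rule emeasure_Un_null_set) (use \<open>_ \<in> null_sets lborel\<close> in \<open>auto simp: V_def\<close>)
    finally show "emeasure lborel U \<le> emeasure lborel (\<Union>N. V N)" .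
    show "emeasure lborel (\<Union>N. V N) \<le> emeasure lborel U"
      using KU[OF fin] interior_subset assms(1) unfolding V_def by (intro emeasure_mono) (blast, simp)
  qed
  also have "\<dots> = (SUP N. emeasure lborel (V N))"
    by (rule SUP_emeasure_incseq[symmetric]) (auto simp: V_def incseq_def intro: less_le_trans)
  also have "\<dots> \<le> ennreal (unit_ball_vol DIM('a) * (diameter U / 2) ^ DIM('a))"
  proof (rule SUP_least)
    fix N
    have fam: "box_family (interior ` f ` {..<N})"
      unfolding box_family_def
    proof (intro conjI ballI)
      fix Q assume "Q \<in> interior ` f ` {..<N}"
      then obtain n where n: "Q = interior (f n)" by auto
      show "Q \<noteq> {}" "\<exists>a b. Q = box a b" using \<D>(2)[OF fin[of n]] interior_cbox unfolding n by metis+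
    next
      show "pairwise disjnt (interior ` f ` {..<N})"
      proof (rule pairwiseI)
        fix P Q assume "P \<in> interior ` f ` {..<N}" "Q \<in> interior ` f ` {..<N}" "P \<noteq> Q"
        then obtain m n where mn: "P = interior (f m)" "Q = interior (f n)" by blast
        with \<open>P \<noteq> Q\<close> have "f m \<noteq> f n" by auto
        with mn show "disjnt P Q" using \<D>(3) fin unfolding pairwise_def disjnt_def by blast
      qed
    qed simp
    have "\<Union>(interior ` f ` {..<N}) \<subseteq> U" using KU[OF fin] interior_subset by blast
    from isodiametric_box_family[OF fam this assms(2)]
    have "measure lborel (V N) \<le> unit_ball_vol DIM('a) * (diameter U / 2) ^ DIM('a)"
      by (simp add: V_def image_image)
    moreover have "emeasure lborel (V N) = ennreal (measure lborel (V N))"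
    proof (rule emeasure_eq_ennreal_measure)
      have "V N \<subseteq> U" using \<open>\<Union>(interior ` f ` {..<N}) \<subseteq> U\<close> unfolding V_def by blast
      then have "bounded (V N)" using assms(2) by (rule bounded_subset[rotated])
      then show "emeasure lborel (V N) \<noteq> top" using emeasure_bounded_finite[of "V N"] by simp
    qed
    ultimately show "emeasure lborel (V N) \<le> ennreal (unit_ball_vol DIM('a) * (diameter U / 2) ^ DIM('a))"
      by (simp add: ennreal_leI)
  qed
  finally show ?thesis .
qed simp

text \<open>The open \<open>e\<close>-neighbourhood of \<open>S\<close> has diameter at most that of
  \<open>S\<close> plus \<open>2 * e\<close>; then \<open>e\<close> tends to 0.\<close>

theorem isodiametric_inequality:
  fixes S :: "'a::euclidean_space set"
  assumes S: "closed S" "bounded S"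
  shows "emeasure lborel S \<le> hausdorff_weight DIM('a) S"
proof (cases "S = {}")
  case False
  let ?D = "diameter S" and ?\<kappa> = "unit_ball_vol DIM('a)"
  have le: "measure lborel S \<le> ?\<kappa> * ((?D + 2 * e) / 2) ^ DIM('a)" if "0 < e" for e
  proof -
    define U where "U = (\<Union>x\<in>S. ball x e)"
    have U: "open U" "S \<subseteq> U" using that by (auto simp: U_def)
    have diam: "dist x y \<le> ?D + 2 * e" if xy: "x \<in> U" "y \<in> U" for x y
    proof -
      obtain s t where "s \<in> S" "t \<in> S" "dist s x < e" "dist t y < e" using xy unfolding U_def by auto
      moreover have "dist s t \<le> ?D" using calculation S by (intro diameter_bounded_bound) auto
      moreover have "dist x y \<le> dist s x + dist s t + dist t y"
        by (metis add.commute add_left_mono dist_commute dist_triangle dist_triangle3 order_trans add.left_commute)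
      ultimately show ?thesis by linarith
    qed
    then have "bounded U" unfolding bounded_two_points by blast
    have "U \<noteq> {}" using U False by auto
    then have "diameter U \<le> ?D + 2 * e"
      using diam by (intro diameter_le) (auto simp: dist_norm)
    have "ennreal (measure lborel S) = emeasure lborel S"
      using emeasure_bounded_finite[OF S(2)] by (intro emeasure_eq_ennreal_measure[symmetric]) auto
    also have "\<dots> \<le> emeasure lborel U" using U by (intro emeasure_mono) auto
    also have "\<dots> \<le> ennreal (?\<kappa> * (diameter U / 2) ^ DIM('a))"
      using U \<open>bounded U\<close> by (intro isodiametric_open)
    also have "\<dots> \<le> ennreal (?\<kappa> * ((?D + 2 * e) / 2) ^ DIM('a))"
      using \<open>diameter U \<le> ?D + 2 * e\<close> diameter_ge_0[OF \<open>bounded U\<close>]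
      by (intro ennreal_leI mult_left_mono power_mono) auto
    finally show ?thesis
      using that diameter_ge_0[OF S(2)] by (subst (asm) ennreal_le_iff) auto
  qed
  have "((\<lambda>e. ?\<kappa> * ((?D + 2 * e) / 2) ^ DIM('a)) \<longlongrightarrow> ?\<kappa> * ((?D + 2 * 0) / 2) ^ DIM('a)) (at_right 0)"
    by (intro tendsto_intros) auto
  then have "measure lborel S \<le> ?\<kappa> * ((?D + 2 * 0) / 2) ^ DIM('a)"
    by (rule tendsto_lowerbound) (use le in \<open>auto simp: eventually_at_right_less intro: eventually_mono[OF eventually_at_right_less]\<close>)
  moreover have "emeasure lborel S = ennreal (measure lborel S)"
    using emeasure_bounded_finite[OF S(2)] by (intro emeasure_eq_ennreal_measure) auto
  ultimately show ?thesis
    using False by (simp add: hausdorff_weight_def ennreal_leI)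
qed simp

subsection \<open>Hausdorff measure in full dimension\<close>

text \<open>The isodiametric inequality bounds the volume of each covering set by its weight,
  whatever the scale. Passing to closures makes the covering sets measurable and keeps their
  diameters.\<close>

lemma lborel_le_hausdorff_outer:
  fixes A :: "'a::euclidean_space set"
  assumes "A \<in> sets borel"
  shows "emeasure lborel A \<le> hausdorff_outer DIM('a) A"
proof -
  have "emeasure lborel A \<le> hausdorff_content DIM('a) 1 A"
    unfolding hausdorff_content_def
  proof (rule INF_greatest, clarify)
    fix U :: "nat \<Rightarrow> 'a set"
    assume cov: "A \<subseteq> (\<Union>i. U i)" and U: "\<forall>i. bounded (U i) \<and> diameter (U i) \<le> 1"
    have "A \<subseteq> (\<Union>i. closure (U i))" using cov closure_subset by blast
    then have "emeasure lborel A \<le> emeasure lborel (\<Union>i. closure (U i))"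
      by (intro emeasure_mono) auto
    also have "\<dots> \<le> (\<Sum>i. emeasure lborel (closure (U i)))"
      by (intro emeasure_subadditive_countably) auto
    also have "\<dots> \<le> (\<Sum>i. hausdorff_weight DIM('a) (U i))"
    proof (rule suminf_le)
      fix i
      have "emeasure lborel (closure (U i)) \<le> hausdorff_weight DIM('a) (closure (U i))"
        using U by (intro isodiametric_inequality) auto
      also have "\<dots> = hausdorff_weight DIM('a) (U i)"
        using U by (simp add: hausdorff_weight_def diameter_closure)
      finally show "emeasure lborel (closure (U i)) \<le> hausdorff_weight DIM('a) (U i)" .
    qed auto
    finally show "emeasure lborel A \<le> (\<Sum>i. hausdorff_weight DIM('a) (U i))" .
  qed
  also have "\<dots> \<le> hausdorff_outer DIM('a) A" by (rule hausdorff_content_le_outer) simp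
  finally show ?thesis .
qed

text \<open>Common end of two covering arguments: dyadic cubes, where \<open>c\<close> is a crude
  constant, and Vitali balls, where \<open>c\<close> is 1. Disjoint interiors inside
  \<open>T\<close> bound the total volume.\<close>

lemma hausdorff_content_countable_cover:
  fixes \<D> :: "'a::euclidean_space set set"
  assumes \<D>: "countable \<D>" "pairwise (\<lambda>A B. interior A \<inter> interior B = {}) \<D>"
    and K: "\<And>K. K \<in> \<D> \<Longrightarrow> bounded K" "\<And>K. K \<in> \<D> \<Longrightarrow> diameter K \<le> \<delta>"
    and w: "\<And>K. K \<in> \<D> \<Longrightarrow> hausdorff_weight d K \<le> c * emeasure lborel (interior K)"
    and T: "T \<in> sets borel" "\<And>K. K \<in> \<D> \<Longrightarrow> interior K \<subseteq> T" and \<delta>: "0 \<le> \<delta>"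
  shows "hausdorff_content d \<delta> (\<Union>\<D>) \<le> c * emeasure lborel T"
proof -
  \<comment> \<open>The cover may be finite, so it is indexed by the codes of its members, and the
    other indices carry the empty set, of weight 0.\<close>
  define N where "N = to_nat_on \<D> ` \<D>"
  define U where "U n = (if n \<in> N then from_nat_into \<D> n else {})" for n
  have in\<D>: "from_nat_into \<D> n \<in> \<D>" if "n \<in> N" for n
    using that \<D>(1) by (auto simp: N_def)
  have inj: "m = n" if "m \<in> N" "n \<in> N" "from_nat_into \<D> m = from_nat_into \<D> n" for m n
    using that \<D>(1) by (auto simp: N_def)
  have "hausdorff_content d \<delta> (\<Union>\<D>) \<le> (\<Sum>n. hausdorff_weight d (U n))"
  proof (rule hausdorff_content_le)
    show "\<Union>\<D> \<subseteq> (\<Union>n. U n)"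
    proof
      fix x assume "x \<in> \<Union>\<D>"
      then obtain K where "K \<in> \<D>" "x \<in> K" by auto
      then have "x \<in> U (to_nat_on \<D> K)" using \<D>(1) by (auto simp: U_def N_def)
      then show "x \<in> (\<Union>n. U n)" by blast
    qed
    show "bounded (U n)" "diameter (U n) \<le> \<delta>" for n
      using K in\<D>[of n] \<delta> by (auto simp: U_def)
  qed
  also have "\<dots> \<le> (\<Sum>n. c * emeasure lborel (interior (U n)))"
    by (intro suminf_le) (use w in\<D> in \<open>auto simp: U_def hausdorff_weight_def[of _ "{}"]\<close>)
  also have "\<dots> = c * (\<Sum>n. emeasure lborel (interior (U n)))" by simp
  also have "(\<Sum>n. emeasure lborel (interior (U n))) = emeasure lborel (\<Union>n. interior (U n))"
  proof (rule suminf_emeasure)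
    show "disjoint_family (\<lambda>n. interior (U n))"
      unfolding disjoint_family_on_def
    proof (intro ballI impI)
      fix m n :: nat assume "m \<noteq> n"
      then show "interior (U m) \<inter> interior (U n) = {}"
        using \<D>(2) in\<D>[of m] in\<D>[of n] inj[of m n] unfolding U_def pairwise_def by auto
    qed
  qed auto
  also have "c * emeasure lborel (\<Union>n. interior (U n)) \<le> c * emeasure lborel T"
  proof (intro mult_left_mono emeasure_mono UN_least)
    show "interior (U n) \<subseteq> T" for n
      using T(2)[OF in\<D>[of n]] by (cases "n \<in> N") (simp_all add: U_def)
  qed (use T in auto)
  finally show ?thesis .
qed

text \<open>The weight of a cube is at most a fixed multiple of its volume. A null set lies in open
  sets of arbitrarily small volume, which can be covered around it by cubes, so the size of the
  multiple is harmless.\<close>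

lemma hausdorff_content_negligible_bounded:
  fixes S :: "'a::euclidean_space set"
  assumes "negligible S" "bounded S" "0 < \<delta>"
  shows "hausdorff_content DIM('a) \<delta> S = 0"
proof -
  \<comment> \<open>A cube of side \<open>s\<close> has diameter at most \<open>DIM('a) * s\<close>,
    hence weight at most \<open>C * s ^ DIM('a)\<close>.\<close>
  define C where "C = unit_ball_vol DIM('a) * (real DIM('a) / 2) ^ DIM('a)"
  have C: "0 \<le> C" by (simp add: C_def)
  obtain M where M: "\<And>x. x \<in> S \<Longrightarrow> norm x \<le> M" "0 < M"
    using bounded_pos[THEN iffD1, OF assms(2)] by auto
  define c :: 'a where "c = M *\<^sub>R One"
  have ci: "c \<bullet> i = M" if "i \<in> Basis" for i using that by (simp add: c_def inner_sum_left inner_Basis sum.delta)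
  have Sc: "S \<subseteq> cbox (-c) c"
  proof
    fix x assume "x \<in> S"
    then have "\<bar>x \<bullet> i\<bar> \<le> M" if "i \<in> Basis" for i
      using M(1)[of x] Basis_le_norm[OF that, of x] by linarith
    then show "x \<in> cbox (-c) c" using ci by (auto simp: mem_box abs_le_iff minus_le_iff)
  qed
  have bne: "box (-c) c \<noteq> {}" using ci M(2) by (auto simp: box_ne_empty)
  have "hausdorff_content DIM('a) \<delta> S \<le> 0 + ennreal e" if "0 < e" for e
  proof -
    have "S \<in> null_sets lebesgue" using assms(1) by (simp add: negligible_iff_null_sets)
    moreover have "0 < e / (C + 1)" using C that by simp
    ultimately obtain T where T: "open T" "S \<subseteq> T" "emeasure lebesgue (T - S) < ennreal (e / (C + 1))"
      using sets_lebesgue_outer_open[of S "e / (C+1)"] null_setsD2 by metis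
    have "emeasure lborel T = emeasure lebesgue ((T - S) \<union> S)" using T by (simp add: Un_absorb2)
    also have "\<dots> = emeasure lebesgue (T - S)"
      using \<open>S \<in> null_sets lebesgue\<close> T by (intro emeasure_Un_null_set) auto
    finally have eT: "emeasure lborel T \<le> ennreal (e / (C + 1))" using T(3) by simp
    \<comment> \<open>The gauge keeps every cube tagged in \<open>S\<close> inside \<open>T\<close>
      and inside a ball of diameter \<delta>.\<close>
    define g where "g x = (if x \<in> T then T \<inter> ball x (\<delta>/2) else ball x 1)" for x
    have "gauge g" using T(1) assms(3) by (auto simp: gauge_def g_def)
    show ?thesis
    proof (rule covering_lemma[OF Sc bne \<open>gauge g\<close>])
      fix \<D> :: "'a set set"
      assume \<D>: "countable \<D>" "pairwise (\<lambda>A B. interior A \<inter> interior B = {}) \<D>"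
        and \<D>': "\<And>K. K \<in> \<D> \<Longrightarrow> interior K \<noteq> {} \<and> (\<exists>c d. K = cbox c d)"
          "\<And>K. K \<in> \<D> \<Longrightarrow> \<exists>x \<in> S \<inter> K. K \<subseteq> g x"
          "\<And>u v. cbox u v \<in> \<D> \<Longrightarrow> \<exists>n. \<forall>i \<in> Basis. v \<bullet> i - u \<bullet> i = (c \<bullet> i - (-c) \<bullet> i) / 2^n"
          "S \<subseteq> \<Union>\<D>"
      have Kball: "\<exists>x. K \<subseteq> T \<inter> ball x (\<delta>/2)" if "K \<in> \<D>" for K
        using \<D>'(2)[OF that] T(2) by (auto simp: g_def subset_iff split: if_splits)
      have "hausdorff_content DIM('a) \<delta> (\<Union>\<D>) \<le> ennreal C * emeasure lborel T"
      proof (rule hausdorff_content_countable_cover[OF \<D>])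
        fix K assume K: "K \<in> \<D>"
        obtain x where x: "K \<subseteq> T \<inter> ball x (\<delta>/2)" using Kball[OF K] by blast
        then show "bounded K" by (meson bounded_ball bounded_subset le_inf_iff)
        have "diameter K \<le> diameter (ball x (\<delta>/2))" using x by (intro diameter_subset) auto
        then show "diameter K \<le> \<delta>" using assms(3) by simp
        show "interior K \<subseteq> T" using x interior_subset by blast
        obtain u v where uv: "K = cbox u v" "interior K \<noteq> {}" using \<D>'(1)[OF K] by blast
        then obtain n where n: "\<And>i. i \<in> Basis \<Longrightarrow> v \<bullet> i - u \<bullet> i = 2 * M / 2 ^ n"
          using \<D>'(3)[of u v] K ci by auto
        define s where "s = 2 * M / 2 ^ n"
        have s: "0 < s" using M(2) by (simp add: s_def)
        have le: "u \<bullet> i \<le> v \<bullet> i" if "i \<in> Basis" for i using n[OF that] s by (simp add: s_def)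
        have "diameter K = norm (v - u)"
          unfolding uv(1) using le by (subst diameter_cbox) (auto simp: dist_norm norm_minus_commute)
        also have "\<dots> \<le> (\<Sum>i\<in>Basis. \<bar>(v - u) \<bullet> i\<bar>)" by (rule norm_le_l1)
        also have "\<dots> = DIM('a) * s" using n s M(2) by (simp add: inner_diff_left s_def)
        finally have "unit_ball_vol DIM('a) * (diameter K / 2) ^ DIM('a) \<le> unit_ball_vol DIM('a) * (DIM('a) * s / 2) ^ DIM('a)"
          using diameter_ge_0[OF \<open>bounded K\<close>] by (intro mult_left_mono power_mono divide_right_mono) auto
        also have "\<dots> = C * s ^ DIM('a)" by (simp add: C_def power_mult_distrib power_divide)
        finally have "hausdorff_weight DIM('a) K \<le> ennreal (C * s ^ DIM('a))"
          by (auto simp: hausdorff_weight_def intro: ennreal_leI)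
        moreover have "emeasure lborel (interior K) = ennreal (s ^ DIM('a))"
          unfolding uv(1) interior_cbox using le n by (subst emeasure_lborel_box) (auto simp: inner_diff_left s_def)
        ultimately show "hausdorff_weight DIM('a) K \<le> ennreal C * emeasure lborel (interior K)"
          using C s by (simp add: ennreal_mult')
      qed (use T assms in auto)
      also have "\<dots> \<le> ennreal C * ennreal (e / (C + 1))" using eT by (rule mult_left_mono) simp
      also have "\<dots> = ennreal (C * (e / (C + 1)))" using C that by (intro ennreal_mult[symmetric]) auto
      also have "\<dots> \<le> ennreal e" using C that by (intro ennreal_leI) (simp add: field_simps)
      finally have "hausdorff_content DIM('a) \<delta> (\<Union>\<D>) \<le> ennreal e" .
      then show "hausdorff_content DIM('a) \<delta> S \<le> 0 + ennreal e"
        unfolding add_0 by (rule order_trans[OF hausdorff_content_mono[OF \<D>'(4)]])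
    qed
  qed
  then have "hausdorff_content DIM('a) \<delta> S \<le> 0" by (rule ennreal_le_epsilon)
  then show ?thesis by simp
qed

lemma hausdorff_content_negligible:
  fixes S :: "'a::euclidean_space set"
  assumes "negligible S" "0 < \<delta>"
  shows "hausdorff_content DIM('a) \<delta> S = 0"
proof -
  have "hausdorff_content DIM('a) \<delta> (\<Union>n::nat. S \<inter> cball 0 n) \<le> (\<Sum>n. hausdorff_content DIM('a) \<delta> (S \<inter> cball 0 (real n)))"
    using assms by (intro hausdorff_content_countably_subadditive) auto
  also have "\<dots> = 0"
    using assms by (simp add: hausdorff_content_negligible_bounded negligible_Int bounded_Int)
  also have "(\<Union>n::nat. S \<inter> cball 0 n) = S" using real_arch_simple by auto
  finally show ?thesis by simp
qed

text \<open>By Vitali's theorem almost all of an open set is filled by disjoint small balls, for which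
  the weight is the volume.\<close>

lemma hausdorff_content_open_le:
  fixes T :: "'a::euclidean_space set"
  assumes "open T" "0 < \<delta>"
  shows "hausdorff_content DIM('a) \<delta> T \<le> emeasure lborel T"
proof -
  define K where "K = {(x::'a, r::real). 0 < r \<and> r \<le> \<delta> / 2 \<and> cball x r \<subseteq> T}"
  have fine: "\<exists>i. i \<in> K \<and> x \<in> cball (fst i) (snd i) \<and> snd i < e" if "x \<in> T" "0 < e" for x e
  proof -
    obtain r where r: "0 < r" "cball x r \<subseteq> T" using assms(1) \<open>x \<in> T\<close> open_contains_cball by blast
    define q where "q = min (min r (\<delta>/2)) (e/2)"
    have "0 < q" "q \<le> r" "q \<le> \<delta>/2" "q < e" using r assms(2) that by (auto simp: q_def)
    moreover have "cball x q \<subseteq> T" using r \<open>q \<le> r\<close> by auto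
    ultimately show ?thesis by (intro exI[of _ "(x, q)"]) (auto simp: K_def)
  qed
  obtain C where C: "countable C" "C \<subseteq> K"
    "pairwise (\<lambda>i j. disjnt (cball (fst i) (snd i)) (cball (fst j) (snd j))) C"
    "negligible (T - (\<Union>i \<in> C. cball (fst i) (snd i)))"
  proof (rule Vitali_covering_theorem_cballs[of K snd T fst])
    show "\<And>i. i \<in> K \<Longrightarrow> 0 < snd i" by (auto simp: K_def)
    show "\<And>x d. \<lbrakk>x \<in> T; 0 < d\<rbrakk> \<Longrightarrow> \<exists>i. i \<in> K \<and> x \<in> cball (fst i) (snd i) \<and> snd i < d"
      by (rule fine)
    fix C assume *: "countable C" "C \<subseteq> K"
      "pairwise (\<lambda>i j. disjnt (cball (fst i) (snd i)) (cball (fst j) (snd j))) C"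
      "negligible (T - (\<Union>i \<in> C. cball (fst i) (snd i)))"
    show thesis by (rule that[OF *])
  qed
  define \<D> where "\<D> = (\<lambda>i. cball (fst i) (snd i)) ` C"
  have "hausdorff_content DIM('a) \<delta> T \<le> hausdorff_content DIM('a) \<delta> (\<Union>n. binaryset (\<Union>\<D>) (T - \<Union>\<D>) n)"
    by (intro hausdorff_content_mono) (auto simp: UN_binaryset_eq)
  also have "\<dots> \<le> (\<Sum>n. hausdorff_content DIM('a) \<delta> (binaryset (\<Union>\<D>) (T - \<Union>\<D>) n))"
    using assms by (intro hausdorff_content_countably_subadditive) auto
  also have "\<dots> = hausdorff_content DIM('a) \<delta> (\<Union>\<D>) + hausdorff_content DIM('a) \<delta> (T - \<Union>\<D>)"
    by (rule suminf_binaryset_eq) (use assms in auto)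
  also have "hausdorff_content DIM('a) \<delta> (T - \<Union>\<D>) = 0"
    using C(4) assms by (intro hausdorff_content_negligible) (auto simp: \<D>_def)
  also have "hausdorff_content DIM('a) \<delta> (\<Union>\<D>) \<le> 1 * emeasure lborel T"
  proof (rule hausdorff_content_countable_cover)
    show "countable \<D>" using C(1) by (simp add: \<D>_def)
    show "pairwise (\<lambda>A B. interior A \<inter> interior B = {}) \<D>"
    proof (rule pairwiseI)
      fix A B assume AB: "A \<in> \<D>" "B \<in> \<D>" "A \<noteq> B"
      then obtain i j where ij: "i \<in> C" "j \<in> C" "A = cball (fst i) (snd i)" "B = cball (fst j) (snd j)"
        by (auto simp: \<D>_def)
      with AB have "i \<noteq> j" by auto
      then have "disjnt A B" using C(3) ij unfolding pairwise_def by auto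
      then show "interior A \<inter> interior B = {}" using interior_subset unfolding disjnt_def by blast
    qed
    fix A assume "A \<in> \<D>"
    then obtain x r where xr: "A = cball x r" "(x, r) \<in> K" using C(2) by (auto simp: \<D>_def)
    then have r: "0 < r" "r \<le> \<delta>/2" "cball x r \<subseteq> T" by (auto simp: K_def)
    show "bounded A" "diameter A \<le> \<delta>" using r by (auto simp: xr)
    show "interior A \<subseteq> T" using r interior_subset by (auto simp: xr)
    show "hausdorff_weight DIM('a) A \<le> 1 * emeasure lborel (interior A)"
      using r by (auto simp: xr hausdorff_weight_def emeasure_ball)
  qed (use assms in auto)
  finally show ?thesis by simp
qed

text \<open>The lower bound is isodiametric; the upper bound holds for open sets by Vitali and
  extends to Borel sets by outer regularity.\<close>

theorem hausdorff_outer_eq_lborel: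
  fixes A :: "'a::euclidean_space set"
  assumes "A \<in> sets borel"
  shows "hausdorff_outer DIM('a) A = emeasure lborel A"
proof (rule antisym)
  show "hausdorff_outer DIM('a) A \<le> emeasure lborel A"
  proof (rule ennreal_le_epsilon)
    fix e :: real assume "0 < e"
    then obtain T where T: "open T" "A \<subseteq> T" "emeasure lborel (T - A) < ennreal e"
      using outer_regular_lborel[OF assms] by blast
    have "hausdorff_outer DIM('a) A \<le> hausdorff_outer DIM('a) T" using T(2) by (rule hausdorff_outer_mono)
    also have "\<dots> \<le> emeasure lborel T"
      using T(1) by (intro hausdorff_outer_leI hausdorff_content_open_le)
    also have "\<dots> = emeasure lborel (A \<union> (T - A))" using T(2) by (simp add: Un_absorb1)
    also have "\<dots> \<le> emeasure lborel A + emeasure lborel (T - A)"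
      using T(1) assms by (intro emeasure_subadditive) auto
    also have "\<dots> \<le> emeasure lborel A + ennreal e" using T(3) by (intro add_left_mono) auto
    finally show "hausdorff_outer DIM('a) A \<le> emeasure lborel A + ennreal e" .
  qed
qed (rule lborel_le_hausdorff_outer[OF assms])

subsection \<open>Linear images and determinants\<close>

text \<open>The library proves the volume formula for linear images for well-ordered index types only.\<close>

typedef 'a enumerated = "UNIV :: 'a set" by simp

instance enumerated :: (finite) finite
proof
  have "(UNIV :: 'a enumerated set) = Abs_enumerated ` UNIV"
    by (metis Abs_enumerated_cases UNIV_eq_I rangeI)
  then show "finite (UNIV :: 'a enumerated set)" by (metis finite finite_imageI)
qed

definition enumeration :: "'a::finite \<Rightarrow> nat" where
  "enumeration = (SOME f. inj f)"

lemma inj_enumeration: "inj enumeration"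
proof -
  have "\<exists>f :: 'a \<Rightarrow> nat. inj f"
    using finite_imp_inj_to_nat_seg[OF finite[of "UNIV :: 'a set"]] by auto
  then show ?thesis unfolding enumeration_def by (rule someI_ex)
qed

instantiation enumerated :: (finite) wellorder
begin

definition "x \<le> y \<longleftrightarrow> enumeration (Rep_enumerated x) \<le> enumeration (Rep_enumerated y)"
definition "x < y \<longleftrightarrow> enumeration (Rep_enumerated x) < enumeration (Rep_enumerated y)"

instance
proof
  fix x y z :: "'a enumerated"
  show "x < y \<longleftrightarrow> x \<le> y \<and> \<not> y \<le> x" "x \<le> x" "x \<le> y \<Longrightarrow> y \<le> z \<Longrightarrow> x \<le> z" "x \<le> y \<or> y \<le> x"
    by (auto simp: less_eq_enumerated_def less_enumerated_def)
  show "x \<le> y \<Longrightarrow> y \<le> x \<Longrightarrow> x = y"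
    using inj_eq[OF inj_enumeration] Rep_enumerated_inject unfolding less_eq_enumerated_def
    by (metis order_antisym)
next
  fix P :: "'a enumerated \<Rightarrow> bool" and a
  assume step: "\<And>x. (\<And>y. y < x \<Longrightarrow> P y) \<Longrightarrow> P x"
  show "P a"
    by (induction a rule: measure_induct_rule[of "\<lambda>x. enumeration (Rep_enumerated x)"])
      (rule step, simp add: less_enumerated_def)
qed

end

text \<open>Conjugation by the bijection matches the permutations of the two index types and
  preserves signs, so the Leibniz sums agree term by term.\<close>

lemma det_reindex:
  fixes A :: "real^'n^'n" and e :: "'m::finite \<Rightarrow> 'n::finite"
  assumes "bij e"
  shows "det (\<chi> i j. A $ e i $ e j) = det A"
proof -
  have inj: "inj_on e UNIV" and img: "range e = UNIV" using assms by (auto simp: bij_def)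
  let ?P = "\<lambda>p. map_permutation UNIV e p"
  have "det A = (\<Sum>p | p permutes (UNIV :: 'm set). of_int (sign (?P p)) * (\<Prod>i\<in>UNIV. A $ i $ (?P p i)))"
    unfolding det_def
  proof (rule sum.reindex_bij_witness[symmetric, of _ "map_permutation UNIV (inv e)" "map_permutation UNIV e"])
    have bij: "bij_betw e UNIV UNIV" "bij_betw (inv e) UNIV UNIV" using assms by (auto simp: bij_imp_bij_inv)
    show "map_permutation UNIV (inv e) p \<in> {p. p permutes UNIV}" if "p \<in> {p. p permutes UNIV}" for p
      using that bij(2) by (auto intro: map_permutation_permutes)
    show "map_permutation UNIV e p \<in> {p. p permutes UNIV}" if "p \<in> {p. p permutes UNIV}" for p
      using that bij(1) by (auto intro: map_permutation_permutes)
    show "map_permutation UNIV (inv e) (map_permutation UNIV e p) = p" if "p \<in> {p. p permutes UNIV}" for p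
      by (rule map_permutation_compose_inv) (use that bij assms in \<open>auto simp: bij_is_inj\<close>)
    show "map_permutation UNIV e (map_permutation UNIV (inv e) p) = p" if "p \<in> {p. p permutes UNIV}" for p
      by (rule map_permutation_compose_inv) (use that bij assms in \<open>auto simp: bij_is_surj surj_f_inv_f\<close>)
  qed auto
  also have "\<dots> = (\<Sum>p | p permutes (UNIV :: 'm set). of_int (sign p) * (\<Prod>i\<in>UNIV. A $ e i $ e (p i)))"
  proof (rule sum.cong[OF refl])
    fix p :: "'m \<Rightarrow> 'm" assume "p \<in> {p. p permutes UNIV}"
    then have p: "p permutes UNIV" by simp
    have "sign (?P p) = sign p" using p inj by (intro sign_map_permutation) auto
    moreover have "(\<Prod>i\<in>UNIV. A $ i $ (?P p i)) = (\<Prod>i\<in>UNIV. A $ e i $ e (p i))"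
      using inj img by (subst prod.reindex_bij_betw[OF assms, symmetric]) (simp add: map_permutation_apply)
    ultimately show "of_int (sign (?P p)) * (\<Prod>i\<in>UNIV. A $ i $ (?P p i)) =
        of_int (sign p) * (\<Prod>i\<in>UNIV. A $ e i $ e (p i))" by simp
  qed
  also have "\<dots> = det (\<chi> i j. A $ e i $ e j)" by (simp add: det_def)
  finally show ?thesis ..
qed

lemma inj_linear_image_borel:
  fixes f :: "'a::euclidean_space \<Rightarrow> 'b::euclidean_space"
  assumes f: "linear f" "inj f" and dim: "DIM('a) = DIM('b)" and S: "S \<in> sets borel"
  shows "f ` S \<in> sets borel"
proof -
  obtain g where g: "linear g" "\<And>x. g (f x) = x" "\<And>y. f (g y) = y"
    using linear_injective_isomorphism[OF f] dim by auto
  have "f ` S = g -` S" by (rule set_eqI) (metis g(2,3) image_iff vimage_eq)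
  moreover have "g \<in> borel_measurable borel"
    using g(1) linear_conv_bounded_linear
    by (auto intro!: borel_measurable_continuous_onI linear_continuous_on)
  ultimately show ?thesis using S by (metis measurable_sets_borel)
qed

text \<open>Relabelling the coordinates by \<open>R\<close> is an isometry onto a space with
  well-ordered indices, where the volume formula applies to \<open>h\<close>. Hausdorff measure is
  unchanged by \<open>R\<close>, and the determinant by relabelling.\<close>

lemma hausdorff_outer_linear_image:
  fixes f :: "real^'n \<Rightarrow> real^'n"
  assumes f: "linear f" "inj f" and S: "S \<in> sets borel" "bounded S"
  shows "hausdorff_outer CARD('n) (f ` S) = ennreal \<bar>det (matrix f)\<bar> * emeasure lborel S"
proof -
  let ?e = "Rep_enumerated :: 'n enumerated \<Rightarrow> 'n"
  let ?d = "Abs_enumerated :: 'n \<Rightarrow> 'n enumerated"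
  have e: "bij ?e" "?e (?d x) = x" "?d (?e y) = y" for x y
    using Abs_enumerated_inverse[OF UNIV_I] Rep_enumerated_inverse by (auto intro!: o_bij[of ?d] simp: fun_eq_iff)
  have card: "CARD('n enumerated) = CARD('n)" using bij_betw_same_card[OF e(1)] by simp
  define R :: "real^'n \<Rightarrow> real^'n enumerated" where "R x = (\<chi> i. x $ ?e i)" for x
  define Q :: "real^'n enumerated \<Rightarrow> real^'n" where "Q y = (\<chi> i. y $ ?d i)" for y
  have RQ: "R (Q y) = y" "Q (R x) = x" for x y by (auto simp: R_def Q_def vec_eq_iff e)
  have lin: "linear R" "linear Q" by (auto intro!: linearI simp: R_def Q_def vec_eq_iff)
  have R: "dist (R x) (R y) = dist x y" for x y
  proof -
    have "(\<Sum>i\<in>UNIV. (x $ ?e i - y $ ?e i)\<^sup>2) = (\<Sum>i\<in>UNIV. (x $ i - y $ i)\<^sup>2)"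
      using e(1) by (rule sum.reindex_bij_betw)
    then show ?thesis by (simp add: R_def dist_norm norm_vec_def L2_set_def)
  qed
  have injR: "inj R" by (metis RQ(2) injI)
  define h where "h = R \<circ> f \<circ> Q"
  have h: "linear h" "inj h"
    unfolding h_def using lin f injR RQ by (auto intro!: linear_compose inj_compose) (metis RQ(1) injI)
  have Sb: "R ` S \<in> sets borel" "bounded (R ` S)" "f ` S \<in> sets borel"
    using lin injR S f by (auto intro!: inj_linear_image_borel bounded_linear_image simp: card linear_linear)
  have H: "hausdorff_outer CARD('n) (R ` T) = hausdorff_outer CARD('n) T" for T
    by (rule hausdorff_outer_isometry) (rule R)
  have "hausdorff_outer CARD('n) (f ` S) = hausdorff_outer CARD('n) (R ` f ` S)" by (simp add: H)
  also have "R ` f ` S = h ` R ` S" by (simp add: h_def image_image RQ)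
  also have "hausdorff_outer CARD('n) (h ` R ` S) = emeasure lborel (h ` R ` S)"
    using hausdorff_outer_eq_lborel[OF inj_linear_image_borel[OF h _ Sb(1)]] by (simp add: card)
  also have "\<dots> = emeasure lebesgue (h ` R ` S)" 
    using inj_linear_image_borel[OF h _ Sb(1)] by simp
  also have "\<dots> = ennreal \<bar>det (matrix h)\<bar> * emeasure lborel (R ` S)"
  proof -
    have m: "R ` S \<in> lmeasurable" using Sb by (intro bounded_set_imp_lmeasurable) auto
    have "emeasure lebesgue (h ` R ` S) = ennreal (measure lebesgue (h ` R ` S))"
      using measurable_linear_image[OF h(1) m] by (simp add: emeasure_eq_measure2)
    also have "\<dots> = ennreal \<bar>det (matrix h)\<bar> * emeasure lebesgue (R ` S)"
      using m by (simp add: measure_linear_image[OF h(1) m] ennreal_mult emeasure_eq_measure2)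
    finally show ?thesis using Sb by simp
  qed
  also have "emeasure lborel (R ` S) = hausdorff_outer CARD('n) (R ` S)"
    using hausdorff_outer_eq_lborel[OF Sb(1)] by (simp add: card)
  also have "\<dots> = emeasure lborel S"
    using hausdorff_outer_eq_lborel[OF S(1)] by (simp add: H)
  also have "det (matrix h) = det (\<chi> i j. matrix f $ ?e i $ ?e j)"
  proof -
    have Qaxis: "Q (axis j 1) = axis (?e j) 1" for j
      by (auto simp: Q_def vec_eq_iff axis_def e)
    then have "matrix h = (\<chi> i j. matrix f $ ?e i $ ?e j)"
      unfolding matrix_def h_def R_def by (simp add: Qaxis)
    then show ?thesis by simp
  qed
  also have "\<dots> = det (matrix f)" by (rule det_reindex[OF e(1)])
  finally show ?thesis .
qed

section \<open>Determinants of rank-one perturbations\<close>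

text \<open>Row \<open>k\<close> is \<open>v\<close> itself, so multiples of it can be cleared from
  the rows in \<open>S\<close> without changing the determinant; Cramer's rule evaluates the
  identity matrix with row \<open>k\<close> replaced.\<close>

lemma det_replace_row:
  fixes v u :: "real^'n"
  assumes "k \<notin> S"
  shows "det (\<chi> i. if i = k then v else if i \<in> S then axis i 1 + u $ i *s v else axis i 1) = v $ k"
proof -
  have "finite S" by simp
  then show ?thesis using assms
  proof (induction S)
    case empty
    have sum: "(\<Sum>i\<in>UNIV. v $ i *s row i (mat 1 :: real^'n^'n)) = v"
      by (simp add: vec_eq_iff row_def mat_def if_distrib cong: if_cong)
    have "det (\<chi> i. if i = k then v else row i (mat 1)) = v $ k * det (mat 1 :: real^'n^'n)"
      using cramer_lemma_transpose[of k v "mat 1"] unfolding sum .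
    moreover have "row i (mat 1) = axis i (1::real)" for i :: 'n
      by (auto simp: vec_eq_iff row_def mat_def axis_def)
    ultimately show ?case by (simp cong: if_cong)
  next
    case (insert j S)
    let ?B = "\<chi> i. if i = k then v else if i \<in> S then axis i 1 + u $ i *s v else axis i 1"
    have jk: "j \<noteq> k" "k \<notin> S" using insert.prems by auto
    have "(\<chi> i. if i = k then v else if i \<in> insert j S then axis i 1 + u $ i *s v else axis i 1) =
      (\<chi> i. if i = j then row j ?B + u $ j *s row k ?B else row i ?B)"
      using jk insert.hyps by (auto simp: vec_eq_iff row_def)
    then have "det (\<chi> i. if i = k then v else if i \<in> insert j S then axis i 1 + u $ i *s v else axis i 1) = det ?B"
      using det_row_operation[OF jk(1), of ?B "u $ j"] by simp
    then show ?case using insert.IH jk(2) by simp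
  qed
qed

text \<open>The matrix determinant lemma, with the rows perturbed one at a time. By linearity in row
  \<open>k\<close> the new determinant is the old one plus \<open>u $ k\<close> times the one with
  row \<open>k\<close> equal to \<open>v\<close>.\<close>

lemma det_identity_plus_outer:
  fixes u v :: "real^'n"
  shows "det (\<chi> i j. (if i = j then 1 else 0) + u $ i * v $ j) = 1 + u \<bullet> v"
proof -
  have "det (\<chi> i. if i \<in> S then axis i 1 + u $ i *s v else axis i 1) = 1 + (\<Sum>i\<in>S. u $ i * v $ i)"
    if "finite S" for S
    using that
  proof (induction S)
    case empty
    have "(\<chi> i. axis i 1) = (mat 1 :: real^'n^'n)" by (auto simp: vec_eq_iff mat_def axis_def)
    then show ?case by simp
  next
    case (insert k S)
    let ?c = "\<lambda>i. if i \<in> S then axis i 1 + u $ i *s v else axis i 1"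
    have "det (\<chi> i. if i \<in> insert k S then axis i 1 + u $ i *s v else axis i 1) =
        det (\<chi> i. if i = k then axis i 1 + u $ k *s v else ?c i)"
      by (rule arg_cong[where f=det]) (auto simp: vec_eq_iff)
    also have "\<dots> = det (\<chi> i. if i = k then axis i 1 else ?c i) + det (\<chi> i. if i = k then u $ k *s v else ?c i)"
      by (rule det_row_add)
    also have "(\<chi> i. if i = k then axis i 1 else ?c i) = (\<chi> i. ?c i)"
      using insert.hyps by (auto simp: vec_eq_iff)
    also have "det (\<chi> i. if i = k then u $ k *s v else ?c i) = u $ k * v $ k"
      using det_row_mul[of k "u $ k" "\<lambda>_. v" ?c] det_replace_row[OF insert.hyps(2)] by simp
    finally show ?case using insert by simp
  qed
  from this[of UNIV] have "det (\<chi> i. axis i 1 + u $ i *s v) = 1 + u \<bullet> v"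
    by (simp add: inner_vec_def)
  moreover have "(\<chi> i. axis i 1 + u $ i *s v) = (\<chi> i j. (if i = j then 1 else 0) + u $ i * v $ j)"
    by (auto simp: vec_eq_iff axis_def)
  ultimately show ?thesis by simp
qed

subsection \<open>The area formula\<close>

definition gram :: "(real^'a \<Rightarrow> 'w::euclidean_space) \<Rightarrow> real^'a^'a" where
  "gram L = (\<chi> i j. L (axis i 1) \<bullet> L (axis j 1))"

text \<open>The factor by which a linear map scales volume of the dimension of its domain. Through
  the Gram determinant it makes sense for a target of larger dimension.\<close>

definition area_factor :: "(real^'a \<Rightarrow> 'w::euclidean_space) \<Rightarrow> real" where
  "area_factor L = sqrt (det (gram L))"

text \<open>By polarisation, equal norms give equal inner products and hence equal Gram
  matrices.\<close>

lemma area_factor_isometric: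
  fixes L :: "real^'a \<Rightarrow> 'w::euclidean_space" and A :: "real^'a \<Rightarrow> real^'b"
  assumes L: "linear L" and A: "linear A" "\<And>v. norm (A v) = norm (L v)"
  shows "area_factor L = area_factor A"
proof -
  have "A x \<bullet> A y = L x \<bullet> L y" for x y
    using A(2)[of "x + y"] A(2)[of x] A(2)[of y] by (simp add: dot_norm linear_add[OF A(1)] linear_add[OF L])
  then show ?thesis by (simp add: area_factor_def gram_def)
qed

lemma area_factor_square:
  fixes A :: "real^'a \<Rightarrow> real^'a"
  shows "area_factor A = \<bar>det (matrix A)\<bar>"
proof -
  have "gram A = transpose (matrix A) ** matrix A"
    by (simp add: gram_def matrix_matrix_mult_def transpose_def matrix_def vec_eq_iff inner_vec_def)
  then have "det (gram A) = (det (matrix A))\<^sup>2"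
    by (simp add: det_mul det_transpose power2_eq_square)
  then show ?thesis by (simp add: area_factor_def)
qed

text \<open>The range of \<open>L\<close> is isometric to the domain; composing \<open>L\<close>
  with such an isometry gives a square map with the same norms. This reduces maps into larger spaces
  to the determinant formula for linear images.\<close>

lemma isometric_square_root:
  fixes L :: "real^'a \<Rightarrow> 'w::euclidean_space"
  assumes L: "linear L" "inj L"
  obtains A :: "real^'a \<Rightarrow> real^'a" where "linear A" "inj A" "\<And>v. norm (A v) = norm (L v)"
    "\<bar>det (matrix A)\<bar> = area_factor L" "0 < area_factor L"
proof -
  have "subspace (range L)" using L(1) by (simp add: linear_subspace_image)
  moreover have "dim (range L) = dim (UNIV :: (real^'a) set)"
    using L by (simp add: dim_image_eq)
  ultimately obtain f :: "'w \<Rightarrow> real^'a" where f: "linear f" "f ` range L = UNIV"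
      "\<And>x. x \<in> range L \<Longrightarrow> norm (f x) = norm x"
  proof (rule isometry_subspaces[OF _ subspace_UNIV])
    fix f :: "'w \<Rightarrow> real^'a"
    assume *: "linear f" "f ` range L = UNIV" "\<And>x. x \<in> range L \<Longrightarrow> norm (f x) = norm x"
    show thesis by (rule that[OF *])
  qed
  define A where "A = f \<circ> L"
  have A: "linear A" "\<And>v. norm (A v) = norm (L v)"
    using f L by (auto simp: A_def intro: linear_compose)
  have "inj A"
    using A L by (auto simp: linear_injective_0) (metis norm_eq_zero)
  moreover have J: "\<bar>det (matrix A)\<bar> = area_factor L"
    using area_factor_isometric[OF L(1) A] area_factor_square[of A] by simp
  moreover have "0 < area_factor L"
    using J \<open>inj A\<close> A(1) det_nz_iff_inj[of A] by (metis zero_less_abs_iff)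
  ultimately show ?thesis using that A by blast
qed

lemma continuous_on_area_factor:
  fixes L :: "'c::topological_space \<Rightarrow> real^'a \<Rightarrow> 'w::euclidean_space"
  assumes "\<And>v. continuous_on U (\<lambda>u. L u v)"
  shows "continuous_on U (\<lambda>u. area_factor (L u))"
  unfolding area_factor_def gram_def det_def
  using assms by (auto intro!: continuous_intros)

lemma norm_le_axis_sum:
  fixes T :: "real^'a \<Rightarrow> 'w::euclidean_space" and c :: real
  assumes "linear T" "\<And>i. norm (T (axis i 1)) \<le> c"
  shows "norm (T v) \<le> CARD('a) * c * norm v"
proof -
  have "norm (T v) = norm (\<Sum>i\<in>UNIV. (v $ i) *\<^sub>R T (axis i 1))"
    by (subst basis_expansion[symmetric, of v])
      (simp add: linear_sum[OF assms(1)] linear_scale[OF assms(1)] scalar_mult_eq_scaleR)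
  also have "\<dots> \<le> (\<Sum>i\<in>(UNIV :: 'a set). norm v * c)"
    by (rule order_trans[OF norm_sum sum_mono]) (use assms(2) component_le_norm_cart[of v] in \<open>auto intro!: mult_mono\<close>)
  finally show ?thesis by (simp add: mult_ac)
qed

text \<open>In the linear coordinates \<open>A\<close>, for which \<open>norm (A v) = norm (\<phi>' u v)\<close>, the map \<open>\<phi>\<close> is nearly an
  isometry around \<open>u\<close>.\<close>

lemma C1_almost_isometry:
  fixes \<phi> :: "real^'a \<Rightarrow> 'w::euclidean_space" and A :: "real^'a \<Rightarrow> real^'a" and \<phi>' :: "real^'a \<Rightarrow> real^'a \<Rightarrow> 'w"
  assumes U: "open U" "u \<in> U"
    and der: "\<And>u. u \<in> U \<Longrightarrow> (\<phi> has_derivative \<phi>' u) (at u)"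
    and cont: "\<And>v. continuous_on U (\<lambda>u. \<phi>' u v)"
    and \<epsilon>: "0 < \<epsilon>" "\<epsilon> < 1"
    and A: "linear A" "inj A" "\<And>v. norm (A v) = norm (\<phi>' u v)"
  obtains r where "0 < r" "ball u r \<subseteq> U"
    "\<And>x y. x \<in> ball u r \<Longrightarrow> y \<in> ball u r \<Longrightarrow>
       (1 - \<epsilon>) * norm (A (x - y)) \<le> norm (\<phi> x - \<phi> y) \<and> norm (\<phi> x - \<phi> y) \<le> (1 + \<epsilon>) * norm (A (x - y))"
    "\<And>x. x \<in> ball u r \<Longrightarrow>
       (1 - \<epsilon>) * area_factor (\<phi>' u) \<le> area_factor (\<phi>' x) \<and> area_factor (\<phi>' x) \<le> (1 + \<epsilon>) * area_factor (\<phi>' u)"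
proof -
  have lin: "linear (\<phi>' x)" if "x \<in> U" for x using der[OF that] by (rule has_derivative_linear)
  obtain B where B: "B > 0" "\<And>x. norm x * B \<le> norm (A x)"
    using linear_inj_bounded_below_pos[OF A(1,2)] by (auto simp: mult.commute)
  \<comment> \<open>An error of \<eta> on every axis vector is an error of at most
    \<open>\<epsilon> * B\<close> in operator norm, and \<open>B\<close> times the length of a
    vector is at most the length of its image under \<open>A\<close>.\<close>
  define \<eta> where "\<eta> = \<epsilon> * B / CARD('a)"
  have \<eta>: "0 < \<eta>" using \<epsilon> B by (simp add: \<eta>_def)
  have inj': "inj (\<phi>' u)" using A lin[OF U(2)] by (auto simp: linear_injective_0) (metis norm_eq_zero)
  have J0: "0 < area_factor (\<phi>' u)" using isometric_square_root[OF lin[OF U(2)] inj'] by metis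
  have "eventually (\<lambda>x. norm (\<phi>' x (axis i 1) - \<phi>' u (axis i 1)) < \<eta>) (nhds u)" for i
  proof -
    have "isCont (\<lambda>x. \<phi>' x (axis i 1)) u" using cont[of "axis i 1"] U by (simp add: continuous_on_eq_continuous_at)
    then have "((\<lambda>x. \<phi>' x (axis i 1)) \<longlongrightarrow> \<phi>' u (axis i 1)) (nhds u)"
      using tendsto_at_iff_tendsto_nhds[of "\<lambda>x. \<phi>' x (axis i 1)" u] by (simp add: continuous_at)
    then show ?thesis using \<eta> by (auto simp: tendsto_iff dist_norm)
  qed
  then have "eventually (\<lambda>x. \<forall>i. norm (\<phi>' x (axis i 1) - \<phi>' u (axis i 1)) < \<eta>) (nhds u)"
    by (rule eventually_all_finite)
  moreover have "eventually (\<lambda>x. x \<in> U) (nhds u)" using U by (rule eventually_nhds_in_open)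
  moreover have "eventually (\<lambda>x. dist (area_factor (\<phi>' x)) (area_factor (\<phi>' u)) < \<epsilon> * area_factor (\<phi>' u)) (nhds u)"
  proof -
    have "isCont (\<lambda>x. area_factor (\<phi>' x)) u"
      using continuous_on_area_factor[of U \<phi>', OF cont] U by (simp add: continuous_on_eq_continuous_at)
    then have "((\<lambda>x. area_factor (\<phi>' x)) \<longlongrightarrow> area_factor (\<phi>' u)) (nhds u)"
      using tendsto_at_iff_tendsto_nhds[of "\<lambda>x. area_factor (\<phi>' x)" u] by (simp add: continuous_at)
    then show ?thesis using \<epsilon> J0 by (intro tendstoD) auto
  qed
  ultimately have "eventually (\<lambda>x. (\<forall>i. norm (\<phi>' x (axis i 1) - \<phi>' u (axis i 1)) < \<eta>) \<and> x \<in> U \<and>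
      dist (area_factor (\<phi>' x)) (area_factor (\<phi>' u)) < \<epsilon> * area_factor (\<phi>' u)) (nhds u)"
    by eventually_elim simp
  then obtain r where r: "0 < r" and rb: "\<And>x. x \<in> ball u r \<Longrightarrow>
      (\<forall>i. norm (\<phi>' x (axis i 1) - \<phi>' u (axis i 1)) < \<eta>) \<and> x \<in> U \<and>
      dist (area_factor (\<phi>' x)) (area_factor (\<phi>' u)) < \<epsilon> * area_factor (\<phi>' u)"
    unfolding eventually_nhds_metric by (auto simp: dist_commute)
  show ?thesis
  proof (rule that[OF r])
    show "ball u r \<subseteq> U" by (rule subsetI) (simp only: rb)
    fix x assume x: "x \<in> ball u r"
    show "(1 - \<epsilon>) * area_factor (\<phi>' u) \<le> area_factor (\<phi>' x) \<and> area_factor (\<phi>' x) \<le> (1 + \<epsilon>) * area_factor (\<phi>' u)"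
    proof -
      have "\<bar>area_factor (\<phi>' x) - area_factor (\<phi>' u)\<bar> < \<epsilon> * area_factor (\<phi>' u)"
        using rb[OF x] by (simp only: dist_real_def)
      then show ?thesis by (simp add: left_diff_distrib distrib_right abs_less_iff)
    qed
    fix y assume y: "y \<in> ball u r"
    \<comment> \<open>The mean value inequality for \<phi> minus its linear part at
      \<open>u\<close>, whose derivative is small on the whole ball.\<close>
    have "norm ((\<phi> x - \<phi>' u x) - (\<phi> y - \<phi>' u y)) \<le> (\<epsilon> * B) * norm (x - y)"
    proof (rule differentiable_bound[where f = "\<lambda>x. \<phi> x - \<phi>' u x" and f' = "\<lambda>z h. \<phi>' z h - \<phi>' u h",
          OF convex_ball _ _ x y])
      fix z assume z: "z \<in> ball u r"
      show "((\<lambda>x. \<phi> x - \<phi>' u x) has_derivative (\<lambda>h. \<phi>' z h - \<phi>' u h)) (at z within ball u r)"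
        using rb[OF z] by (intro has_derivative_diff has_derivative_at_withinI[OF der]
            linear_imp_has_derivative lin U(2)) auto
      show "onorm (\<lambda>h. \<phi>' z h - \<phi>' u h) \<le> \<epsilon> * B"
      proof (rule onorm_le)
        fix h
        have "norm (\<phi>' z h - \<phi>' u h) \<le> CARD('a) * \<eta> * norm h"
        proof (rule norm_le_axis_sum)
          show "linear (\<lambda>h. \<phi>' z h - \<phi>' u h)" using rb[OF z] by (intro linear_compose_sub lin U(2)) auto
          show "norm (\<phi>' z (axis i 1) - \<phi>' u (axis i 1)) \<le> \<eta>" for i
            using rb[OF z] by (simp add: less_imp_le)
        qed
        then show "norm (\<phi>' z h - \<phi>' u h) \<le> (\<epsilon> * B) * norm h" by (simp add: \<eta>_def)
      qed
    qed
    also have "\<dots> \<le> \<epsilon> * norm (A (x - y))"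
      using B(2)[of "x - y"] \<epsilon> by (simp add: mult.assoc mult.commute[of B])
    finally have *: "norm ((\<phi> x - \<phi> y) - \<phi>' u (x - y)) \<le> \<epsilon> * norm (A (x - y))"
      by (simp add: linear_diff[OF lin[OF U(2)]] algebra_simps)
    have "norm (\<phi> x - \<phi> y) \<le> norm (\<phi>' u (x - y)) + norm ((\<phi> x - \<phi> y) - \<phi>' u (x - y))"
      by (metis norm_triangle_sub)
    moreover have "norm (\<phi>' u (x - y)) \<le> norm (\<phi> x - \<phi> y) + norm ((\<phi> x - \<phi> y) - \<phi>' u (x - y))"
      by (metis norm_minus_commute norm_triangle_sub)
    ultimately show "(1 - \<epsilon>) * norm (A (x - y)) \<le> norm (\<phi> x - \<phi> y) \<and>
        norm (\<phi> x - \<phi> y) \<le> (1 + \<epsilon>) * norm (A (x - y))"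
      using * A(3)[of "x - y"] by (simp add: algebra_simps)
  qed
qed

text \<open>Seen from the image of \<open>C\<close> under \<open>A\<close>, the map \<phi> is
  Lipschitz with constant 1 + \<epsilon> and its inverse with constant 1 / (1 - \<epsilon>); the
  linear image is already measured exactly.\<close>

lemma hausdorff_outer_almost_isometry:
  fixes \<phi> :: "real^'a \<Rightarrow> 'w::euclidean_space"
  assumes A: "linear A" "inj A" and \<epsilon>: "0 < \<epsilon>" "\<epsilon> < 1"
    and bi: "\<And>x y. x \<in> C \<Longrightarrow> y \<in> C \<Longrightarrow>
       (1 - \<epsilon>) * norm (A (x - y)) \<le> norm (\<phi> x - \<phi> y) \<and> norm (\<phi> x - \<phi> y) \<le> (1 + \<epsilon>) * norm (A (x - y))"
    and C: "C \<in> sets borel" "bounded C"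
  shows "hausdorff_outer CARD('a) (\<phi> ` C) \<le> ennreal ((1 + \<epsilon>) ^ CARD('a) * \<bar>det (matrix A)\<bar>) * emeasure lborel C"
    and "ennreal \<bar>det (matrix A)\<bar> * emeasure lborel C
       \<le> ennreal ((1 / (1 - \<epsilon>)) ^ CARD('a)) * hausdorff_outer CARD('a) (\<phi> ` C)"
proof -
  let ?d = "CARD('a)"
  have inv: "inv A (A x) = x" for x using A(2) by simp
  have HA: "hausdorff_outer ?d (A ` C) = ennreal \<bar>det (matrix A)\<bar> * emeasure lborel C"
    using A C by (rule hausdorff_outer_linear_image)
  have "hausdorff_outer ?d ((\<phi> \<circ> inv A) ` (A ` C)) \<le> ennreal ((1 + \<epsilon>) ^ ?d) * hausdorff_outer ?d (A ` C)"
  proof (rule hausdorff_outer_Lipschitz)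
    fix x y assume "x \<in> A ` C" "y \<in> A ` C"
    then obtain x' y' where *: "x' \<in> C" "y' \<in> C" "x = A x'" "y = A y'" by blast
    show "dist ((\<phi> \<circ> inv A) x) ((\<phi> \<circ> inv A) y) \<le> (1 + \<epsilon>) * dist x y"
      using bi[OF *(1,2)] by (simp add: * inv dist_norm linear_diff[OF A(1)])
  qed (use \<epsilon> in auto)
  moreover have "(\<phi> \<circ> inv A) ` (A ` C) = \<phi> ` C" by (simp add: image_image inv)
  ultimately show "hausdorff_outer ?d (\<phi> ` C) \<le> ennreal ((1 + \<epsilon>) ^ ?d * \<bar>det (matrix A)\<bar>) * emeasure lborel C"
    using \<epsilon> by (simp add: HA ennreal_mult mult.assoc)
  have "inj_on \<phi> C"
  proof (rule inj_onI)
    fix x y assume xy: "x \<in> C" "y \<in> C" "\<phi> x = \<phi> y"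
    then have "(1 - \<epsilon>) * norm (A (x - y)) \<le> 0" using bi[of x y] by auto
    then have "A (x - y) = 0" using \<epsilon> by (simp add: mult_le_0_iff)
    then show "x = y" using A by (metis eq_iff_diff_eq_0 linear_injective_0)
  qed
  have "hausdorff_outer ?d ((A \<circ> the_inv_into C \<phi>) ` (\<phi> ` C)) \<le> ennreal ((1 / (1 - \<epsilon>)) ^ ?d) * hausdorff_outer ?d (\<phi> ` C)"
  proof (rule hausdorff_outer_Lipschitz)
    fix x y assume "x \<in> \<phi> ` C" "y \<in> \<phi> ` C"
    then obtain x' y' where *: "x' \<in> C" "y' \<in> C" "x = \<phi> x'" "y = \<phi> y'" by blast
    show "dist ((A \<circ> the_inv_into C \<phi>) x) ((A \<circ> the_inv_into C \<phi>) y) \<le> (1 / (1 - \<epsilon>)) * dist x y"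
      using bi[OF *(1,2)] \<epsilon>
      by (simp add: * the_inv_into_f_f[OF \<open>inj_on \<phi> C\<close>] dist_norm linear_diff[OF A(1), symmetric] field_simps)
  qed (use \<epsilon> in auto)
  moreover have "(A \<circ> the_inv_into C \<phi>) ` (\<phi> ` C) = A ` C"
    unfolding image_image by (intro image_cong refl) (simp add: the_inv_into_f_f[OF \<open>inj_on \<phi> C\<close>])
  ultimately show "ennreal \<bar>det (matrix A)\<bar> * emeasure lborel C
       \<le> ennreal ((1 / (1 - \<epsilon>)) ^ ?d) * hausdorff_outer ?d (\<phi> ` C)"
    by (simp add: HA)
qed

text \<open>Two errors, the distortion of \<phi> relative to its linearisation and the oscillation
  of the area factor over the ball, are absorbed into one factor \<open>k\<close>.\<close>

lemma area_formula_local: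
  fixes \<phi> :: "real^'a \<Rightarrow> 'w::euclidean_space" and \<phi>' :: "real^'a \<Rightarrow> real^'a \<Rightarrow> 'w"
  assumes U: "open U" "u \<in> U"
    and der: "\<And>u. u \<in> U \<Longrightarrow> (\<phi> has_derivative \<phi>' u) (at u)"
    and cont: "\<And>v. continuous_on U (\<lambda>u. \<phi>' u v)"
    and inj': "inj (\<phi>' u)" and k: "1 < k"
  obtains r where "0 < r" "ball u r \<subseteq> U"
    "\<And>C. C \<in> sets borel \<Longrightarrow> C \<subseteq> ball u r \<Longrightarrow>
       hausdorff_outer CARD('a) (\<phi> ` C) \<le> ennreal k * (\<integral>\<^sup>+x. ennreal (area_factor (\<phi>' x)) * indicator C x \<partial>lborel) \<and>
       (\<integral>\<^sup>+x. ennreal (area_factor (\<phi>' x)) * indicator C x \<partial>lborel) \<le> ennreal k * hausdorff_outer CARD('a) (\<phi> ` C)"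
proof -
  let ?d = "CARD('a)"
  have lin: "linear (\<phi>' u)" using der[OF U(2)] by (rule has_derivative_linear)
  obtain A :: "real^'a \<Rightarrow> real^'a" where A: "linear A" "inj A" "\<And>v. norm (A v) = norm (\<phi>' u v)"
      and J: "\<bar>det (matrix A)\<bar> = area_factor (\<phi>' u)" "0 < area_factor (\<phi>' u)"
    using isometric_square_root[OF lin inj'] by metis
  let ?J = "area_factor (\<phi>' u)"
  \<comment> \<open>The upper estimate combines the Lipschitz constant of \<phi> with the smallest
    area factor; the lower estimate combines that of the inverse with the largest.\<close>
  obtain \<epsilon> where \<epsilon>: "0 < \<epsilon>" "\<epsilon> < 1" "(1 + \<epsilon>) ^ ?d / (1 - \<epsilon>) \<le> k" "(1 + \<epsilon>) / (1 - \<epsilon>) ^ ?d \<le> k"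
  proof -
    have "((\<lambda>\<epsilon>. (1 + \<epsilon>) ^ ?d / (1 - \<epsilon>)) \<longlongrightarrow> (1 + 0) ^ ?d / (1 - 0)) (at_right (0::real))"
      by (intro tendsto_intros) auto
    then have "eventually (\<lambda>\<epsilon>. (1 + \<epsilon>) ^ ?d / (1 - \<epsilon>) < k) (at_right (0::real))"
      using k by (intro order_tendstoD(2)) auto
    moreover have "((\<lambda>\<epsilon>. (1 + \<epsilon>) / (1 - \<epsilon>) ^ ?d) \<longlongrightarrow> (1 + 0) / (1 - 0) ^ ?d) (at_right (0::real))"
      by (intro tendsto_intros) auto
    then have "eventually (\<lambda>\<epsilon>. (1 + \<epsilon>) / (1 - \<epsilon>) ^ ?d < k) (at_right (0::real))"
      using k by (intro order_tendstoD(2)) auto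
    moreover have "eventually (\<lambda>\<epsilon>. \<epsilon> \<in> {0<..<1}) (at_right (0::real))"
      by (intro eventually_at_right_real) auto
    ultimately have "eventually (\<lambda>\<epsilon>. (1 + \<epsilon>) ^ ?d / (1 - \<epsilon>) < k \<and> (1 + \<epsilon>) / (1 - \<epsilon>) ^ ?d < k \<and> \<epsilon> \<in> {0<..<1}) (at_right (0::real))"
      by eventually_elim simp
    then obtain \<epsilon> where "(1 + \<epsilon>) ^ ?d / (1 - \<epsilon>) < k \<and> (1 + \<epsilon>) / (1 - \<epsilon>) ^ ?d < k \<and> \<epsilon> \<in> {0<..<1}"
      using eventually_happens'[OF trivial_limit_at_right_real] by blast
    then show thesis by (intro that[of \<epsilon>]) auto
  qed
  obtain r where r: "0 < r" "ball u r \<subseteq> U"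
    "\<And>x y. x \<in> ball u r \<Longrightarrow> y \<in> ball u r \<Longrightarrow>
       (1 - \<epsilon>) * norm (A (x - y)) \<le> norm (\<phi> x - \<phi> y) \<and> norm (\<phi> x - \<phi> y) \<le> (1 + \<epsilon>) * norm (A (x - y))"
    "\<And>x. x \<in> ball u r \<Longrightarrow>
       (1 - \<epsilon>) * ?J \<le> area_factor (\<phi>' x) \<and> area_factor (\<phi>' x) \<le> (1 + \<epsilon>) * ?J"
    using C1_almost_isometry[OF U der cont \<epsilon>(1,2) A] by metis
  show ?thesis
  proof (rule that[OF r(1,2)])
    fix C assume C: "C \<in> sets borel" "C \<subseteq> ball u r"
    have bC: "bounded C" using C(2) bounded_ball bounded_subset by blast
    have bi: "(1 - \<epsilon>) * norm (A (x - y)) \<le> norm (\<phi> x - \<phi> y) \<and> norm (\<phi> x - \<phi> y) \<le> (1 + \<epsilon>) * norm (A (x - y))"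
      if "x \<in> C" "y \<in> C" for x y using r(3)[of x y] that C(2) by blast
    note H = hausdorff_outer_almost_isometry[OF A(1,2) \<epsilon>(1,2) bi C(1) bC, unfolded J(1)]
    let ?I = "\<integral>\<^sup>+x. ennreal (area_factor (\<phi>' x)) * indicator C x \<partial>lborel"
    have I1: "ennreal ((1 - \<epsilon>) * ?J) * emeasure lborel C \<le> ?I"
    proof -
      have "ennreal ((1 - \<epsilon>) * ?J) * emeasure lborel C = (\<integral>\<^sup>+x. ennreal ((1 - \<epsilon>) * ?J) * indicator C x \<partial>lborel)"
        using C(1) by (simp add: nn_integral_cmult_indicator)
      also have "\<dots> \<le> ?I"
        using r(4) C(2) by (intro nn_integral_mono) (auto split: split_indicator intro!: ennreal_leI)
      finally show ?thesis .
    qed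
    have I2: "?I \<le> ennreal ((1 + \<epsilon>) * ?J) * emeasure lborel C"
    proof -
      have "?I \<le> (\<integral>\<^sup>+x. ennreal ((1 + \<epsilon>) * ?J) * indicator C x \<partial>lborel)"
        using r(4) C(2) by (intro nn_integral_mono) (auto split: split_indicator intro!: ennreal_leI)
      also have "\<dots> = ennreal ((1 + \<epsilon>) * ?J) * emeasure lborel C"
        using C(1) by (simp add: nn_integral_cmult_indicator)
      finally show ?thesis .
    qed
    have "hausdorff_outer ?d (\<phi> ` C) \<le> ennreal ((1 + \<epsilon>) ^ ?d * ?J) * emeasure lborel C" by (rule H(1))
    also have "(1 + \<epsilon>) ^ ?d * ?J = ((1 + \<epsilon>) ^ ?d / (1 - \<epsilon>)) * ((1 - \<epsilon>) * ?J)" using \<epsilon> by simp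
    also have "ennreal \<dots> * emeasure lborel C = ennreal ((1 + \<epsilon>) ^ ?d / (1 - \<epsilon>)) * (ennreal ((1 - \<epsilon>) * ?J) * emeasure lborel C)"
    proof -
      have "ennreal (((1 + \<epsilon>) ^ ?d / (1 - \<epsilon>)) * ((1 - \<epsilon>) * ?J)) = ennreal ((1 + \<epsilon>) ^ ?d / (1 - \<epsilon>)) * ennreal ((1 - \<epsilon>) * ?J)"
        by (rule ennreal_mult) (use \<epsilon> J in auto)
      then show ?thesis by (simp only: mult.assoc)
    qed
    also have "\<dots> \<le> ennreal k * ?I" using \<epsilon> by (intro mult_mono I1 ennreal_leI) auto
    finally have 1: "hausdorff_outer ?d (\<phi> ` C) \<le> ennreal k * ?I" .
    have "?I \<le> ennreal ((1 + \<epsilon>) * ?J) * emeasure lborel C" by (rule I2)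
    also have "\<dots> = ennreal (1 + \<epsilon>) * (ennreal ?J * emeasure lborel C)"
      using \<epsilon> J by (subst ennreal_mult) (auto simp: mult.assoc)
    also have "\<dots> \<le> ennreal (1 + \<epsilon>) * (ennreal ((1 / (1 - \<epsilon>)) ^ ?d) * hausdorff_outer ?d (\<phi> ` C))"
      by (rule mult_left_mono[OF H(2) zero_le])
    also have "\<dots> = ennreal ((1 + \<epsilon>) / (1 - \<epsilon>) ^ ?d) * hausdorff_outer ?d (\<phi> ` C)"
      using \<epsilon> by (subst mult.assoc[symmetric], subst ennreal_mult[symmetric]) (auto simp: power_divide)
    also have "\<dots> \<le> ennreal k * hausdorff_outer ?d (\<phi> ` C)" using \<epsilon> by (intro mult_right_mono ennreal_leI) auto
    finally show "hausdorff_outer ?d (\<phi> ` C) \<le> ennreal k * ?I \<and> ?I \<le> ennreal k * hausdorff_outer ?d (\<phi> ` C)"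
      using 1 by blast
  qed
qed

section \<open>Globalising the area formula\<close>

text \<open>Open sets are countable unions of compact sets, whose images are compact. Induction over
  the generated sigma-algebra does the rest; injectivity is what carries complements over.\<close>

lemma injective_continuous_image_borel:
  fixes \<phi> :: "'a::euclidean_space \<Rightarrow> 'w::euclidean_space"
  assumes U: "open U" and cont: "continuous_on U \<phi>" and inj: "inj_on \<phi> U" and B: "B \<in> sets borel"
  shows "\<phi> ` (U \<inter> B) \<in> sets borel"
proof -
  have op: "\<phi> ` V \<in> sets borel" if V: "open V" "V \<subseteq> U" for V
  proof -
    obtain C :: "nat \<Rightarrow> 'a set" where C: "\<And>n. compact (C n)" "\<And>n. C n \<subseteq> V" "\<Union>(range C) = V"
    proof (rule open_Union_compact_subsets[OF V(1)])
      fix C :: "nat \<Rightarrow> 'a set"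
      assume *: "\<And>n. compact (C n)" "\<And>n. C n \<subseteq> V" "\<Union>(range C) = V"
      show thesis by (rule that[OF *])
    qed
    have "compact (\<phi> ` C n)" for n
      by (rule compact_continuous_image[OF continuous_on_subset[OF cont order_trans[OF C(2) V(2)]] C(1)])
    then have "(\<Union>n. \<phi> ` C n) \<in> sets borel" by (intro sets.countable_UN) (auto intro: borel_compact)
    also have "(\<Union>n. \<phi> ` C n) = \<phi> ` V" using C(3) by blast
    finally show ?thesis .
  qed
  have "B \<in> sigma_sets UNIV {S. open S}" using B by (simp add: borel_def)
  then show ?thesis
  proof induction
    case (Basic S)
    then show ?case using op[of "U \<inter> S"] U by auto
  next
    case Empty
    then show ?case by simp
  next
    case (Compl S)
    have "\<phi> ` (U \<inter> (UNIV - S)) = \<phi> ` U - \<phi> ` (U \<inter> S)"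
      using inj by (auto simp: inj_on_def)
    then show ?case using op[of U] U Compl.IH by auto
  next
    case (Union S)
    have "\<phi> ` (U \<inter> \<Union>(range S)) = (\<Union>i. \<phi> ` (U \<inter> S i))" by blast
    then show ?case using Union.IH by auto
  qed
qed

lemma ennreal_le_of_le_mult:
  fixes x y :: ennreal
  assumes "\<And>k. 1 < k \<Longrightarrow> x \<le> ennreal k * y"
  shows "x \<le> y"
proof (cases y)
  case (real c)
  show ?thesis
  proof (rule ennreal_le_epsilon)
    fix e :: real assume e: "0 < e"
    have "x \<le> ennreal (1 + e / (c + 1)) * y" using e real by (intro assms) simp
    also have "\<dots> = ennreal ((1 + e / (c + 1)) * c)" using e real by (simp add: ennreal_mult)
    also have "(1 + e / (c + 1)) * c \<le> c + e" using e real by (simp add: field_simps)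
    then have "ennreal ((1 + e / (c + 1)) * c) \<le> y + ennreal e"
      using e real by (simp add: ennreal_plus[symmetric] ennreal_leI del: ennreal_plus)
    finally show "x \<le> y + ennreal e" .
  qed
qed simp

text \<open>Countably many of the local balls cover \<open>U\<close>. On disjoint Borel pieces both
  sides are countably additive, the left one because images of the pieces are disjoint and Borel.
  The global error is the same factor \<open>k\<close>, which then tends to 1.\<close>

theorem area_formula:
  fixes \<phi> :: "real^'a \<Rightarrow> 'w::euclidean_space" and \<phi>' :: "real^'a \<Rightarrow> real^'a \<Rightarrow> 'w"
  assumes U: "open U"
    and der: "\<And>u. u \<in> U \<Longrightarrow> (\<phi> has_derivative \<phi>' u) (at u)"
    and cont: "\<And>v. continuous_on U (\<lambda>u. \<phi>' u v)"
    and inj': "\<And>u. u \<in> U \<Longrightarrow> inj (\<phi>' u)" and inj: "inj_on \<phi> U"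
    and B: "B \<in> sets borel" "B \<subseteq> U"
  shows "hausdorff_outer CARD('a) (\<phi> ` B) = (\<integral>\<^sup>+x. ennreal (area_factor (\<phi>' x)) * indicator B x \<partial>lborel)"
proof -
  let ?d = "CARD('a)" and ?H = "hausdorff_measure CARD('a) :: 'w measure"
  let ?I = "\<lambda>C. \<integral>\<^sup>+x. ennreal (area_factor (\<phi>' x)) * indicator C x \<partial>lborel"
  have c\<phi>: "continuous_on U \<phi>"
    using der U by (meson continuous_at_imp_continuous_on has_derivative_continuous)
  have img: "\<phi> ` C \<in> sets borel" if "C \<in> sets borel" "C \<subseteq> U" for C
    using injective_continuous_image_borel[OF U c\<phi> inj that(1)] that(2) by (simp add: Int_absorb1)
  have key: "hausdorff_outer ?d (\<phi> ` B) \<le> ennreal k * ?I B \<and> ?I B \<le> ennreal k * hausdorff_outer ?d (\<phi> ` B)"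
    if k: "1 < k" for k
  proof -
    define P where "P u r \<longleftrightarrow> 0 < r \<and> ball u r \<subseteq> U \<and> (\<forall>C. C \<in> sets borel \<longrightarrow> C \<subseteq> ball u r \<longrightarrow>
        hausdorff_outer ?d (\<phi> ` C) \<le> ennreal k * ?I C \<and> ?I C \<le> ennreal k * hausdorff_outer ?d (\<phi> ` C))" for u r
    have "\<exists>r. P u r" if u: "u \<in> U" for u
    proof (rule area_formula_local[OF U u der cont inj'[OF u] k])
      fix r assume *: "0 < r" "ball u r \<subseteq> U"
        "\<And>C. C \<in> sets borel \<Longrightarrow> C \<subseteq> ball u r \<Longrightarrow>
          hausdorff_outer ?d (\<phi> ` C) \<le> ennreal k * ?I C \<and> ?I C \<le> ennreal k * hausdorff_outer ?d (\<phi> ` C)"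
      show "\<exists>r. P u r" unfolding P_def by (intro exI[of _ r] conjI *(1,2) allI impI *(3)[THEN conjunct1] *(3)[THEN conjunct2])
    qed
    then obtain r where Pr: "\<And>u. u \<in> U \<Longrightarrow> P u (r u)" by metis
    have r: "0 < r u" "ball u (r u) \<subseteq> U" 
        "\<And>C. C \<in> sets borel \<Longrightarrow> C \<subseteq> ball u (r u) \<Longrightarrow>
        hausdorff_outer ?d (\<phi> ` C) \<le> ennreal k * ?I C \<and> ?I C \<le> ennreal k * hausdorff_outer ?d (\<phi> ` C)"
      if "u \<in> U" for u
      using Pr[OF that] unfolding P_def by blast+
    obtain \<F> where \<F>: "\<F> \<subseteq> (\<lambda>u. ball u (r u)) ` U" "countable \<F>" "\<Union>\<F> = \<Union>((\<lambda>u. ball u (r u)) ` U)"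
    proof (rule Lindelof[of "(\<lambda>u. ball u (r u)) ` U"])
      show "\<And>S. S \<in> (\<lambda>u. ball u (r u)) ` U \<Longrightarrow> open S" by auto
      fix \<F> assume *: "\<F> \<subseteq> (\<lambda>u. ball u (r u)) ` U" "countable \<F>" "\<Union>\<F> = \<Union>((\<lambda>u. ball u (r u)) ` U)"
      show thesis by (rule that[OF *])
    qed
    \<comment> \<open>Adding the empty set keeps the enumerated family nonempty when
      \<open>U\<close> is empty.\<close>
    define N where "N = from_nat_into (insert {} \<F>)"
    have rN: "range N = insert {} \<F>" unfolding N_def using \<F>(2) by (intro range_from_nat_into) auto
    have N: "N n = {} \<or> (\<exists>u\<in>U. N n = ball u (r u))" for n
      using rN \<F>(1) by (metis (no_types, lifting) image_iff insertE rangeI subsetD)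
    have oN: "N n \<in> sets borel" for n using N[of n] by auto
    define C where "C n = B \<inter> disjointed N n" for n
    have Cb: "C n \<in> sets borel" for n
      unfolding C_def using B(1) sets.range_disjointed_sets[of N borel] oN by auto
    have CN: "C n \<subseteq> N n" "C n \<subseteq> U" for n
      using disjointed_subset[of N n] B(2) by (auto simp: C_def)
    have BC: "B = (\<Union>n. C n)"
    proof -
      have "B \<subseteq> \<Union>\<F>" using B(2) r(1) \<F>(3) by (auto intro: centre_in_ball[THEN iffD2])
      also have "\<Union>\<F> = (\<Union>n. disjointed N n)" unfolding UN_disjointed_eq using rN by auto
      finally show ?thesis by (auto simp: C_def)
    qed
    have dC: "disjoint_family C"
      using disjoint_family_disjointed[of N] by (auto simp: C_def disjoint_family_on_def)
    have loc: "hausdorff_outer ?d (\<phi> ` C n) \<le> ennreal k * ?I (C n) \<and> ?I (C n) \<le> ennreal k * hausdorff_outer ?d (\<phi> ` C n)" for n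
    proof (cases "N n = {}")
      case True
      then have "C n = {}" using CN by auto
      then show ?thesis by simp
    next
      case False
      then obtain u where "u \<in> U" "N n = ball u (r u)" using N[of n] by blast
      then show ?thesis using r(3)[of u "C n"] Cb CN by auto
    qed
    have H: "hausdorff_outer ?d (\<phi> ` B) = (\<Sum>n. hausdorff_outer ?d (\<phi> ` C n))"
    proof -
      have "hausdorff_outer ?d (\<phi> ` B) = emeasure ?H (\<Union>n. \<phi> ` C n)"
        using img[OF B] by (simp add: emeasure_hausdorff_measure BC image_UN)
      also have "\<dots> = (\<Sum>n. emeasure ?H (\<phi> ` C n))"
      proof (rule suminf_emeasure[symmetric])
        show "range (\<lambda>n. \<phi> ` C n) \<subseteq> sets ?H" using img Cb CN by auto
        show "disjoint_family (\<lambda>n. \<phi> ` C n)"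
          unfolding disjoint_family_on_def
        proof (intro ballI impI)
          fix m n :: nat assume "m \<noteq> n"
          then have "C m \<inter> C n = {}" using dC by (auto simp: disjoint_family_on_def)
          then show "\<phi> ` C m \<inter> \<phi> ` C n = {}"
            using inj_on_image_Int[OF inj CN(2) CN(2)] by (metis image_empty)
        qed
      qed
      also have "\<dots> = (\<Sum>n. hausdorff_outer ?d (\<phi> ` C n))"
        using img Cb CN by (simp add: emeasure_hausdorff_measure)
      finally show ?thesis .
    qed
    have I: "?I B = (\<Sum>n. ?I (C n))"
    proof -
      have m: "(\<lambda>x. ennreal (area_factor (\<phi>' x)) * indicator S x) \<in> borel_measurable borel" if "S \<in> sets borel" "S \<subseteq> U" for S
      proof -
        have "(\<lambda>x. indicator S x *\<^sub>R area_factor (\<phi>' x)) \<in> borel_measurable borel"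
          using that continuous_on_subset[OF continuous_on_area_factor[OF cont]]
          by (intro borel_measurable_continuous_on_indicator) auto
        then have "(\<lambda>x. ennreal (indicator S x *\<^sub>R area_factor (\<phi>' x))) \<in> borel_measurable borel" by measurable
        also have "(\<lambda>x. ennreal (indicator S x *\<^sub>R area_factor (\<phi>' x))) = (\<lambda>x. ennreal (area_factor (\<phi>' x)) * indicator S x)"
          by (auto split: split_indicator)
        finally show ?thesis .
      qed
      have "(\<Sum>n. ?I (C n)) = (\<integral>\<^sup>+x. (\<Sum>n. ennreal (area_factor (\<phi>' x)) * indicator (C n) x) \<partial>lborel)"
        using m Cb CN by (intro nn_integral_suminf[symmetric]) auto
      also have "\<dots> = ?I B"
        unfolding BC by (simp add: suminf_indicator[OF dC])
      finally show ?thesis ..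
    qed
    show ?thesis
      unfolding H I ennreal_suminf_cmult[symmetric] using loc by (intro conjI suminf_le) auto
  qed
  show ?thesis by (rule antisym; rule ennreal_le_of_le_mult) (use key in auto)
qed

text \<open>The area formula says that Hausdorff measure on the image is the push-forward of
  Lebesgue measure weighted by the area factor; equal measures have equal integrals.\<close>

theorem area_formula_nn_integral:
  fixes \<phi> :: "real^'a \<Rightarrow> 'w::euclidean_space" and \<phi>' :: "real^'a \<Rightarrow> real^'a \<Rightarrow> 'w"
  assumes U: "open U"
    and der: "\<And>u. u \<in> U \<Longrightarrow> (\<phi> has_derivative \<phi>' u) (at u)"
    and cont: "\<And>v. continuous_on U (\<lambda>u. \<phi>' u v)"
    and inj': "\<And>u. u \<in> U \<Longrightarrow> inj (\<phi>' u)" and inj: "inj_on \<phi> U"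
    and h[measurable]: "h \<in> borel_measurable borel"
  shows "(\<integral>\<^sup>+x. h x * indicator (\<phi> ` U) x \<partial>hausdorff_measure CARD('a)) =
    (\<integral>\<^sup>+u. ennreal (area_factor (\<phi>' u)) * h (\<phi> u) * indicator U u \<partial>lborel)"
proof -
  have c\<phi>: "continuous_on U \<phi>"
    using der U by (meson continuous_at_imp_continuous_on has_derivative_continuous)
  have [measurable]: "U \<in> sets borel" using U by simp
  have imgU[measurable]: "\<phi> ` U \<in> sets borel"
    using injective_continuous_image_borel[OF U c\<phi> inj, of UNIV] by simp
  \<comment> \<open>Extension of \<phi> by 0 outside \<open>U\<close>: it is Borel on the whole
    space, where \<phi> is controlled on \<open>U\<close> only.\<close>
  define \<psi> where "\<psi> u = indicator U u *\<^sub>R \<phi> u" for u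
  have \<psi>[measurable]: "\<psi> \<in> borel_measurable borel"
    unfolding \<psi>_def using c\<phi> by (intro borel_measurable_continuous_on_indicator) auto
  define J where "J u = indicator U u *\<^sub>R area_factor (\<phi>' u)" for u
  have J[measurable]: "J \<in> borel_measurable borel"
    unfolding J_def using continuous_on_area_factor[OF cont] by (intro borel_measurable_continuous_on_indicator) auto
  let ?M = "density (hausdorff_measure CARD('a)) (indicator (\<phi> ` U)) :: 'w measure"
  let ?N = "distr (density lborel (\<lambda>u. ennreal (J u))) borel \<psi>"
  have "?M = ?N"
  proof (rule measure_eqI)
    show "sets ?M = sets ?N" by simp
    fix A assume "A \<in> sets ?M"
    then have A[measurable]: "A \<in> sets borel" by simp
    have B: "U \<inter> \<psi> -` A \<in> sets borel" using measurable_sets_borel[OF \<psi> A] by auto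
    have "emeasure ?M A = emeasure (hausdorff_measure CARD('a)) (\<phi> ` U \<inter> A)"
      by (subst emeasure_density) (auto simp: nn_integral_indicator Int_commute simp flip: indicator_inter_arith)
    also have "\<phi> ` U \<inter> A = \<phi> ` (U \<inter> \<psi> -` A)" by (auto simp: \<psi>_def)
    also have "emeasure (hausdorff_measure CARD('a)) \<dots> = hausdorff_outer CARD('a) \<dots>"
      using injective_continuous_image_borel[OF U c\<phi> inj B] by (intro emeasure_hausdorff_measure) (simp add: Int_assoc[symmetric])
    also have "\<dots> = (\<integral>\<^sup>+x. ennreal (area_factor (\<phi>' x)) * indicator (U \<inter> \<psi> -` A) x \<partial>lborel)"
      by (rule area_formula[OF U der cont inj' inj B]) auto
    also have "\<dots> = (\<integral>\<^sup>+x. ennreal (J x) * indicator (\<psi> -` A) x \<partial>lborel)"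
      by (intro nn_integral_cong) (auto simp: J_def split: split_indicator)
    also have "\<dots> = emeasure ?N A"
      using measurable_sets_borel[OF \<psi> A] by (simp add: emeasure_distr emeasure_density)
    finally show "emeasure ?M A = emeasure ?N A" .
  qed
  then have "(\<integral>\<^sup>+x. h x \<partial>?M) = (\<integral>\<^sup>+x. h x \<partial>?N)" by simp
  moreover have "(\<integral>\<^sup>+x. h x \<partial>?M) = (\<integral>\<^sup>+x. h x * indicator (\<phi> ` U) x \<partial>hausdorff_measure CARD('a))"
    by (subst nn_integral_density) (auto simp: mult.commute)
  moreover have "(\<integral>\<^sup>+x. h x \<partial>?N) = (\<integral>\<^sup>+u. ennreal (J u) * h (\<psi> u) \<partial>lborel)"
    by (subst nn_integral_distr, simp, simp, subst nn_integral_density) auto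
  moreover have "\<dots> = (\<integral>\<^sup>+u. ennreal (area_factor (\<phi>' u)) * h (\<phi> u) * indicator U u \<partial>lborel)"
    by (intro nn_integral_cong) (auto simp: J_def \<psi>_def split: split_indicator)
  ultimately show ?thesis by simp
qed

subsection \<open>Geometry of the weighted \<open>p\<close>-ball\<close>

text \<open>The tangent of a convex function lies below it. Here this is Young's inequality with
  conjugate exponents \<open>p\<close> and \<open>q\<close>, because raising
  \<open>\<bar>t\<bar> powr (p - 1)\<close> to the power \<open>q\<close> gives
  \<open>\<bar>t\<bar> powr p\<close>.\<close>

lemma abs_powr_tangent_le:
  fixes s t p :: real
  assumes p: "1 < p"
  shows "\<bar>t\<bar> powr p + p * (\<bar>t\<bar> powr (p - 1) * sgn t) * (s - t) \<le> \<bar>s\<bar> powr p"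
proof -
  define q where "q = p / (p - 1)"
  have q: "q > 1" "1 / p + 1 / q = 1" using p by (auto simp: q_def field_simps)
  have t: "\<bar>t\<bar> powr (p - 1) * sgn t * t = \<bar>t\<bar> powr p"
    using p powr_mult_base[of "\<bar>t\<bar>" "p - 1"] by (simp add: sgn_if split: if_splits) (auto simp: mult.commute)
  have "\<bar>s\<bar> * \<bar>t\<bar> powr (p - 1) \<le> \<bar>s\<bar> powr p / p + (\<bar>t\<bar> powr (p - 1)) powr q / q"
    using p q by (intro Youngs_inequality) auto
  also have "(\<bar>t\<bar> powr (p - 1)) powr q = \<bar>t\<bar> powr p" using p by (simp add: powr_powr q_def)
  finally have "p * (\<bar>s\<bar> * \<bar>t\<bar> powr (p - 1)) \<le> p * (\<bar>s\<bar> powr p / p + \<bar>t\<bar> powr p / q)"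
    using p by simp
  also have "\<dots> = \<bar>s\<bar> powr p + (p - 1) * \<bar>t\<bar> powr p"
    using p by (simp add: q_def field_simps)
  finally have 1: "p * (\<bar>s\<bar> * \<bar>t\<bar> powr (p - 1)) \<le> \<bar>s\<bar> powr p + (p - 1) * \<bar>t\<bar> powr p" .
  have "\<bar>t\<bar> powr (p - 1) * sgn t * s \<le> \<bar>s\<bar> * \<bar>t\<bar> powr (p - 1)"
  proof -
    have "sgn t * s \<le> \<bar>s\<bar>" by (auto simp: sgn_if)
    then show ?thesis using mult_left_mono[of "sgn t * s" "\<bar>s\<bar>" "\<bar>t\<bar> powr (p - 1)"] by (simp add: mult_ac)
  qed
  then have "p * (\<bar>t\<bar> powr (p - 1) * sgn t * s) \<le> p * (\<bar>s\<bar> * \<bar>t\<bar> powr (p - 1))" using p by simp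
  moreover have "p * (\<bar>t\<bar> powr (p - 1) * sgn t) * (s - t) = p * (\<bar>t\<bar> powr (p - 1) * sgn t * s) - p * \<bar>t\<bar> powr p"
    unfolding t[symmetric] by (simp add: algebra_simps)
  moreover have "p * (\<bar>s\<bar> * \<bar>t\<bar> powr (p - 1)) \<le> \<bar>s\<bar> powr p + (p * \<bar>t\<bar> powr p - \<bar>t\<bar> powr p)"
    using 1 by (simp add: left_diff_distrib)
  ultimately show ?thesis by (simp only:)
qed

lemma has_real_derivative_abs_powr_nonzero:
  fixes t r :: real
  assumes "t \<noteq> 0"
  shows "((\<lambda>t. \<bar>t\<bar> powr r) has_real_derivative r * \<bar>t\<bar> powr (r - 1) * sgn t) (at t)"
proof -
  have "eventually (\<lambda>s. s \<in> (if t > 0 then {0<..} else {..<0})) (nhds t)"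
    using assms by (intro eventually_nhds_in_open) auto
  then have "eventually (\<lambda>s. \<bar>s\<bar> = sgn t * s) (nhds t)"
    by eventually_elim (use assms in \<open>auto simp: sgn_if split: if_splits\<close>)
  then have "((\<lambda>t::real. \<bar>t\<bar>) has_real_derivative sgn t) (at t)"
    by (subst DERIV_cong_ev[OF refl _ refl]) (auto intro!: derivative_eq_intros)
  from DERIV_chain2[OF has_real_derivative_powr this] assms show ?thesis
    by (simp add: mult.assoc)
qed

text \<open>At 0 the difference quotient is bounded by \<open>\<bar>h\<bar> powr (p - 1)\<close>,
  which vanishes in the limit because \<open>1 < p\<close>.\<close>

lemma has_real_derivative_abs_powr:
  fixes t p :: real
  assumes "1 < p"
  shows "((\<lambda>t. \<bar>t\<bar> powr p) has_real_derivative p * \<bar>t\<bar> powr (p - 1) * sgn t) (at t)"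
proof (cases "t = 0")
  case True
  have "((\<lambda>h::real. \<bar>h\<bar> powr (p - 1)) \<longlongrightarrow> 0) (at 0)"
  proof -
    have "((\<lambda>h::real. \<bar>h\<bar> powr (p - 1)) \<longlongrightarrow> \<bar>0\<bar> powr (p - 1)) (at 0)"
      using assms by (intro tendsto_powr' tendsto_intros) auto
    then show ?thesis using assms by simp
  qed
  then have "((\<lambda>h::real. (\<bar>h\<bar> powr p - \<bar>0\<bar> powr p) / h) \<longlongrightarrow> 0) (at 0)"
  proof (rule Lim_null_comparison[rotated])
    show "\<forall>\<^sub>F h in at 0. norm ((\<bar>h\<bar> powr p - \<bar>0\<bar> powr p) / h) \<le> \<bar>h\<bar> powr (p - 1)"
      by (rule always_eventually) (auto simp: powr_diff)
  qed
  then show ?thesis using True assms by (simp add: has_field_derivative_iff)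
next
  case False
  then show ?thesis by (rule has_real_derivative_abs_powr_nonzero)
qed

text \<open>At 0 the derivative fails to exist for 1 < \<open>p\<close> < 2; this is why the charts
  stay away from the coordinate hyperplanes.\<close>

lemma has_real_derivative_signed_powr:
  fixes t p :: real
  assumes "t \<noteq> 0"
  shows "((\<lambda>t. \<bar>t\<bar> powr (p - 1) * sgn t) has_real_derivative (p - 1) * \<bar>t\<bar> powr (p - 2)) (at t)"
proof -
  have "((\<lambda>t. \<bar>t\<bar> powr (p - 1) * sgn t') has_real_derivative (p - 1) * \<bar>t\<bar> powr (p - 1 - 1) * sgn t * sgn t') (at t)" for t'
    by (intro DERIV_cmult_right has_real_derivative_abs_powr_nonzero assms)
  from this[of t] have "((\<lambda>s. \<bar>s\<bar> powr (p - 1) * sgn t) has_real_derivative (p - 1) * \<bar>t\<bar> powr (p - 2)) (at t)"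
    using assms by (simp add: sgn_if split: if_splits)
  moreover have "eventually (\<lambda>s. s \<in> (if t > 0 then {0<..} else {..<0})) (nhds t)"
    using assms by (intro eventually_nhds_in_open) auto
  then have "eventually (\<lambda>s. \<bar>s\<bar> powr (p - 1) * sgn s = \<bar>s\<bar> powr (p - 1) * sgn t) (nhds t)"
    by eventually_elim (use assms in \<open>auto simp: sgn_if split: if_splits\<close>)
  ultimately show ?thesis by (subst DERIV_cong_ev[OF refl _ refl]) auto
qed

section \<open>Convexity, boundary and normal rays\<close>

locale weighted_lp =
  fixes p :: real and a :: "real^'n"
  assumes p: "1 < p" and a: "\<And>r. 0 < a $ r"
begin

abbreviation "K \<equiv> weighted_lp_ball p a"

definition lp_sum :: "real^'n \<Rightarrow> real" where
  "lp_sum x = (\<Sum>r\<in>UNIV. \<bar>a $ r * x $ r\<bar> powr p)"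

text \<open>The gradient of \<^const>\<open>lp_sum\<close> divided by \<open>p\<close>, an outer normal of the ball.\<close>

definition normal :: "real^'n \<Rightarrow> real^'n" where
  "normal x = (\<chi> r. (a $ r) powr p * (\<bar>x $ r\<bar> powr (p - 1) * sgn (x $ r)))"

lemma K_eq: "K = {x. lp_sum x \<le> 1}"
  by (simp add: weighted_lp_ball_def lp_sum_def)

lemma lp_term: "\<bar>a $ r * t\<bar> powr p = (a $ r) powr p * \<bar>t\<bar> powr p"
  using a[of r] by (simp add: abs_mult powr_mult)

lemma lp_sum_alt: "lp_sum x = (\<Sum>r\<in>UNIV. (a $ r) powr p * \<bar>x $ r\<bar> powr p)"
  by (simp add: lp_sum_def lp_term)

lemma normal_inner_self: "normal x \<bullet> x = lp_sum x"
proof -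
  have "\<bar>t\<bar> powr (p - 1) * sgn t * t = \<bar>t\<bar> powr p" for t :: real
    using p powr_mult_base[of "\<bar>t\<bar>" "p - 1"] by (simp add: sgn_if split: if_splits) (auto simp: mult.commute)
  then show ?thesis by (simp add: normal_def inner_vec_def lp_sum_alt mult.assoc)
qed

text \<open>The single source of both the convexity of the ball and the supporting property of
  \<open>normal\<close>.\<close>

lemma lp_sum_tangent: "lp_sum x + p * (normal x \<bullet> (z - x)) \<le> lp_sum z"
proof -
  have "lp_sum x + p * (normal x \<bullet> (z - x)) =
      (\<Sum>r\<in>UNIV. (a $ r) powr p * (\<bar>x $ r\<bar> powr p + p * (\<bar>x $ r\<bar> powr (p - 1) * sgn (x $ r)) * (z $ r - x $ r)))"
    by (simp add: lp_sum_alt normal_def inner_vec_def sum_distrib_left sum.distrib[symmetric] algebra_simps)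
  also have "\<dots> \<le> lp_sum z"
    unfolding lp_sum_alt using p by (intro sum_mono mult_left_mono abs_powr_tangent_le) auto
  finally show ?thesis .
qed

lemma lp_sum_scale: "lp_sum (c *\<^sub>R x) = \<bar>c\<bar> powr p * lp_sum x"
  by (simp add: lp_sum_alt sum_distrib_left abs_mult powr_mult mult_ac)

lemma continuous_on_lp_sum: "continuous_on UNIV lp_sum"
  unfolding lp_sum_def using p by (intro continuous_on_sum continuous_on_powr' continuous_intros) auto

lemma closed_K: "closed K"
  unfolding K_eq by (intro closed_Collect_le continuous_on_lp_sum continuous_on_const)

lemma convex_K: "convex K"
proof (rule convexI)
  fix x y :: "real^'n" and u v :: real
  assume xy: "x \<in> K" "y \<in> K" and uv: "0 \<le> u" "0 \<le> v" "u + v = 1"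
  define c where "c = u *\<^sub>R x + v *\<^sub>R y"
  \<comment> \<open>The tangent inequality at the convex combination \<open>c\<close>, averaged over
    \<open>x\<close> and \<open>y\<close>: the gradient terms cancel.\<close>
  have "u * (lp_sum c + p * (normal c \<bullet> (x - c))) + v * (lp_sum c + p * (normal c \<bullet> (y - c))) \<le> u * 1 + v * 1"
    using xy uv lp_sum_tangent[of c x] lp_sum_tangent[of c y]
    by (intro add_mono mult_left_mono) (auto simp: K_eq)
  also have "u * (lp_sum c + p * (normal c \<bullet> (x - c))) + v * (lp_sum c + p * (normal c \<bullet> (y - c))) =
      (u + v) * lp_sum c + p * (normal c \<bullet> (u *\<^sub>R x + v *\<^sub>R y - (u + v) *\<^sub>R c))"
    by (simp add: inner_diff_right inner_add_right algebra_simps)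
  also have "\<dots> = lp_sum c" using uv by (simp add: c_def)
  finally show "u *\<^sub>R x + v *\<^sub>R y \<in> K" using uv by (simp add: K_eq c_def)
qed

lemma bounded_K: "bounded K"
proof -
  have "\<bar>x $ r\<bar> \<le> 1 / a $ r" if "x \<in> K" for x r
  proof -
    have "\<bar>a $ r * x $ r\<bar> powr p \<le> lp_sum x"
      unfolding lp_sum_def by (rule member_le_sum) auto
    also have "\<dots> \<le> 1 powr p" using that by (simp add: K_eq)
    finally have "\<bar>a $ r * x $ r\<bar> powr p \<le> 1 powr p" .
    then have "\<bar>a $ r * x $ r\<bar> \<le> 1"
      using p powr_less_mono2[of p 1 "\<bar>a $ r * x $ r\<bar>"] by (meson not_less zero_le_one less_trans zero_less_one)
    then show ?thesis using a[of r] by (simp add: abs_mult field_simps)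
  qed
  then have "norm x \<le> (\<Sum>r\<in>UNIV. 1 / a $ r)" if "x \<in> K" for x
    using that norm_le_l1_cart[of x] sum_mono[of UNIV "\<lambda>r. \<bar>x $ r\<bar>" "\<lambda>r. 1 / a $ r"] by fastforce
  then show ?thesis unfolding bounded_iff by blast
qed

lemma zero_in_K: "0 \<in> K"
  using p by (simp add: K_eq lp_sum_def)

lemma frontier_K: "frontier K = {x. lp_sum x = 1}"
proof
  have "open {x. lp_sum x < 1}"
    by (intro open_Collect_less continuous_on_lp_sum continuous_on_const)
  then have "{x. lp_sum x < 1} \<subseteq> interior K"
    by (intro interior_maximal) (auto simp: K_eq)
  then have "\<not> lp_sum x < 1" "x \<in> K" if "x \<in> frontier K" for x
    using that unfolding frontier_def closure_closed[OF closed_K] by blast+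
  then show "frontier K \<subseteq> {x. lp_sum x = 1}"
    by (force simp: K_eq)
  show "{x. lp_sum x = 1} \<subseteq> frontier K"
  proof
    fix x assume "x \<in> {x. lp_sum x = 1}"
    then have x: "lp_sum x = 1" by simp
    have "x \<notin> interior K"
    proof
      assume "x \<in> interior K"
      then obtain e where e: "0 < e" "ball x e \<subseteq> K" using mem_interior by blast
      define c where "c = e / (norm x + 1) / 2"
      have n: "0 < norm x + 1" by (simp add: add_nonneg_pos)
      have c: "0 < c" using e n by (simp add: c_def)
      have "dist x ((1 + c) *\<^sub>R x) = c * norm x" using c by (simp add: dist_norm scaleR_add_left)
      also have "\<dots> < e"
      proof -
        have "c * norm x \<le> c * (norm x + 1)" using c by simp
        also have "\<dots> = e / 2" using n unfolding c_def by (simp add: divide_simps)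
        finally show ?thesis using e by simp
      qed
      finally have "(1 + c) *\<^sub>R x \<in> K" using e by auto
      then have "\<bar>1 + c\<bar> powr p \<le> 1" using x by (simp add: K_eq lp_sum_scale)
      moreover have "1 powr p < (1 + c) powr p" using c p by (intro powr_less_mono2) auto
      ultimately show False using c by simp
    qed
    then show "x \<in> frontier K" using x unfolding frontier_def closure_closed[OF closed_K] by (simp add: K_eq)
  qed
qed

lemma frontierD: "x \<in> frontier K \<Longrightarrow> lp_sum x = 1" "x \<in> frontier K \<Longrightarrow> x \<in> K"
  unfolding frontier_K by (simp_all add: K_eq)

lemma K_nonempty: "K \<noteq> {}"
  using zero_in_K by blast

lemma normal_nonzero: "x \<in> frontier K \<Longrightarrow> normal x \<noteq> 0"
  using normal_inner_self[of x] frontierD(1)[of x] by auto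

lemma normal_supporting: "x \<in> frontier K \<Longrightarrow> z \<in> K \<Longrightarrow> normal x \<bullet> (z - x) \<le> 0"
proof -
  assume "x \<in> frontier K" "z \<in> K"
  then have "p * (normal x \<bullet> (z - x)) \<le> 0"
    using lp_sum_tangent[of x z] frontierD(1)[of x] by (simp add: K_eq)
  then show ?thesis using p by (simp add: mult_le_0_iff)
qed

text \<open>Scaling \<open>x + \<epsilon> e\<^sub>r\<close> back to the boundary shows that
  \<open>(w \<bullet> x) lp_sum (x + \<epsilon> e\<^sub>r) powr (1/p) - w \<bullet> (x + \<epsilon> e\<^sub>r)\<close>
  is minimal at \<open>\<epsilon> = 0\<close>; its derivative there must vanish.\<close>

lemma supporting_imp_normal:
  assumes x: "x \<in> frontier K" and w: "\<And>z. z \<in> K \<Longrightarrow> w \<bullet> (z - x) \<le> 0"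
  shows "w = (w \<bullet> x) *\<^sub>R normal x"
proof -
  have x1: "lp_sum x = 1" using x by (rule frontierD)
  have "w $ r = (w \<bullet> x) * normal x $ r" for r
  proof -
    define S where "S e = lp_sum (x + e *\<^sub>R axis r 1)" for e
    have S_eq: "S e = (a $ r) powr p * \<bar>x $ r + e\<bar> powr p + (\<Sum>i\<in>UNIV - {r}. (a $ i) powr p * \<bar>x $ i\<bar> powr p)" for e
      unfolding S_def lp_sum_alt by (subst sum.remove[of UNIV r]) (auto simp: axis_def intro!: sum.cong)
    have S0: "S 0 = 1" by (simp add: S_def x1)
    have dS: "(S has_real_derivative p * normal x $ r) (at 0)"
      unfolding S_eq[abs_def]
      by (rule derivative_eq_intros DERIV_chain2[OF has_real_derivative_abs_powr[OF p]] refl)+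
        (simp add: normal_def mult_ac)
    have "((\<lambda>e. S e powr (1 / p)) has_real_derivative (1 / p) * S 0 powr (1 / p - 1) * (p * normal x $ r)) (at 0)"
      using DERIV_chain2[OF has_real_derivative_powr[of "S 0" "1/p"] dS] by (simp add: S0)
    then have d1: "((\<lambda>e. S e powr (1 / p)) has_real_derivative normal x $ r) (at 0)"
      using p by (simp add: S0)
    define f where "f e = (w \<bullet> x) * S e powr (1 / p) - (w \<bullet> x + e * w $ r)" for e
    have df: "(f has_real_derivative (w \<bullet> x) * normal x $ r - w $ r) (at 0)"
      unfolding f_def[abs_def] by (rule derivative_eq_intros d1 refl)+ simp
    have f0: "f 0 = 0" by (simp add: f_def S0)
    have "isCont S 0" using dS by (rule DERIV_isCont)
    then have "eventually (\<lambda>e. 0 < S e) (at 0)"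
      unfolding isCont_def by (rule order_tendstoD) (simp add: S0)
    then obtain d where d: "0 < d" "\<And>e. e \<noteq> 0 \<Longrightarrow> dist e 0 < d \<Longrightarrow> 0 < S e"
      unfolding eventually_at by auto
    have "f 0 \<le> f e" if "\<bar>0 - e\<bar> < d" for e
    proof -
      have Se: "0 < S e" using d(2)[of e] that S0 by (cases "e = 0") auto
      define z where "z = (1 / S e powr (1 / p)) *\<^sub>R (x + e *\<^sub>R axis r 1)"
      have pos: "0 < S e powr (1 / p)" using Se by simp
      have "lp_sum z = \<bar>1 / S e powr (1 / p)\<bar> powr p * S e" unfolding z_def lp_sum_scale S_def ..
      also have "\<dots> = 1" using Se p by (simp add: powr_divide powr_powr)
      finally have "z \<in> K" by (simp add: K_eq)
      then have "w \<bullet> z \<le> w \<bullet> x" using w[of z] by (simp add: inner_diff_right)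
      then have "S e powr (1 / p) * (w \<bullet> z) \<le> S e powr (1 / p) * (w \<bullet> x)" using pos by simp
      also have "S e powr (1 / p) * (w \<bullet> z) = w \<bullet> x + e * w $ r"
        using pos by (simp add: z_def inner_add_right inner_axis)
      finally show ?thesis by (simp add: f0) (simp add: f_def mult.commute)
    qed
    then have "(w \<bullet> x) * normal x $ r - w $ r = 0"
      using DERIV_local_min[OF df d(1)] by blast
    then show ?thesis by simp
  qed
  then show ?thesis by (simp add: vec_eq_iff)
qed

text \<open>In the expansion of the squared distance to the nearest point around \<open>x\<close>,
  the cross term is nonnegative since \<open>normal x\<close> supports the ball at \<open>x\<close>.
  The nearest point cannot be farther than \<open>x\<close>, so it equals \<open>x\<close>.\<close>

lemma closest_point_eqI:
  assumes x: "x \<in> frontier K" and t: "0 \<le> t"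
  shows "closest_point K (x + t *\<^sub>R normal x) = x"
proof -
  let ?y = "x + t *\<^sub>R normal x" and ?c = "closest_point K (x + t *\<^sub>R normal x)"
  have xK: "x \<in> K" using x by (rule frontierD)
  have c: "?c \<in> K" "dist ?y ?c \<le> dist ?y x"
    by (rule closest_point_in_set[OF closed_K K_nonempty], rule closest_point_le[OF closed_K xK])
  have "(dist ?y ?c)\<^sup>2 = (norm (x - ?c))\<^sup>2 + (norm (t *\<^sub>R normal x))\<^sup>2 + 2 * t * (normal x \<bullet> (x - ?c))"
    unfolding dist_norm power2_norm_eq_inner
    by (simp add: inner_diff_left inner_diff_right inner_add_left inner_add_right inner_commute algebra_simps)
  moreover have "(dist ?y ?c)\<^sup>2 \<le> (norm (t *\<^sub>R normal x))\<^sup>2"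
    using c(2) by (intro power_mono) (auto simp: dist_norm)
  moreover have "0 \<le> t * (normal x \<bullet> (x - ?c))"
    using normal_supporting[OF x c(1)] t by (simp add: inner_diff_right)
  ultimately have "(norm (x - ?c))\<^sup>2 \<le> 0" by linarith
  then show ?thesis by simp
qed

text \<open>The vector from the nearest point \<open>x\<close> to \<open>y\<close> supports the ball
  at \<open>x\<close>, hence is a multiple of \<open>normal x\<close>; its length is the distance to
  the ball.\<close>

lemma local_parallel_set_eq:
  assumes B: "B \<subseteq> frontier K" and \<rho>: "0 \<le> \<rho>"
  shows "local_parallel_set K B \<rho> = {x + t *\<^sub>R normal x | x t. x \<in> B \<and> 0 < t \<and> t * norm (normal x) \<le> \<rho>}"
    (is "?L = ?R")
proof
  show "?L \<subseteq> ?R"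
  proof
    fix y assume "y \<in> ?L"
    then obtain u v where uv: "y = u + v" "u \<in> K" "norm v \<le> \<rho>" and yK: "y \<notin> K" and yB: "closest_point K y \<in> B"
      by (auto simp: local_parallel_set_def)
    define x where "x = closest_point K y"
    have x: "x \<in> frontier K" "x \<in> B" using yB B by (auto simp: x_def)
    define w where "w = y - x"
    have "w \<bullet> (z - x) \<le> 0" if "z \<in> K" for z
      unfolding w_def x_def by (rule closest_point_dot[OF convex_K closed_K that])
    then have w: "w = (w \<bullet> x) *\<^sub>R normal x" and "w \<bullet> (0 - x) \<le> 0"
      using supporting_imp_normal[OF x(1)] zero_in_K by blast+
    have "w \<noteq> 0" using yK closest_point_in_set[OF closed_K K_nonempty, of y] by (auto simp: w_def x_def)
    then have "w \<bullet> x \<noteq> 0" using w by auto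
    \<comment> \<open>The origin belongs to the ball, which makes the inner product nonnegative; it
      is the parameter \<open>t\<close> of the ray.\<close>
    then have pos: "0 < w \<bullet> x" using \<open>w \<bullet> (0 - x) \<le> 0\<close> by simp
    have "norm w \<le> dist y u"
      unfolding w_def x_def dist_norm[symmetric] by (rule closest_point_le[OF closed_K uv(2)])
    also have "\<dots> \<le> \<rho>" using uv by (simp add: dist_norm)
    finally have "(w \<bullet> x) * norm (normal x) \<le> \<rho>"
      using arg_cong[OF w, of norm] pos by simp
    moreover have "y = x + (w \<bullet> x) *\<^sub>R normal x" using w by (simp add: w_def)
    ultimately show "y \<in> ?R" using x pos by blast
  qed
  show "?R \<subseteq> ?L"
  proof
    fix y assume "y \<in> ?R"
    then obtain x t where y: "y = x + t *\<^sub>R normal x" "x \<in> B" "0 < t" "t * norm (normal x) \<le> \<rho>" by auto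
    then have x: "x \<in> frontier K" "x \<in> K" using B frontierD(2) by blast+
    have "y \<notin> K"
    proof
      assume "y \<in> K"
      from normal_supporting[OF x(1) this] have "t * (normal x \<bullet> normal x) \<le> 0" by (simp add: y)
      moreover have "0 < t * (normal x \<bullet> normal x)" using y(3) normal_nonzero[OF x(1)] by simp
      ultimately show False by linarith
    qed
    moreover have "closest_point K y \<in> B" using closest_point_eqI[OF x(1), of t] y by simp
    moreover have "\<exists>u v. y = u + v \<and> u \<in> K \<and> v \<in> cball 0 \<rho>"
      using x(2) y by (intro exI[of _ x] exI[of _ "t *\<^sub>R normal x"]) auto
    ultimately show "y \<in> ?L" by (auto simp: local_parallel_set_def)
  qed
qed

lemma normal_ray_inj:
  assumes "x \<in> frontier K" "x' \<in> frontier K" "0 < t" "0 < t'"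
    and eq: "x + t *\<^sub>R normal x = x' + t' *\<^sub>R normal x'"
  shows "x = x' \<and> t = t'"
proof -
  have "x = x'" using closest_point_eqI[OF assms(1), of t] closest_point_eqI[OF assms(2), of t'] assms by simp
  then show ?thesis using eq normal_nonzero[OF assms(1)] by auto
qed

end

subsection \<open>Boundary charts and normal coordinates\<close>

lemma has_derivative_vecI:
  fixes f :: "'a::real_normed_vector \<Rightarrow> real^'b"
  assumes "\<And>i. ((\<lambda>x. f x $ i) has_derivative (\<lambda>v. f' v $ i)) (at x within S)"
  shows "(f has_derivative f') (at x within S)"
proof (subst has_derivative_componentwise_within, intro ballI)
  fix b :: "real^'b" assume "b \<in> Basis"
  then obtain i where b: "b = axis i 1" by (auto simp: Basis_vec_def)
  show "((\<lambda>x. f x \<bullet> b) has_derivative (\<lambda>x. f' x \<bullet> b)) (at x within S)"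
    using assms[of i] by (simp add: b inner_axis)
qed

lemma has_derivative_vec_nth_id: "((\<lambda>x::real^'a. x $ i) has_derivative (\<lambda>v. v $ i)) F"
  by (rule bounded_linear_imp_has_derivative[OF bounded_linear_vec_nth])

text \<open>Up to row factors the matrix is a rank-one perturbation of the identity with its \<open>k\<close>-th column
  replaced, so Cramer's rule applies.\<close>

lemma det_normal_flow:
  fixes N E :: "real^'n"
  assumes Nk: "N $ k \<noteq> 0" and E: "\<And>r. E $ r \<noteq> 0"
  shows "det (\<chi> i j. if j = k then N $ i
      else E $ i * ((if i = j then 1 else 0) + (if i = k then - N $ j / N $ k else 0))) =
    (\<Sum>r\<in>UNIV. (N $ r)\<^sup>2 * (\<Prod>j\<in>UNIV - {r}. E $ j)) / N $ k"
proof -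
  define c where "c = (\<chi> j. if j = k then 0 else - N $ j / N $ k)"
  define w where "w = (\<chi> i. N $ i / E $ i)"
  define A :: "real^'n^'n" where "A = (\<chi> i j. (if i = j then 1 else 0) + axis k 1 $ i * c $ j)"
  \<comment> \<open>\<open>A\<close> is the identity plus the outer product of
    \<open>axis k 1\<close> and \<open>c\<close>. As \<open>c $ k\<close> vanishes, its inverse just
    changes the sign of that product, so \<open>x\<close> solves \<open>A *v x = w\<close>.\<close>
  define x where "x = w - (c \<bullet> w) *\<^sub>R axis k 1"
  have ck: "c $ k = 0" by (simp add: c_def)
  have detA: "det A = 1"
    unfolding A_def det_identity_plus_outer by (simp add: inner_axis' ck)
  have Ax: "A *v x = w"
  proof -
    have "(A *v x) $ i = x $ i + axis k 1 $ i * (c \<bullet> x)" for i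
    proof -
      have "(A *v x) $ i = (\<Sum>j\<in>UNIV. (if i = j then 1 else 0) * x $ j) + (\<Sum>j\<in>UNIV. axis k 1 $ i * (c $ j * x $ j))"
        by (simp add: A_def matrix_vector_mult_def distrib_right sum.distrib mult.assoc)
      then show ?thesis by (simp add: inner_vec_def sum_distrib_left if_distrib[of "\<lambda>t. t * _"] cong: if_cong)
    qed
    moreover have "c \<bullet> x = c \<bullet> w" by (simp add: x_def inner_diff_right inner_axis ck)
    ultimately show ?thesis by (simp add: vec_eq_iff x_def)
  qed
  have "det (\<chi> i j. if j = k then N $ i
      else E $ i * ((if i = j then 1 else 0) + (if i = k then - N $ j / N $ k else 0))) =
      det (\<chi> i. E $ i *s (\<chi> j. if j = k then (A *v x) $ i else A $ i $ j))"
    unfolding Ax by (rule arg_cong[where f=det]) (use E in \<open>auto simp: vec_eq_iff w_def A_def c_def axis_def\<close>)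
  also have "\<dots> = prod (($) E) UNIV * det (\<chi> i j. if j = k then (A *v x) $ i else A $ i $ j)"
    by (rule det_rows_mul)
  also have "det (\<chi> i j. if j = k then (A *v x) $ i else A $ i $ j) = x $ k"
    by (simp add: cramer_lemma detA)
  also have "x $ k = (\<Sum>r\<in>UNIV. (N $ r)\<^sup>2 / E $ r) / N $ k"
  proof -
    have "c \<bullet> w = (\<Sum>r\<in>UNIV - {k}. c $ r * w $ r)"
      unfolding inner_vec_def using ck by (subst sum.remove[of UNIV k]) auto
    also have "\<dots> = (\<Sum>r\<in>UNIV - {k}. - ((N $ r)\<^sup>2 / E $ r) / N $ k)"
      by (rule sum.cong) (auto simp: c_def w_def power2_eq_square)
    also have "\<dots> = - (\<Sum>r\<in>UNIV - {k}. (N $ r)\<^sup>2 / E $ r) / N $ k"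
      by (simp add: sum_divide_distrib sum_negf)
    finally have "x $ k = N $ k / E $ k + (\<Sum>r\<in>UNIV - {k}. (N $ r)\<^sup>2 / E $ r) / N $ k"
      by (simp add: x_def w_def)
    then show ?thesis
      using Nk by (subst sum.remove[of UNIV k]) (auto simp: add_divide_distrib power2_eq_square)
  qed
  also have "prod (($) E) UNIV * ((\<Sum>r\<in>UNIV. (N $ r)\<^sup>2 / E $ r) / N $ k) =
      (\<Sum>r\<in>UNIV. prod (($) E) UNIV * ((N $ r)\<^sup>2 / E $ r)) / N $ k"
    by (simp add: sum_distrib_left)
  also have "(\<Sum>r\<in>UNIV. prod (($) E) UNIV * ((N $ r)\<^sup>2 / E $ r)) =
      (\<Sum>r\<in>UNIV. (N $ r)\<^sup>2 * (\<Prod>j\<in>UNIV - {r}. E $ j))"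
  proof (rule sum.cong[OF refl])
    fix r
    have "prod (($) E) UNIV = E $ r * (\<Prod>j\<in>UNIV - {r}. E $ j)" by (rule prod.remove) auto
    then show "prod (($) E) UNIV * ((N $ r)\<^sup>2 / E $ r) = (N $ r)\<^sup>2 * (\<Prod>j\<in>UNIV - {r}. E $ j)"
      using E[of r] by simp
  qed
  finally show ?thesis .
qed

context weighted_lp
begin

lemma normal_nth: "normal x $ r = (a $ r) powr p * (\<bar>x $ r\<bar> powr (p - 1) * sgn (x $ r))"
  by (simp add: normal_def)

lemma continuous_on_normal: "continuous_on {x. \<forall>r. x $ r \<noteq> 0} normal"
  unfolding normal_def[abs_def]
  by (intro continuous_on_vec_lambda continuous_on_mult continuous_on_powr continuous_on_sgn continuous_intros) auto

definition normal_diff :: "real^'n \<Rightarrow> real^'n" where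
  "normal_diff x = (\<chi> r. (a $ r) powr p * ((p - 1) * \<bar>x $ r\<bar> powr (p - 2)))"

lemma normal_diff_nonneg: "0 \<le> normal_diff x $ r"
  using p by (simp add: normal_diff_def)

lemma has_derivative_normal:
  assumes "\<And>r. x $ r \<noteq> 0"
  shows "(normal has_derivative (\<lambda>h. \<chi> r. normal_diff x $ r * h $ r)) (at x)"
proof (rule has_derivative_vecI)
  fix r
  have "((\<lambda>x. \<bar>x $ r\<bar> powr (p - 1) * sgn (x $ r)) has_derivative (\<lambda>h. h $ r * ((p - 1) * \<bar>x $ r\<bar> powr (p - 2)))) (at x)"
    by (rule DERIV_compose_FDERIV[OF has_real_derivative_signed_powr[OF assms] has_derivative_vec_nth_id])
  then have "((\<lambda>x. (a $ r) powr p * (\<bar>x $ r\<bar> powr (p - 1) * sgn (x $ r))) has_derivative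
      (\<lambda>h. (a $ r) powr p * (h $ r * ((p - 1) * \<bar>x $ r\<bar> powr (p - 2))))) (at x)"
    by (rule has_derivative_mult_right)
  then show "((\<lambda>x. normal x $ r) has_derivative (\<lambda>h. (\<chi> r. normal_diff x $ r * h $ r) $ r)) (at x)"
    by (simp add: normal_nth normal_diff_def mult_ac)
qed

text \<open>The part of the flow Jacobian that does not depend on the chart; the remaining
  denominator \<open>normal x $ k\<close> also occurs in the area factor of the chart.\<close>

definition normal_jacobian :: "real^'n \<Rightarrow> real \<Rightarrow> real" where
  "normal_jacobian x t = (\<Sum>i\<in>UNIV. (normal x $ i)\<^sup>2 * (\<Prod>j\<in>UNIV - {i}. 1 + t * normal_diff x $ j))"

lemma normal_jacobian_pos:
  assumes "normal x $ k \<noteq> 0" "0 \<le> t"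
  shows "0 < normal_jacobian x t"
proof -
  have pr: "0 < (\<Prod>j\<in>UNIV - {i}. 1 + t * normal_diff x $ j)" for i
    using assms(2) normal_diff_nonneg[of x] by (intro prod_pos) (simp add: add_pos_nonneg)
  show ?thesis unfolding normal_jacobian_def
    by (rule sum_pos2[of _ k]) (use assms pr in \<open>auto simp: less_imp_le\<close>)
qed

end

text \<open>A graph over all coordinates but \<open>k\<close>. The dimension sits in the type, so a
  separate index type with an enumeration \<iota> stands for these coordinates; \<open>s\<close>
  selects the sheet where coordinate \<open>k\<close> has that sign.\<close>

locale weighted_lp_chart = weighted_lp p a for p and a :: "real^'n" +
  fixes \<iota> :: "'m::finite \<Rightarrow> 'n" and k :: 'n and s :: real
  assumes inj_\<iota>: "inj \<iota>" and range_\<iota>: "range \<iota> = UNIV - {k}" and s: "s = 1 \<or> s = -1"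
begin

definition proj :: "real^'n \<Rightarrow> real^'m" where "proj z = (\<chi> j. z $ \<iota> j)"
definition emb :: "real^'m \<Rightarrow> real \<Rightarrow> real^'n" where
  "emb u c = (\<chi> r. if r = k then c else u $ inv \<iota> r)"

lemma \<iota>_neq_k [simp]: "\<iota> j \<noteq> k" "k \<noteq> \<iota> j"
  using range_\<iota> by blast+

lemma inv_\<iota> [simp]: "inv \<iota> (\<iota> j) = j"
  using inj_\<iota> by simp

lemma \<iota>_cases: obtains "r = k" | j where "r = \<iota> j"
  using range_\<iota> by blast

lemma \<iota>_eq [simp]: "\<iota> i = \<iota> j \<longleftrightarrow> i = j"
  using inj_\<iota> by (simp add: inj_eq)

lemma all_index_iff: "(\<forall>r. P r) \<longleftrightarrow> P k \<and> (\<forall>j. P (\<iota> j))"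
  by (metis \<iota>_cases)

lemma sum_index: "(\<Sum>r\<in>UNIV. f r) = f k + (\<Sum>j\<in>UNIV. f (\<iota> j))" for f :: "'n \<Rightarrow> real"
proof -
  have "(\<Sum>r\<in>UNIV. f r) = f k + (\<Sum>r\<in>UNIV - {k}. f r)" by (rule sum.remove) auto
  also have "(\<Sum>r\<in>UNIV - {k}. f r) = (\<Sum>j\<in>UNIV. f (\<iota> j))"
    unfolding range_\<iota>[symmetric] by (simp add: sum.reindex[OF inj_\<iota>])
  finally show ?thesis .
qed

lemma emb_nth [simp]: "emb u c $ k = c" "emb u c $ \<iota> j = u $ j"
  by (simp_all add: emb_def)

lemma proj_nth [simp]: "proj z $ j = z $ \<iota> j"
  by (simp add: proj_def)

lemma proj_emb [simp]: "proj (emb u c) = u"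
  by (simp add: vec_eq_iff)

lemma vec_eq_index: "x = y \<longleftrightarrow> x $ k = y $ k \<and> proj x = proj y"
  by (simp add: vec_eq_iff all_index_iff[of "\<lambda>r. x $ r = y $ r"])

lemma emb_proj [simp]: "emb (proj z) (z $ k) = z"
  by (simp add: vec_eq_index)

lemma inner_emb: "emb u c \<bullet> emb v d = u \<bullet> v + c * d"
  by (simp add: inner_vec_def sum_index)

lemma linear_proj: "linear proj"
  by (rule linearI) (simp_all add: vec_eq_iff)

lemma continuous_on_proj [continuous_intros]: "continuous_on S f \<Longrightarrow> continuous_on S (\<lambda>z. proj (f z))"
  unfolding proj_def by (intro continuous_intros)

lemma continuous_on_emb [continuous_intros]:
  assumes "continuous_on S f" "continuous_on S g"
  shows "continuous_on S (\<lambda>z. emb (f z) (g z))"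
  unfolding emb_def
proof (rule continuous_on_vec_lambda)
  show "continuous_on S (\<lambda>x. if r = k then g x else f x $ inv \<iota> r)" for r
    using assms by (cases "r = k") (auto intro!: continuous_intros)
qed

text \<open>Together with the isometry invariance of Hausdorff measure, this identifies the volume
  on the product of base and axis with the volume on \<open>real^'n\<close>.\<close>

lemma dist_emb: "dist (emb u c) (emb v d) = dist (u, c) (v, d)"
proof -
  have "emb u c - emb v d = emb (u - v) (c - d)" by (simp add: vec_eq_index) (simp add: vec_eq_iff)
  then have "(dist (emb u c) (emb v d))\<^sup>2 = (dist u v)\<^sup>2 + (dist c d)\<^sup>2"
    unfolding dist_norm by (simp only: power2_norm_eq_inner inner_emb) simp
  then show ?thesis by (simp add: dist_prod_def real_sqrt_unique[symmetric])
qed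

lemma card_index: "CARD('n) = CARD('m) + 1"
proof -
  have "CARD('m) = card (UNIV - {k} :: 'n set)"
    unfolding range_\<iota>[symmetric] using inj_\<iota> by (simp add: card_image)
  then show ?thesis by simp
qed

section \<open>The boundary as a graph\<close>

definition partial_sum :: "real^'m \<Rightarrow> real" where
  "partial_sum u = (\<Sum>j\<in>UNIV. (a $ \<iota> j) powr p * \<bar>u $ j\<bar> powr p)"

text \<open>Nonzero coordinates keep \<open>normal\<close> differentiable along the chart; the
  strict inequality keeps coordinate \<open>k\<close> nonzero as well.\<close>

definition chart_dom :: "(real^'m) set" where
  "chart_dom = {u. (\<forall>j. u $ j \<noteq> 0) \<and> partial_sum u < 1}"

definition height :: "real^'m \<Rightarrow> real" where
  "height u = (1 - partial_sum u) powr (1 / p) / a $ k"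

definition chart :: "real^'m \<Rightarrow> real^'n" where
  "chart u = emb u (s * height u)"

text \<open>Implicit differentiation: coordinate \<open>k\<close> is the value that makes the vector
  orthogonal to the normal.\<close>

definition chart_deriv :: "real^'m \<Rightarrow> real^'m \<Rightarrow> real^'n" where
  "chart_deriv u v = emb v (- (\<Sum>j\<in>UNIV. normal (chart u) $ \<iota> j * v $ j) / normal (chart u) $ k)"

lemma s_simps [simp]: "\<bar>s\<bar> = 1" "s * s = 1" "s \<noteq> 0" "sgn s = s"
  using s by auto

lemma continuous_on_partial_sum: "continuous_on UNIV partial_sum"
  unfolding partial_sum_def using p by (intro continuous_on_sum continuous_on_mult continuous_on_powr' continuous_intros) auto

lemma open_chart_dom: "open chart_dom"
proof -
  have "open {u :: real^'m. u $ j \<noteq> 0}" for j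
    by (intro open_Collect_neq continuous_intros)
  then have "open {u :: real^'m. \<forall>j. u $ j \<noteq> 0}"
    by (simp add: Collect_all_eq open_INT)
  moreover have "open {u. partial_sum u < 1}"
    by (intro open_Collect_less continuous_on_partial_sum continuous_intros)
  ultimately show ?thesis unfolding chart_dom_def Collect_conj_eq by (intro open_Int)
qed

lemma height_pos: "u \<in> chart_dom \<Longrightarrow> 0 < height u"
  using a[of k] by (simp add: height_def chart_dom_def)

lemma lp_sum_emb: "lp_sum (emb u c) = (a $ k) powr p * \<bar>c\<bar> powr p + partial_sum u"
  by (simp add: lp_sum_alt sum_index partial_sum_def)

lemma ak_height: "u \<in> chart_dom \<Longrightarrow> (a $ k) powr p * height u powr p = 1 - partial_sum u"
  using a[of k] p by (simp add: height_def chart_dom_def powr_divide powr_powr)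

lemma chart_in_frontier: "u \<in> chart_dom \<Longrightarrow> chart u \<in> frontier K"
  unfolding frontier_K chart_def by (simp add: lp_sum_emb abs_mult ak_height height_pos less_imp_le)

lemma chart_nth [simp]: "chart u $ k = s * height u" "chart u $ \<iota> j = u $ j" "proj (chart u) = u"
  by (simp_all add: chart_def)

lemma chart_image: "chart ` chart_dom = {x \<in> frontier K. (\<forall>r. x $ r \<noteq> 0) \<and> sgn (x $ k) = s}"
proof (intro set_eqI iffI)
  fix x assume "x \<in> chart ` chart_dom"
  then obtain u where u: "u \<in> chart_dom" "x = chart u" by blast
  have "\<forall>r. x $ r \<noteq> 0" unfolding all_index_iff[of "\<lambda>r. x $ r \<noteq> 0"]
    using u height_pos[OF u(1)] by (auto simp: chart_dom_def)
  moreover have "sgn (x $ k) = s" using u height_pos[OF u(1)] by (simp add: sgn_mult)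
  ultimately show "x \<in> {x \<in> frontier K. (\<forall>r. x $ r \<noteq> 0) \<and> sgn (x $ k) = s}"
    using u(2) chart_in_frontier[OF u(1)] by auto
next
  fix x assume "x \<in> {x \<in> frontier K. (\<forall>r. x $ r \<noteq> 0) \<and> sgn (x $ k) = s}"
  then have x: "x \<in> frontier K" "\<And>r. x $ r \<noteq> 0" "sgn (x $ k) = s" by auto
  have xk: "x $ k = s * \<bar>x $ k\<bar>" using x(3) by (metis sgn_mult_abs)
  have eq: "(a $ k) powr p * \<bar>x $ k\<bar> powr p = 1 - partial_sum (proj x)"
    using frontierD(1)[OF x(1)] lp_sum_emb[of "proj x" "x $ k"] by simp
  have "0 < (a $ k) powr p * \<bar>x $ k\<bar> powr p" using a[of k] x(2)[of k] by simp
  then have chart_dom: "proj x \<in> chart_dom" using x(2) eq by (simp add: chart_dom_def)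
  have "height (proj x) = ((a $ k) powr p * \<bar>x $ k\<bar> powr p) powr (1 / p) / a $ k"
    by (simp add: height_def eq)
  also have "\<dots> = \<bar>x $ k\<bar>" using a[of k] p by (simp add: powr_mult powr_powr)
  finally have "x = chart (proj x)" using xk by (simp add: vec_eq_index)
  then show "x \<in> chart ` chart_dom" using chart_dom by blast
qed

lemma chart_nonzero: "u \<in> chart_dom \<Longrightarrow> chart u $ r \<noteq> 0"
  using chart_image by blast

lemma normal_chart_k_nonzero: "u \<in> chart_dom \<Longrightarrow> normal (chart u) $ k \<noteq> 0"
  using a[of k] chart_nonzero[of u k] by (simp add: normal_nth sgn_eq_0_iff)

lemma has_derivative_abs_powr_nth:
  "((\<lambda>u::real^'m. \<bar>u $ j\<bar> powr p) has_derivative (\<lambda>v. v $ j * (p * \<bar>u $ j\<bar> powr (p - 1) * sgn (u $ j)))) (at u)"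
  by (rule DERIV_compose_FDERIV[OF has_real_derivative_abs_powr[OF p] has_derivative_vec_nth_id])

lemma has_derivative_height:
  assumes u: "u \<in> chart_dom"
  shows "((\<lambda>u. s * height u) has_derivative (\<lambda>v. - (\<Sum>j\<in>UNIV. normal (chart u) $ \<iota> j * v $ j) / normal (chart u) $ k)) (at u)"
proof -
  let ?S = "\<lambda>v. \<Sum>j\<in>UNIV. normal (chart u) $ \<iota> j * v $ j"
  have "(partial_sum has_derivative (\<lambda>v. \<Sum>j\<in>UNIV. (a $ \<iota> j) powr p * (v $ j * (p * \<bar>u $ j\<bar> powr (p - 1) * sgn (u $ j))))) (at u)"
    unfolding partial_sum_def[abs_def]
    by (intro has_derivative_sum has_derivative_mult_right has_derivative_abs_powr_nth)
  moreover have "(\<lambda>v. \<Sum>j\<in>UNIV. (a $ \<iota> j) powr p * (v $ j * (p * \<bar>u $ j\<bar> powr (p - 1) * sgn (u $ j)))) = (\<lambda>v. p * ?S v)"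
    by (simp add: normal_nth sum_distrib_left mult_ac)
  ultimately have "(partial_sum has_derivative (\<lambda>v. p * ?S v)) (at u)" by simp
  then have d1: "((\<lambda>u. 1 - partial_sum u) has_derivative (\<lambda>v. - (p * ?S v))) (at u)"
    by (auto intro!: derivative_eq_intros)
  have pos: "0 < 1 - partial_sum u" using u by (simp add: chart_dom_def)
  have "((\<lambda>u. (1 - partial_sum u) powr (1 / p)) has_derivative
      (\<lambda>v. - (p * ?S v) * (1 / p * (1 - partial_sum u) powr (1 / p - 1)))) (at u)"
    by (rule DERIV_compose_FDERIV[OF has_real_derivative_powr[OF pos] d1])
  then have d2: "((\<lambda>u. s / a $ k * (1 - partial_sum u) powr (1 / p)) has_derivative
      (\<lambda>v. s / a $ k * (- (p * ?S v) * (1 / p * (1 - partial_sum u) powr (1 / p - 1))))) (at u)"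
    by (rule has_derivative_mult_right)
  \<comment> \<open>Apart from \<open>s\<close> and \<open>a $ k\<close>, coordinate
    \<open>k\<close> of the normal is the reciprocal of the power that the chain rule produces, so
    the derivative becomes a quotient of normal coordinates.\<close>
  have Nk: "normal (chart u) $ k = s * a $ k * (1 - partial_sum u) powr (1 - 1 / p)"
  proof -
    have "height u powr (p - 1) = (1 - partial_sum u) powr (1 - 1 / p) / (a $ k) powr (p - 1)"
      using pos a[of k] p by (simp add: height_def powr_divide powr_powr diff_divide_distrib)
    moreover have "(a $ k) powr p = a $ k * (a $ k) powr (p - 1)"
      using a[of k] by (simp add: powr_mult_base)
    ultimately show ?thesis
      using a[of k] height_pos[OF u] by (simp add: normal_nth abs_mult sgn_mult)
  qed
  have "s / a $ k * (- (p * ?S v) * (1 / p * (1 - partial_sum u) powr (1 / p - 1))) = - ?S v / normal (chart u) $ k" for v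
  proof -
    have "(1 - partial_sum u) powr (1 / p - 1) = 1 / (1 - partial_sum u) powr (1 - 1 / p)"
      using powr_minus_divide[of "1 - partial_sum u" "1 - 1 / p"] by simp
    moreover have "s / a $ k = 1 / (s * a $ k)" using a[of k] s by auto
    ultimately show ?thesis unfolding Nk using p by simp
  qed
  with d2 show ?thesis by (simp add: height_def)
qed

lemma has_derivative_chart:
  assumes u: "u \<in> chart_dom"
  shows "(chart has_derivative chart_deriv u) (at u)"
proof (rule has_derivative_vecI)
  fix r
  show "((\<lambda>x. chart x $ r) has_derivative (\<lambda>v. chart_deriv u v $ r)) (at u)"
  proof (cases r rule: \<iota>_cases)
    case 1
    then show ?thesis using has_derivative_height[OF u] by (simp add: chart_deriv_def)
  next
    case (2 j)
    then show ?thesis using has_derivative_vec_nth_id[of j "at u"] by (simp add: chart_deriv_def)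
  qed
qed

lemma continuous_on_chart: "continuous_on chart_dom chart"
  using has_derivative_chart open_chart_dom by (meson continuous_at_imp_continuous_on has_derivative_continuous)

lemma continuous_on_normal_chart: "continuous_on chart_dom (\<lambda>u. normal (chart u))"
  using chart_nonzero by (intro continuous_on_compose2[OF continuous_on_normal continuous_on_chart]) auto

lemma continuous_on_chart_deriv:
  "continuous_on S f \<Longrightarrow> continuous_on S g \<Longrightarrow> f ` S \<subseteq> chart_dom \<Longrightarrow> continuous_on S (\<lambda>u. chart_deriv (f u) (g u))"
proof -
  assume f: "continuous_on S f" "continuous_on S g" "f ` S \<subseteq> chart_dom"
  have N: "continuous_on S (\<lambda>u. normal (chart (f u)))"
    using f by (intro continuous_on_compose2[OF continuous_on_normal_chart f(1)]) auto
  show ?thesis unfolding chart_deriv_def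
  proof (rule continuous_on_emb[OF f(2)], rule continuous_on_divide)
    show "continuous_on S (\<lambda>u. - (\<Sum>j\<in>UNIV. normal (chart (f u)) $ \<iota> j * g u $ j))"
      by (intro continuous_on_minus continuous_on_sum continuous_on_mult continuous_on_component N f(2))
    show "continuous_on S (\<lambda>u. normal (chart (f u)) $ k)" by (intro continuous_on_component N)
    show "\<forall>u\<in>S. normal (chart (f u)) $ k \<noteq> 0" using f(3) normal_chart_k_nonzero by blast
  qed
qed

lemma inj_chart_deriv: "inj (chart_deriv u)"
proof (rule injI)
  fix v w assume "chart_deriv u v = chart_deriv u w"
  then have "proj (chart_deriv u v) = proj (chart_deriv u w)" by simp
  then show "v = w" by (simp add: chart_deriv_def)
qed

lemma inj_on_chart: "inj_on chart chart_dom"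
proof (rule inj_onI)
  fix u v assume "chart u = chart v"
  then have "proj (chart u) = proj (chart v)" by simp
  then show "u = v" by simp
qed

text \<open>The Gram matrix of a graph is the identity plus the outer square of the slope vector
  \<open>c\<close>.\<close>

lemma area_factor_chart:
  assumes u: "u \<in> chart_dom"
  shows "area_factor (chart_deriv u) = norm (normal (chart u)) / \<bar>normal (chart u) $ k\<bar>"
proof -
  let ?N = "normal (chart u)"
  define c where "c = (\<chi> j. - ?N $ \<iota> j / ?N $ k)"
  have chax: "chart_deriv u (axis i 1) = emb (axis i 1) (c $ i)" for i
    by (simp add: chart_deriv_def c_def axis_def if_distrib[of "\<lambda>t. _ * t"] cong: if_cong)
  have "gram (chart_deriv u) = (\<chi> i j. (if i = j then 1 else 0) + c $ i * c $ j)"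
    unfolding gram_def chax inner_emb by (simp add: inner_axis_axis vec_eq_iff)
  then have "det (gram (chart_deriv u)) = 1 + c \<bullet> c" by (simp add: det_identity_plus_outer)
  also have "\<dots> = (norm ?N)\<^sup>2 / (?N $ k)\<^sup>2"
  proof -
    have "c \<bullet> c = (\<Sum>j\<in>UNIV. ?N $ \<iota> j * ?N $ \<iota> j) / (?N $ k)\<^sup>2"
      by (simp add: c_def inner_vec_def sum_divide_distrib power2_eq_square)
    moreover have "(norm ?N)\<^sup>2 = (?N $ k)\<^sup>2 + (\<Sum>j\<in>UNIV. ?N $ \<iota> j * ?N $ \<iota> j)"
      unfolding power2_norm_eq_inner inner_vec_def sum_index by (simp add: power2_eq_square)
    ultimately show ?thesis using normal_chart_k_nonzero[OF u] by (simp add: add_divide_distrib)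
  qed
  finally show ?thesis by (simp add: area_factor_def real_sqrt_divide)
qed

section \<open>The normal flow over a chart\<close>

text \<open>Chart parameters and time are packed into one vector, with the time in coordinate
  \<open>k\<close>. The flow thus maps \<open>real^'n\<close> to itself and has a square derivative
  matrix.\<close>

definition flow_dom :: "(real^'n) set" where
  "flow_dom = {z. proj z \<in> chart_dom \<and> 0 < z $ k}"

definition flow :: "real^'n \<Rightarrow> real^'n" where
  "flow z = chart (proj z) + (z $ k) *\<^sub>R normal (chart (proj z))"

definition flow_deriv :: "real^'n \<Rightarrow> real^'n \<Rightarrow> real^'n" where
  "flow_deriv z v = chart_deriv (proj z) (proj v) +
     ((z $ k) *\<^sub>R (\<chi> r. normal_diff (chart (proj z)) $ r * chart_deriv (proj z) (proj v) $ r) +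
      (v $ k) *\<^sub>R normal (chart (proj z)))"

lemma open_flow_dom: "open flow_dom"
proof -
  have "open {z. proj z \<in> chart_dom}"
    using open_vimage[OF open_chart_dom, of proj] linear_continuous_on[of proj UNIV] linear_proj
    by (simp add: vimage_def linear_conv_bounded_linear)
  moreover have "open {z :: real^'n. 0 < z $ k}" by (intro open_Collect_less continuous_intros)
  ultimately show ?thesis unfolding flow_dom_def Collect_conj_eq by (rule open_Int)
qed

lemma has_derivative_flow:
  assumes z: "z \<in> flow_dom"
  shows "(flow has_derivative flow_deriv z) (at z)"
proof -
  have u: "proj z \<in> chart_dom" using z by (simp add: flow_dom_def)
  have proj: "(proj has_derivative proj) (at z)"
    using linear_proj by (rule linear_imp_has_derivative)
  have ch: "((\<lambda>z. chart (proj z)) has_derivative (\<lambda>v. chart_deriv (proj z) (proj v))) (at z)"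
    by (rule has_derivative_compose[OF proj has_derivative_chart[OF u]])
  have no: "((\<lambda>z. normal (chart (proj z))) has_derivative
      (\<lambda>v. \<chi> r. normal_diff (chart (proj z)) $ r * chart_deriv (proj z) (proj v) $ r)) (at z)"
    using has_derivative_compose[OF ch has_derivative_normal] chart_nonzero[OF u] by blast
  show ?thesis
    unfolding flow_def[abs_def] flow_deriv_def[abs_def]
    by (intro has_derivative_add ch has_derivative_scaleR has_derivative_vec_nth_id no)
qed

lemma continuous_on_flow_deriv: "continuous_on flow_dom (\<lambda>z. flow_deriv z v)"
proof -
  have sub: "proj ` flow_dom \<subseteq> chart_dom" by (auto simp: flow_dom_def)
  have pr: "continuous_on flow_dom proj" using continuous_on_proj[OF continuous_on_id] by simp
  have ch: "continuous_on flow_dom (\<lambda>z. chart_deriv (proj z) (proj v))"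
    using sub by (intro continuous_on_chart_deriv pr continuous_on_const)
  have c: "continuous_on flow_dom (\<lambda>z. chart (proj z))"
    using sub by (intro continuous_on_compose2[OF continuous_on_chart pr])
  have N: "continuous_on flow_dom (\<lambda>z. normal (chart (proj z)))"
    using sub by (intro continuous_on_compose2[OF continuous_on_normal_chart pr])
  have "continuous_on flow_dom (\<lambda>z. normal_diff (chart (proj z)))"
    unfolding normal_diff_def
    by (intro continuous_on_vec_lambda continuous_on_mult continuous_on_const continuous_on_powr
        continuous_on_rabs continuous_on_component c)
      (use sub chart_nonzero in \<open>auto simp: image_subset_iff\<close>)
  then show ?thesis
    unfolding flow_deriv_def by (intro continuous_intros ch N)
qed

lemma inj_on_flow: "inj_on flow flow_dom"
proof (rule inj_onI)
  fix z z' assume z: "z \<in> flow_dom" "z' \<in> flow_dom" and eq: "flow z = flow z'"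
  then have "chart (proj z) = chart (proj z') \<and> z $ k = z' $ k"
    unfolding flow_def by (intro normal_ray_inj chart_in_frontier) (auto simp: flow_dom_def)
  then have "proj (chart (proj z)) = proj (chart (proj z')) \<and> z $ k = z' $ k" by simp
  then show "z = z'" by (simp add: vec_eq_index)
qed

text \<open>Column \<open>k\<close>, the time direction, is the normal. The other columns are
  tangent vectors of the chart, scaled rowwise by \<open>E\<close> because the normal field has a
  diagonal derivative.\<close>

lemma det_flow_deriv:
  assumes z: "z \<in> flow_dom"
  shows "det (matrix (flow_deriv z)) = normal_jacobian (chart (proj z)) (z $ k) / normal (chart (proj z)) $ k"
proof -
  have u: "proj z \<in> chart_dom" and t: "0 < z $ k" using z by (auto simp: flow_dom_def)
  let ?x = "chart (proj z)"
  let ?N = "normal ?x"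
  define E where "E = (\<chi> r. 1 + z $ k * normal_diff ?x $ r)"
  have "matrix (flow_deriv z) = (\<chi> i j. if j = k then ?N $ i
      else E $ i * ((if i = j then 1 else 0) + (if i = k then - ?N $ j / ?N $ k else 0)))"
  proof -
    have proj_k: "proj (axis k 1) = 0" by (simp add: vec_eq_iff axis_def)
    have proj_\<iota>: "proj (axis (\<iota> j) 1) = axis j 1" for j by (simp add: vec_eq_iff axis_def)
    have chk: "chart_deriv (proj z) 0 = 0" by (simp add: chart_deriv_def vec_eq_index) (simp add: vec_eq_iff)
    have cha: "chart_deriv (proj z) (axis j 1) = emb (axis j 1) (- ?N $ \<iota> j / ?N $ k)" for j
      by (simp add: chart_deriv_def axis_def if_distrib[of "\<lambda>t. _ * t"] cong: if_cong)
    have cha_nth: "emb (axis j 1) c $ i = (if i = \<iota> j then 1 else 0) + (if i = k then c else 0)" for i j c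
      by (cases i rule: \<iota>_cases) (auto simp: axis_def)
    have "matrix (flow_deriv z) $ i $ j = (if j = k then ?N $ i
      else E $ i * ((if i = j then 1 else 0) + (if i = k then - ?N $ j / ?N $ k else 0)))" for i j
    proof (cases j rule: \<iota>_cases)
      case 1
      then show ?thesis by (simp add: matrix_def flow_deriv_def proj_k chk)
    next
      case (2 j')
      have ax: "axis (\<iota> j') 1 $ k = (0::real)" by (simp add: axis_def)
      have "matrix (flow_deriv z) $ i $ j = E $ i * emb (axis j' 1) (- ?N $ \<iota> j' / ?N $ k) $ i"
        unfolding matrix_def flow_deriv_def by (simp add: 2 proj_\<iota> cha ax E_def distrib_right mult.assoc)
      then show ?thesis by (simp add: 2 cha_nth)
    qed
    then show ?thesis by (simp add: vec_eq_iff)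
  qed
  then have "det (matrix (flow_deriv z)) = (\<Sum>r\<in>UNIV. (?N $ r)\<^sup>2 * (\<Prod>j\<in>UNIV - {r}. E $ j)) / ?N $ k"
  proof -
    have "0 < E $ r" for r
      using t normal_diff_nonneg[of ?x r] by (simp add: E_def add_pos_nonneg)
    then have "E $ r \<noteq> 0" for r by (metis less_irrefl)
    then show ?thesis
      using det_normal_flow[of ?N k E] normal_chart_k_nonzero[OF u] \<open>matrix (flow_deriv z) = _\<close> by simp
  qed
  then show ?thesis by (simp add: normal_jacobian_def E_def)
qed

lemma linear_flow_deriv: "z \<in> flow_dom \<Longrightarrow> linear (flow_deriv z)"
  using has_derivative_flow has_derivative_linear by blast

lemma area_factor_flow:
  assumes "z \<in> flow_dom"
  shows "area_factor (flow_deriv z) = normal_jacobian (chart (proj z)) (z $ k) / \<bar>normal (chart (proj z)) $ k\<bar>"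
    and "inj (flow_deriv z)"
proof -
  have "proj z \<in> chart_dom" "0 < z $ k" using assms by (auto simp: flow_dom_def)
  then have pos: "0 < normal_jacobian (chart (proj z)) (z $ k)"
    using normal_chart_k_nonzero by (intro normal_jacobian_pos) auto
  then show "area_factor (flow_deriv z) = normal_jacobian (chart (proj z)) (z $ k) / \<bar>normal (chart (proj z)) $ k\<bar>"
    by (simp add: area_factor_square det_flow_deriv[OF assms] abs_divide)
  show "inj (flow_deriv z)"
    using det_nz_iff_inj[OF linear_flow_deriv[OF assms]] det_flow_deriv[OF assms] pos
      normal_chart_k_nonzero[OF \<open>proj z \<in> chart_dom\<close>] by simp
qed

end

subsection \<open>Integration in normal coordinates\<close>

context weighted_lp
begin

text \<open>The coefficient of \<open>t ^ l\<close> in the Jacobian. Off the coordinate hyperplanes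
  it is the elementary symmetric function of degree \<open>l\<close> of the principal curvatures,
  times the power \<open>l + 2\<close> of the length of the normal.\<close>

definition curvature_sum :: "nat \<Rightarrow> real^'n \<Rightarrow> real" where
  "curvature_sum l x =
     (\<Sum>i\<in>UNIV. \<Sum>I\<in>{I. I \<subseteq> UNIV - {i} \<and> card I = l}. (normal x $ i)\<^sup>2 * (\<Prod>j\<in>I. normal_diff x $ j))"

lemma curvature_sum_nonneg: "0 \<le> curvature_sum l x"
  unfolding curvature_sum_def by (intro sum_nonneg mult_nonneg_nonneg prod_nonneg) (auto simp: normal_diff_nonneg)

lemma normal_jacobian_expand: "normal_jacobian x t = (\<Sum>l<CARD('n). t ^ l * curvature_sum l x)"
proof -
  have "(\<Prod>j\<in>UNIV - {i}. 1 + t * normal_diff x $ j) =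
      (\<Sum>l<CARD('n). \<Sum>I\<in>{I. I \<subseteq> UNIV - {i} \<and> card I = l}. t ^ l * (\<Prod>j\<in>I. normal_diff x $ j))" for i :: 'n
  proof -
    have "(\<Prod>j\<in>UNIV - {i}. 1 + t * normal_diff x $ j) = (\<Prod>j\<in>UNIV - {i}. t * normal_diff x $ j + 1)"
      by (simp add: add.commute)
    also have "\<dots> = (\<Sum>I\<in>Pow (UNIV - {i}). (\<Prod>j\<in>I. t * normal_diff x $ j))"
      by (subst prod_add) auto
    also have "\<dots> = (\<Sum>I\<in>Pow (UNIV - {i}). t ^ card I * (\<Prod>j\<in>I. normal_diff x $ j))"
      by (simp add: prod.distrib)
    also have "\<dots> = (\<Sum>l<CARD('n). \<Sum>I\<in>{I \<in> Pow (UNIV - {i}). card I = l}. t ^ card I * (\<Prod>j\<in>I. normal_diff x $ j))"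
    proof (rule sum.group[symmetric])
      \<comment> \<open>Only sizes below \<open>CARD('n)\<close> occur, since the index
        \<open>i\<close> is left out.\<close>
      show "card ` Pow (UNIV - {i}) \<subseteq> {..<CARD('n)}"
      proof clarify
        fix I :: "'n set" assume "I \<subseteq> UNIV - {i}"
        then have "card I \<le> card (UNIV - {i})" by (intro card_mono) auto
        also have "\<dots> < CARD('n)" by (intro card_Diff1_less) auto
        finally show "card I < CARD('n)" .
      qed
    qed auto
    also have "\<dots> = (\<Sum>l<CARD('n). \<Sum>I\<in>{I. I \<subseteq> UNIV - {i} \<and> card I = l}. t ^ l * (\<Prod>j\<in>I. normal_diff x $ j))"
      by (intro sum.cong refl) auto
    finally show ?thesis .
  qed
  then have "normal_jacobian x t = (\<Sum>i\<in>UNIV. \<Sum>l<CARD('n). \<Sum>I\<in>{I. I \<subseteq> UNIV - {i} \<and> card I = l}.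
      t ^ l * ((normal x $ i)\<^sup>2 * (\<Prod>j\<in>I. normal_diff x $ j)))"
    by (simp add: normal_jacobian_def sum_distrib_left mult_ac)
  also have "\<dots> = (\<Sum>l<CARD('n). t ^ l * curvature_sum l x)"
    unfolding curvature_sum_def sum_distrib_left by (rule sum.swap)
  finally show ?thesis .
qed

text \<open>Integration over time; the factor \<open>1 / real (Suc l)\<close> is the origin of 1/m
  in the density.\<close>

lemma nn_integral_normal_jacobian:
  assumes c: "0 \<le> c"
  shows "(\<integral>\<^sup>+t. ennreal (normal_jacobian x t) * indicator {0<..c} t \<partial>lborel) =
    ennreal (\<Sum>l<CARD('n). c ^ Suc l / real (Suc l) * curvature_sum l x)"
proof -
  define F where "F t = (\<Sum>l<CARD('n). t ^ Suc l / real (Suc l) * curvature_sum l x)" for t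
  have dF: "(F has_real_derivative normal_jacobian x t) (at t)" for t
  proof -
    have "((\<lambda>t. t ^ Suc l / real (Suc l) * curvature_sum l x) has_real_derivative t ^ l * curvature_sum l x) (at t)" for l
      by (rule derivative_eq_intros refl | simp)+
    then show ?thesis unfolding F_def[abs_def] normal_jacobian_expand by (intro DERIV_sum)
  qed
  have "(\<integral>\<^sup>+t. ennreal (normal_jacobian x t) * indicator {0<..c} t \<partial>lborel) =
      (\<integral>\<^sup>+t. ennreal (normal_jacobian x t) * indicator {0..c} t \<partial>lborel)"
  proof (rule nn_integral_cong_AE)
    have "AE t in lborel. t \<noteq> (0::real)" by (rule AE_lborel_singleton)
    then show "AE t in lborel. ennreal (normal_jacobian x t) * indicator {0<..c} t = ennreal (normal_jacobian x t) * indicator {0..c} t"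
      by eventually_elim (auto split: split_indicator)
  qed
  also have "\<dots> = F c - F 0"
  proof (rule nn_integral_FTC_Icc)
    show "normal_jacobian x \<in> borel_measurable borel" unfolding normal_jacobian_expand[abs_def] by measurable
    show "0 \<le> normal_jacobian x t" if "t \<in> {0..c}" for t
      unfolding normal_jacobian_expand using that by (intro sum_nonneg mult_nonneg_nonneg curvature_sum_nonneg) auto
    show "(F has_real_derivative normal_jacobian x t) (at t)" if "t \<in> {0..c}" for t by (rule dF)
  qed fact
  finally show ?thesis by (simp add: F_def)
qed

section \<open>The densities in terms of the normal\<close>

abbreviation "cdensity \<equiv> lp_curvature_density p a"

lemma normal_sq: "x $ i \<noteq> 0 \<Longrightarrow> (normal x $ i)\<^sup>2 = (a $ i) powr (2 * p) * \<bar>x $ i\<bar> powr (2 * p - 2)"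
proof -
  assume x: "x $ i \<noteq> 0"
  have "(sgn (x $ i))\<^sup>2 = 1" using x by (simp add: sgn_if)
  moreover have "((a $ i) powr p)\<^sup>2 = (a $ i) powr (2 * p)" using a[of i] by (simp add: power2_eq_square powr_add[symmetric])
  moreover have "(\<bar>x $ i\<bar> powr (p - 1))\<^sup>2 = \<bar>x $ i\<bar> powr (2 * p - 2)"
    by (simp add: power2_eq_square powr_add[symmetric])
  ultimately show ?thesis by (simp add: normal_nth power_mult_distrib)
qed

text \<open>Here m is \<open>Suc l\<close>. The denominator of the density contains the squared
  length of the normal to the power (m + 1)/2, which is the length to the power
  \<open>l + 2\<close>; the factors p - 1 move into \<open>normal_diff\<close>.\<close>

lemma cdensity_eq:
  assumes x: "\<And>r. x $ r \<noteq> 0"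
  shows "unit_ball_vol (real (Suc l)) * cdensity (Suc l) x =
    curvature_sum l x / (real (Suc l) * norm (normal x) ^ (l + 2))"
proof -
  let ?S = "\<Sum>r\<in>UNIV. (a $ r) powr (2 * p) * \<bar>x $ r\<bar> powr (2 * p - 2)"
  have S: "?S = (norm (normal x))\<^sup>2"
    unfolding power2_norm_eq_inner inner_vec_def using normal_sq[OF x] by (simp add: power2_eq_square)
  have "0 < (normal x $ r)\<^sup>2" for r
    unfolding normal_sq[OF x] using a[of r] x[of r] by simp
  then have "normal x \<noteq> 0" by auto
  then have n: "0 < norm (normal x)" by simp
  have Spow: "?S powr ((real (Suc l) + 1) / 2) = norm (normal x) ^ (l + 2)"
  proof -
    have sq: "(norm (normal x))\<^sup>2 = norm (normal x) powr 2" using n by simp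
    have "(norm (normal x))\<^sup>2 powr ((real (Suc l) + 1) / 2) = norm (normal x) powr (2 * ((real (Suc l) + 1) / 2))"
      unfolding sq by (rule powr_powr)
    also have "2 * ((real (Suc l) + 1) / 2) = real (l + 2)" by simp
    also have "norm (normal x) powr real (l + 2) = norm (normal x) ^ (l + 2)" using n by (rule powr_realpow)
    finally show ?thesis by (simp add: S)
  qed
  have prod: "(p - 1) ^ l * ((a $ i) powr (2 * p) * \<bar>x $ i\<bar> powr (2 * p - 2) * (\<Prod>j\<in>I. (a $ j) powr p * \<bar>x $ j\<bar> powr (p - 2))) =
      (normal x $ i)\<^sup>2 * (\<Prod>j\<in>I. normal_diff x $ j)" if "card I = l" for i I
  proof -
    have "(\<Prod>j\<in>I. normal_diff x $ j) = (\<Prod>j\<in>I. (p - 1) * ((a $ j) powr p * \<bar>x $ j\<bar> powr (p - 2)))"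
      by (simp add: normal_diff_def mult_ac)
    also have "\<dots> = (p - 1) ^ l * (\<Prod>j\<in>I. (a $ j) powr p * \<bar>x $ j\<bar> powr (p - 2))"
      using that by (simp only: prod.distrib prod_constant)
    finally show ?thesis by (simp add: normal_sq[OF x] mult_ac)
  qed
  let ?T = "\<Sum>i\<in>UNIV. \<Sum>I\<in>{I. I \<subseteq> UNIV - {i} \<and> card I = l}.
        (a $ i) powr (2 * p) * \<bar>x $ i\<bar> powr (2 * p - 2) * (\<Prod>j\<in>I. (a $ j) powr p * \<bar>x $ j\<bar> powr (p - 2))"
  have "cdensity (Suc l) x = (p - 1) ^ l / (real (Suc l) * unit_ball_vol (real (Suc l))) * (?T / norm (normal x) ^ (l + 2))"
    unfolding lp_curvature_density_def Spow by (simp only: diff_Suc_1 sum_divide_distrib)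
  also have "\<dots> = ((p - 1) ^ l * ?T) / (real (Suc l) * unit_ball_vol (real (Suc l)) * norm (normal x) ^ (l + 2))"
    by simp
  also have "(p - 1) ^ l * ?T = curvature_sum l x"
    unfolding curvature_sum_def sum_distrib_left by (intro sum.cong refl prod) auto
  finally have "cdensity (Suc l) x =
    curvature_sum l x / (real (Suc l) * unit_ball_vol (real (Suc l)) * norm (normal x) ^ (l + 2))" .
  moreover have "unit_ball_vol (real (Suc l)) \<noteq> 0"
    by (rule less_imp_neq[symmetric], rule unit_ball_vol_pos) simp
  moreover have "v * (s / (r * v * q)) = s / (r * q)" if "v \<noteq> 0" for v s r q :: real
    using that by simp
  ultimately show ?thesis by (simp only:)
qed

lemma cdensity_nonneg: "0 \<le> cdensity m x"
  unfolding lp_curvature_density_def using p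
  by (intro mult_nonneg_nonneg divide_nonneg_nonneg sum_nonneg prod_nonneg) auto

lemma borel_measurable_cdensity [measurable]: "cdensity m \<in> borel_measurable borel"
  unfolding lp_curvature_density_def by measurable

definition steiner_density :: "real \<Rightarrow> real^'n \<Rightarrow> real" where
  "steiner_density \<rho> x = (\<Sum>l<CARD('n). unit_ball_vol (real (Suc l)) * \<rho> ^ Suc l * cdensity (Suc l) x)"

lemma borel_measurable_steiner_density [measurable]: "steiner_density \<rho> \<in> borel_measurable borel"
  unfolding steiner_density_def[abs_def] by measurable

lemma steiner_density_nonneg: "0 \<le> \<rho> \<Longrightarrow> 0 \<le> steiner_density \<rho> x"
  unfolding steiner_density_def by (intro sum_nonneg mult_nonneg_nonneg cdensity_nonneg) auto

text \<open>The right-hand side is the time integral up to \<rho> divided by the length of the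
  normal. The length left over on the left is the numerator of the area factor of the chart.\<close>

lemma steiner_density_eq:
  assumes x: "\<And>r. x $ r \<noteq> 0" and n: "normal x \<noteq> 0"
  shows "norm (normal x) * steiner_density \<rho> x =
    (\<Sum>l<CARD('n). (\<rho> / norm (normal x)) ^ Suc l / real (Suc l) * curvature_sum l x)"
  unfolding steiner_density_def sum_distrib_left
proof (rule sum.cong[OF refl])
  fix l
  have "norm (normal x) * (unit_ball_vol (real (Suc l)) * \<rho> ^ Suc l * cdensity (Suc l) x) =
      norm (normal x) * \<rho> ^ Suc l * (unit_ball_vol (real (Suc l)) * cdensity (Suc l) x)" by simp
  also have "\<dots> = (\<rho> / norm (normal x)) ^ Suc l / real (Suc l) * curvature_sum l x"
    unfolding cdensity_eq[OF x] using n by (simp add: power_divide mult_ac)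
  finally show "norm (normal x) * (unit_ball_vol (real (Suc l)) * \<rho> ^ Suc l * cdensity (Suc l) x) =
      (\<rho> / norm (normal x)) ^ Suc l / real (Suc l) * curvature_sum l x" .
qed

lemma borel_measurable_normal [measurable]: "normal \<in> borel_measurable borel"
proof (subst borel_measurable_euclidean_space, intro ballI)
  fix b :: "real^'n" assume "b \<in> Basis"
  then obtain i where b: "b = axis i 1" by (auto simp: Basis_vec_def)
  show "(\<lambda>x. normal x \<bullet> b) \<in> borel_measurable borel"
    unfolding b inner_axis by (simp add: normal_nth) measurable
qed

end

context weighted_lp_chart
begin

text \<open>Both volumes are Hausdorff measures of the same top dimension, and \<open>emb\<close> is
  an isometry between the spaces.\<close>

lemma distr_emb: "distr lborel borel (\<lambda>(u, t). emb u t) = lborel"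
proof (rule measure_eqI)
  let ?T = "\<lambda>(u, t). emb u t"
  have T: "?T \<in> borel_measurable borel"
    unfolding case_prod_beta by (intro borel_measurable_continuous_onI continuous_on_emb continuous_intros)
  show "sets (distr lborel borel ?T) = sets lborel" by simp
  fix A assume "A \<in> sets (distr lborel borel ?T)"
  then have A: "A \<in> sets borel" by simp
  have B: "?T -` A \<in> sets borel" using measurable_sets_borel[OF T A] .
  have surj: "?T ` (?T -` A) = A"
  proof (intro set_eqI iffI)
    fix z assume "z \<in> A"
    then show "z \<in> ?T ` (?T -` A)" by (intro image_eqI[of _ _ "(proj z, z $ k)"]) auto
  qed auto
  have "emeasure (distr lborel borel ?T) A = emeasure lborel (?T -` A)"
    using T A by (simp add: emeasure_distr)
  also have "\<dots> = hausdorff_outer DIM((real^'m) \<times> real) (?T -` A)"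
    by (rule hausdorff_outer_eq_lborel[OF B, symmetric])
  also have "\<dots> = hausdorff_outer DIM((real^'m) \<times> real) (?T ` (?T -` A))"
    by (rule hausdorff_outer_isometry[symmetric]) (auto simp: dist_emb)
  also have "\<dots> = hausdorff_outer DIM(real^'n) A" unfolding surj by (simp add: card_index)
  also have "\<dots> = emeasure lborel A" by (rule hausdorff_outer_eq_lborel[OF A])
  finally show "emeasure (distr lborel borel ?T) A = emeasure lborel A" .
qed

lemma nn_integral_emb:
  assumes h[measurable]: "h \<in> borel_measurable borel"
  shows "(\<integral>\<^sup>+z. h z \<partial>lborel) = (\<integral>\<^sup>+u. \<integral>\<^sup>+t. h (emb u t) \<partial>lborel \<partial>lborel)"
proof -
  have T[measurable]: "(\<lambda>(u, t). emb u t) \<in> borel_measurable borel"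
    unfolding case_prod_beta by (intro borel_measurable_continuous_onI continuous_on_emb continuous_intros)
  have hT: "(\<lambda>(u, t). h (emb u t)) \<in> borel_measurable borel"
    using measurable_compose[OF T h] by (simp add: case_prod_beta)
  have "(\<integral>\<^sup>+z. h z \<partial>lborel) = (\<integral>\<^sup>+z. h z \<partial>distr lborel borel (\<lambda>(u, t). emb u t))"
    by (simp add: distr_emb)
  also have "\<dots> = (\<integral>\<^sup>+z. (\<lambda>(u, t). h (emb u t)) z \<partial>lborel)"
    by (subst nn_integral_distr) (use T in \<open>auto simp: case_prod_beta'\<close>)
  also have "\<dots> = (\<integral>\<^sup>+z. (\<lambda>(u, t). h (emb u t)) z \<partial>(lborel \<Otimes>\<^sub>M lborel))"
    by (simp add: lborel_prod)
  also have "\<dots> = (\<integral>\<^sup>+u. \<integral>\<^sup>+t. h (emb u t) \<partial>lborel \<partial>lborel)"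
    using hT by (subst lborel.nn_integral_fst[symmetric]) (auto simp: lborel_prod)
  finally show ?thesis .
qed

text \<open>The area formula for the flow turns volume into an integral over base and time. Tonelli
  isolates the time integral, and the area formula for the chart, read backwards, turns the base
  integral into one over the surface.\<close>

lemma emeasure_flow_image:
  assumes B: "B \<in> sets borel" and \<rho>: "0 \<le> \<rho>"
  defines "W \<equiv> {z \<in> flow_dom. chart (proj z) \<in> B \<and> z $ k * norm (normal (chart (proj z))) \<le> \<rho>}"
  shows "flow ` W \<in> sets borel"
    and "emeasure lborel (flow ` W) =
      (\<integral>\<^sup>+x. ennreal (steiner_density \<rho> x) * indicator B x * indicator (chart ` chart_dom) x \<partial>hausdorff_measure CARD('m))"
proof -
  have [measurable]: "chart_dom \<in> sets borel" "flow_dom \<in> sets borel"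
    using open_chart_dom open_flow_dom by auto
  define \<psi> where "\<psi> u = indicator chart_dom u *\<^sub>R chart u" for u
  have \<psi>[measurable]: "\<psi> \<in> borel_measurable borel"
    unfolding \<psi>_def[abs_def] using continuous_on_chart by (intro borel_measurable_continuous_on_indicator) auto
  have proj[measurable]: "proj \<in> borel_measurable borel"
    using continuous_on_proj[OF continuous_on_id] by (intro borel_measurable_continuous_onI) auto
  have [measurable]: "(\<lambda>z. z $ k) \<in> borel_measurable borel" by (intro borel_measurable_continuous_onI continuous_intros)
  have \<psi>p[measurable]: "(\<lambda>z. \<psi> (proj z)) \<in> borel_measurable borel" by measurable
  have N[measurable]: "(\<lambda>z. norm (normal (\<psi> (proj z)))) \<in> borel_measurable borel" by measurable
  have "W = flow_dom \<inter> ((\<lambda>z. \<psi> (proj z)) -` B \<inter> {z. z $ k * norm (normal (\<psi> (proj z))) \<le> \<rho>})"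
    by (auto simp: W_def \<psi>_def flow_dom_def)
  moreover have "(\<lambda>z. \<psi> (proj z)) -` B \<in> sets borel" using measurable_sets_borel[OF \<psi>p B] .
  moreover have "{z. z $ k * norm (normal (\<psi> (proj z))) \<le> \<rho>} \<in> sets borel"
    by (rule borel_measurable_le[where M=borel, simplified]) measurable
  ultimately have W[measurable]: "W \<in> sets borel" by simp
  have Wsub: "W \<subseteq> flow_dom" by (auto simp: W_def)
  have cflow: "continuous_on flow_dom flow"
    using has_derivative_flow open_flow_dom by (meson continuous_at_imp_continuous_on has_derivative_continuous)
  show img: "flow ` W \<in> sets borel"
    using injective_continuous_image_borel[OF open_flow_dom cflow inj_on_flow W] Wsub by (simp add: Int_absorb1)
  define J where "J z = indicator flow_dom z *\<^sub>R area_factor (flow_deriv z)" for z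
  have J[measurable]: "J \<in> borel_measurable borel"
    unfolding J_def[abs_def] using continuous_on_area_factor[OF continuous_on_flow_deriv]
    by (intro borel_measurable_continuous_on_indicator) auto
  have "emeasure lborel (flow ` W) = hausdorff_outer CARD('n) (flow ` W)"
    using hausdorff_outer_eq_lborel[OF img] by simp
  also have "\<dots> = (\<integral>\<^sup>+z. ennreal (area_factor (flow_deriv z)) * indicator W z \<partial>lborel)"
    by (rule area_formula[OF open_flow_dom has_derivative_flow continuous_on_flow_deriv
          area_factor_flow(2) inj_on_flow W Wsub])
  also have "\<dots> = (\<integral>\<^sup>+z. ennreal (J z) * indicator W z \<partial>lborel)"
    using Wsub by (intro nn_integral_cong) (auto simp: J_def split: split_indicator)
  also have "\<dots> = (\<integral>\<^sup>+u. \<integral>\<^sup>+t. ennreal (J (emb u t)) * indicator W (emb u t) \<partial>lborel \<partial>lborel)"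
    by (rule nn_integral_emb) measurable
  also have "\<dots> = (\<integral>\<^sup>+u. ennreal (area_factor (chart_deriv u)) *
      (ennreal (steiner_density \<rho> (chart u)) * indicator B (chart u)) * indicator chart_dom u \<partial>lborel)"
  proof (rule nn_integral_cong)
    fix u :: "real^'m"
    show "(\<integral>\<^sup>+t. ennreal (J (emb u t)) * indicator W (emb u t) \<partial>lborel) =
      ennreal (area_factor (chart_deriv u)) * (ennreal (steiner_density \<rho> (chart u)) * indicator B (chart u)) * indicator chart_dom u"
    proof (cases "u \<in> chart_dom \<and> chart u \<in> B")
      case False
      then have "indicator W (emb u t) = (0::ennreal)" for t by (auto simp: W_def flow_dom_def)
      then show ?thesis using False by (auto split: split_indicator)
    next
      case True
      then have u: "u \<in> chart_dom" "chart u \<in> B" by auto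
      let ?x = "chart u"
      let ?n = "norm (normal ?x)" and ?k = "\<bar>normal ?x $ k\<bar>"
      have k: "0 < ?k" using normal_chart_k_nonzero[OF u(1)] by simp
      have n: "normal ?x \<noteq> 0" using k by auto
      then have n': "0 < ?n" by simp
      \<comment> \<open>Over a fixed boundary point, membership in \<open>W\<close> confines the
        time to a half-open interval, and only \<open>normal_jacobian\<close> depends on
        time.\<close>
      have "ennreal (J (emb u t)) * indicator W (emb u t) =
          ennreal (1 / ?k) * (ennreal (normal_jacobian ?x t) * indicator {0<..\<rho> / ?n} t)" for t
      proof (cases "0 < t")
        case t: True
        then have d: "emb u t \<in> flow_dom" using u by (simp add: flow_dom_def)
        have "J (emb u t) = normal_jacobian ?x t / ?k"
          using d by (simp add: J_def area_factor_flow(1)[OF d])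
        moreover have "ennreal (normal_jacobian ?x t / ?k) = ennreal (1 / ?k) * ennreal (normal_jacobian ?x t)"
          using k normal_jacobian_pos[of ?x k t] t by (simp add: ennreal_mult'[symmetric] less_imp_le)
        moreover have "indicator W (emb u t) = (indicator {0<..\<rho> / ?n} t :: ennreal)"
          using d t u n' by (auto simp: W_def field_simps split: split_indicator)
        ultimately show ?thesis by (simp add: mult.assoc)
      qed (auto simp: W_def flow_dom_def split: split_indicator)
      then have "(\<integral>\<^sup>+t. ennreal (J (emb u t)) * indicator W (emb u t) \<partial>lborel) =
          ennreal (1 / ?k) * (\<integral>\<^sup>+t. ennreal (normal_jacobian ?x t) * indicator {0<..\<rho> / ?n} t \<partial>lborel)"
        by (simp add: nn_integral_cmult normal_jacobian_expand)
      also have "\<dots> = ennreal (1 / ?k) * ennreal (?n * steiner_density \<rho> ?x)"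
        using n' \<rho> steiner_density_eq[of ?x \<rho>] chart_nonzero[OF u(1)] n
        by (simp add: nn_integral_normal_jacobian)
      also have "\<dots> = ennreal (area_factor (chart_deriv u)) * ennreal (steiner_density \<rho> ?x)"
        using k n' steiner_density_nonneg[OF \<rho>] by (simp add: area_factor_chart[OF u(1)] ennreal_mult[symmetric])
      finally show ?thesis using u by simp
    qed
  qed
  also have "\<dots> = (\<integral>\<^sup>+x. ennreal (steiner_density \<rho> x) * indicator B x * indicator (chart ` chart_dom) x \<partial>hausdorff_measure CARD('m))"
    by (rule area_formula_nn_integral[OF open_chart_dom has_derivative_chart continuous_on_chart_deriv
          inj_chart_deriv inj_on_chart, symmetric])
      (use B in \<open>auto intro!: continuous_intros\<close>)
  finally show "emeasure lborel (flow ` W) =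
      (\<integral>\<^sup>+x. ennreal (steiner_density \<rho> x) * indicator B x * indicator (chart ` chart_dom) x \<partial>hausdorff_measure CARD('m))" .
qed

text \<open>The part of the boundary in a coordinate hyperplane is isometric to the boundary of a
  lower-dimensional weighted ball, a null set of the hyperplane.\<close>

lemma hausdorff_outer_frontier_hyperplane: "hausdorff_outer CARD('m) {x \<in> frontier K. x $ k = 0} = 0"
proof -
  interpret face: weighted_lp p "\<chi> j. a $ \<iota> j"
    using p a by unfold_locales auto
  have sum: "face.lp_sum u = partial_sum u" for u
    by (simp add: face.lp_sum_alt partial_sum_def)
  have eq: "{x \<in> frontier K. x $ k = 0} = (\<lambda>u. emb u 0) ` frontier face.K"
  proof (intro set_eqI iffI)
    fix x assume "x \<in> {x \<in> frontier K. x $ k = 0}"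
    then have x: "lp_sum x = 1" "x $ k = 0" using frontierD(1) by auto
    then have "lp_sum (emb (proj x) 0) = 1" using emb_proj[of x] by simp
    then have "proj x \<in> frontier face.K" using p by (simp add: lp_sum_emb face.frontier_K sum)
    then show "x \<in> (\<lambda>u. emb u 0) ` frontier face.K" using emb_proj[of x] x(2) by (metis image_eqI)
  next
    fix x assume "x \<in> (\<lambda>u. emb u 0) ` frontier face.K"
    then obtain u where u: "x = emb u 0" "face.lp_sum u = 1" using face.frontierD(1) by auto
    then have "lp_sum x = 1" using p by (simp add: lp_sum_emb sum)
    then show "x \<in> {x \<in> frontier K. x $ k = 0}" using u unfolding frontier_K by simp
  qed
  have "negligible (frontier face.K)" by (rule negligible_convex_frontier[OF face.convex_K])
  then have "frontier face.K \<in> null_sets lborel"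
    by (simp add: negligible_iff_null_sets null_sets_completion_iff)
  then have "hausdorff_outer CARD('m) (frontier face.K) = 0"
    using hausdorff_outer_eq_lborel[of "frontier face.K"] by (simp add: null_setsD1)
  then show ?thesis
    unfolding eq by (subst hausdorff_outer_isometry) (auto simp: dist_emb dist_prod_def)
qed

end

subsection \<open>The local Steiner formula\<close>

lemma (in weighted_lp_chart) flow_image_eq:
  "flow ` {z \<in> flow_dom. chart (proj z) \<in> B \<and> z $ k * norm (normal (chart (proj z))) \<le> \<rho>} =
   {x + t *\<^sub>R normal x | x t. x \<in> B \<and> x \<in> chart ` chart_dom \<and> 0 < t \<and> t * norm (normal x) \<le> \<rho>}" (is "?L = ?R")
proof
  show "?L \<subseteq> ?R" unfolding flow_def flow_dom_def by blast
  show "?R \<subseteq> ?L"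
  proof
    fix y assume "y \<in> ?R"
    then obtain u t where u: "u \<in> chart_dom" "chart u \<in> B" "0 < t" "t * norm (normal (chart u)) \<le> \<rho>"
      "y = chart u + t *\<^sub>R normal (chart u)" by blast
    then show "y \<in> ?L" by (intro image_eqI[of _ _ "emb u t"]) (auto simp: flow_def flow_dom_def)
  qed
qed

text \<open>Index type of the chart coordinates. The second alternative only keeps the type inhabited when
  \<open>'a\<close> has a single element.\<close>

typedef 'a omit_one = "{x :: 'a. x \<noteq> undefined \<or> (\<forall>y :: 'a. y = undefined)}"
  by (cases "\<forall>y :: 'a. y = undefined") auto

instance omit_one :: (finite) finite
proof
  have "(UNIV :: 'a omit_one set) = Abs_omit_one ` {x :: 'a. x \<noteq> undefined \<or> (\<forall>y :: 'a. y = undefined)}"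
    by (rule type_definition.Abs_image[OF type_definition_omit_one, symmetric])
  then show "finite (UNIV :: 'a omit_one set)" by (metis finite finite_imageI)
qed

lemma card_omit_one:
  assumes "2 \<le> CARD('a::finite)"
  shows "CARD('a omit_one) = CARD('a) - 1"
proof -
  have "\<exists>y :: 'a. y \<noteq> undefined"
  proof (rule ccontr)
    assume "\<nexists>y :: 'a. y \<noteq> undefined"
    then have "(UNIV :: 'a set) = {undefined}" by auto
    then have "CARD('a) = card {undefined :: 'a}" by (rule arg_cong)
    then show False using assms by simp
  qed
  then have "{x :: 'a. x \<noteq> undefined \<or> (\<forall>y :: 'a. y = undefined)} = UNIV - {undefined}" by auto
  then have "CARD('a omit_one) = card (UNIV - {undefined :: 'a})"
    using type_definition.card[OF type_definition_omit_one[where 'a = 'a]] by simp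
  then show ?thesis by (simp add: card_Diff_singleton)
qed

lemma ex_omit_one_enumeration:
  fixes k :: "'a::finite"
  assumes "2 \<le> CARD('a)"
  obtains \<iota> :: "'a omit_one \<Rightarrow> 'a" where "inj \<iota>" "range \<iota> = UNIV - {k}"
proof -
  have "\<exists>h. bij_betw h (UNIV :: 'a omit_one set) (UNIV - {k})"
    by (rule finite_same_card_bij) (auto simp: card_omit_one[OF assms] card_Diff_singleton)
  then show ?thesis using that by (auto simp: bij_betw_def)
qed

section \<open>Assembling the sheets\<close>

context weighted_lp
begin

text \<open>The normal has the signs of the point, coordinate by coordinate. Hence the flow neither
  enters nor leaves a coordinate hyperplane, and the flows of the two sheets stay disjoint.\<close>

lemma sgn_flow_nth: "0 < t \<Longrightarrow> sgn ((x + t *\<^sub>R normal x) $ r) = sgn (x $ r)"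
proof -
  assume t: "0 < t"
  have "(x + t *\<^sub>R normal x) $ r = x $ r + (t * ((a $ r) powr p * \<bar>x $ r\<bar> powr (p - 1))) * sgn (x $ r)"
    by (simp add: normal_nth mult.assoc)
  moreover have "0 \<le> t * ((a $ r) powr p * \<bar>x $ r\<bar> powr (p - 1))" using t by simp
  moreover have "sgn (y + c * sgn y) = sgn y" if "0 \<le> c" for y c :: real
    using that by (auto simp: sgn_if)
  ultimately show ?thesis by (simp only:)
qed

lemma local_parallel_set_bounds:
  shows "bounded (local_parallel_set K B \<rho>)"
    and "B \<in> sets borel \<Longrightarrow> local_parallel_set K B \<rho> \<in> sets borel"
proof -
  let ?S = "{u + v | u v. u \<in> K \<and> v \<in> cball 0 \<rho>}"
  have S: "compact ?S"
    using bounded_K closed_K by (intro compact_sums) (auto simp: compact_eq_bounded_closed)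
  then show "bounded (local_parallel_set K B \<rho>)"
    unfolding local_parallel_set_def by (rule bounded_subset[OF compact_imp_bounded]) auto
  assume B: "B \<in> sets borel"
  have "closest_point K \<in> borel_measurable borel"
    by (intro borel_measurable_continuous_onI continuous_on_closest_point convex_K closed_K K_nonempty)
  then have "closest_point K -` B \<in> sets borel" using B by (rule measurable_sets_borel)
  then have "(?S - K) \<inter> closest_point K -` B \<in> sets borel"
    using borel_compact[OF S] closed_K by auto
  also have "(?S - K) \<inter> closest_point K -` B = local_parallel_set K B \<rho>"
    by (auto simp: local_parallel_set_def)
  finally show "local_parallel_set K B \<rho> \<in> sets borel" .
qed

lemma null_sets_frontier_hyperplanes:
  assumes n: "2 \<le> CARD('n)"
  shows "{x \<in> frontier K. \<exists>r. x $ r = 0} \<in> null_sets (hausdorff_measure (CARD('n) - 1))"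
proof -
  have "{x \<in> frontier K. x $ r = 0} \<in> null_sets (hausdorff_measure (CARD('n) - 1))" for r
  proof -
    obtain \<iota> :: "'n omit_one \<Rightarrow> 'n" where \<iota>: "inj \<iota>" "range \<iota> = UNIV - {r}"
      by (rule ex_omit_one_enumeration[OF n])
    interpret weighted_lp_chart p a \<iota> r 1 using \<iota> by unfold_locales auto
    have "closed {x :: real^'n. x $ r = 0}" by (intro closed_Collect_eq continuous_intros)
    then have "{x \<in> frontier K. x $ r = 0} \<in> sets borel"
      unfolding Collect_conj_eq by (auto intro!: sets.Int)
    then show ?thesis
      using hausdorff_outer_frontier_hyperplane card_omit_one[OF n]
      by (intro null_setsI) (simp_all add: emeasure_hausdorff_measure)
  qed
  then have "(\<Union>r\<in>UNIV. {x \<in> frontier K. x $ r = 0}) \<in> null_sets (hausdorff_measure (CARD('n) - 1))"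
    by (intro null_sets_UN') auto
  also have "(\<Union>r\<in>UNIV. {x \<in> frontier K. x $ r = 0}) = {x \<in> frontier K. \<exists>r. x $ r = 0}" by auto
  finally show ?thesis .
qed

lemma null_sets_coordinate_hyperplanes: "{y :: real^'n. \<exists>r. y $ r = 0} \<in> null_sets lborel"
proof -
  have "{y :: real^'n. y $ r = 0} \<in> null_sets lborel" for r
  proof -
    have "negligible {y :: real^'n. axis r 1 \<bullet> y = 0}"
      by (rule negligible_hyperplane) (auto simp: axis_eq_0_iff)
    moreover have "closed {y :: real^'n. y $ r = 0}" by (intro closed_Collect_eq continuous_intros)
    ultimately show ?thesis
      by (simp add: inner_axis' negligible_iff_null_sets null_sets_completion_iff)
  qed
  then have "(\<Union>r\<in>UNIV. {y :: real^'n. y $ r = 0}) \<in> null_sets lborel" by (intro null_sets_UN') auto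
  also have "(\<Union>r\<in>UNIV. {y :: real^'n. y $ r = 0}) = {y. \<exists>r. y $ r = 0}" by auto
  finally show ?thesis .
qed

text \<open>Off the coordinate hyperplanes the sign of one coordinate splits the boundary into two
  charts. The hyperplanes are removed as a null set from the volume, and their traces on the
  boundary as a null set for surface measure.\<close>

theorem emeasure_local_parallel_set:
  assumes n: "2 \<le> CARD('n)" and B: "B \<in> sets borel" "B \<subseteq> frontier K" and \<rho>: "0 \<le> \<rho>"
  shows "emeasure lborel (local_parallel_set K B \<rho>) =
    (\<integral>\<^sup>+x. ennreal (steiner_density \<rho> x) * indicator B x \<partial>hausdorff_measure (CARD('n) - 1))"
proof -
  define k :: 'n where "k = undefined"
  let ?H = "hausdorff_measure (CARD('n) - 1) :: (real^'n) measure"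
  let ?L = "local_parallel_set K B \<rho>" and ?Z = "{y :: real^'n. \<exists>r. y $ r = 0}"
  obtain \<iota> :: "'n omit_one \<Rightarrow> 'n" where \<iota>: "inj \<iota>" "range \<iota> = UNIV - {k}"
    by (rule ex_omit_one_enumeration[OF n])
  interpret P: weighted_lp_chart p a \<iota> k 1 using \<iota> by unfold_locales auto
  interpret M: weighted_lp_chart p a \<iota> k "-1" using \<iota> by unfold_locales auto
  define C where "C s = {x \<in> frontier K. (\<forall>r. x $ r \<noteq> 0) \<and> sgn (x $ k) = s}" for s
  define F where "F s = {x + t *\<^sub>R normal x | x t. x \<in> B \<and> x \<in> C s \<and> 0 < t \<and> t * norm (normal x) \<le> \<rho>}" for s
  have F: "F s \<in> sets borel \<and> emeasure lborel (F s) = (\<integral>\<^sup>+x. ennreal (steiner_density \<rho> x) * indicator B x * indicator (C s) x \<partial>?H)"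
    if "s = 1 \<or> s = -1" for s
    using that P.emeasure_flow_image[OF B(1) \<rho>] M.emeasure_flow_image[OF B(1) \<rho>] card_omit_one[OF n]
    by (auto simp: F_def C_def P.flow_image_eq M.flow_image_eq P.chart_image M.chart_image)
  have L: "?L - ?Z = F 1 \<union> F (-1)"
  proof (intro set_eqI iffI)
    fix y assume "y \<in> ?L - ?Z"
    then obtain x t where y: "y = x + t *\<^sub>R normal x" "x \<in> B" "0 < t" "t * norm (normal x) \<le> \<rho>"
        and nz: "\<And>r. y $ r \<noteq> 0"
      unfolding local_parallel_set_eq[OF B(2) \<rho>] by auto
    have "x $ r \<noteq> 0" for r
      using nz[of r] sgn_flow_nth[OF y(3), of x r] unfolding y(1) by (metis sgn_eq_0_iff)
    moreover have "sgn (x $ k) = 1 \<or> sgn (x $ k) = -1" using calculation[of k] by (auto simp: sgn_if)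
    ultimately have "x \<in> C 1 \<or> x \<in> C (-1)" using y(2) B(2) by (auto simp: C_def)
    then show "y \<in> F 1 \<union> F (-1)" unfolding F_def using y by blast
  next
    fix y assume "y \<in> F 1 \<union> F (-1)"
    then obtain x t s where y: "y = x + t *\<^sub>R normal x" "x \<in> B" "x \<in> C s" "0 < t" "t * norm (normal x) \<le> \<rho>"
      unfolding F_def by blast
    have "y $ r \<noteq> 0" for r
    proof -
      have "x $ r \<noteq> 0" using y(3) by (simp add: C_def)
      then show ?thesis using sgn_flow_nth[OF y(4), of x r] unfolding y(1) by (metis sgn_eq_0_iff)
    qed
    then show "y \<in> ?L - ?Z" unfolding local_parallel_set_eq[OF B(2) \<rho>] using y by blast
  qed
  have disj: "F 1 \<inter> F (-1) = {}"
  proof -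
    have sgnF: "sgn (y $ k) = s" if y: "y \<in> F s" for y s
    proof -
      obtain x t where "y = x + t *\<^sub>R normal x" "x \<in> C s" "0 < t" using y unfolding F_def by blast
      then show ?thesis using sgn_flow_nth[of t x k] by (simp add: C_def)
    qed
    have "y \<notin> F (-1)" if "y \<in> F 1" for y using sgnF[OF that] sgnF[of y "-1"] by auto
    then show ?thesis by blast
  qed
  have C: "C s \<in> sets borel" for s
  proof -
    have "C s = frontier K \<inter> {x. \<forall>r. x $ r \<noteq> 0} \<inter> {x. sgn (x $ k) = s}" by (auto simp: C_def)
    moreover have "{x :: real^'n. \<forall>r. x $ r \<noteq> 0} = - ?Z" by auto
    moreover have "?Z \<in> sets borel" using null_setsD2[OF null_sets_coordinate_hyperplanes] by simp
    moreover have "{x :: real^'n. sgn (x $ k) = s} \<in> sets borel"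
    proof -
      have "(\<lambda>x :: real^'n. x $ k) \<in> borel_measurable borel" by (intro borel_measurable_continuous_onI continuous_intros)
      then have "(\<lambda>x :: real^'n. sgn (x $ k)) \<in> borel_measurable borel" by measurable
      then have "(\<lambda>x :: real^'n. sgn (x $ k)) -` {s} \<in> sets borel" by (rule measurable_sets_borel) simp
      then show ?thesis by (simp add: vimage_def)
    qed
    ultimately show ?thesis by (auto intro!: sets.Int)
  qed
  have "emeasure lborel ?L = emeasure lborel (?L - ?Z)"
    using local_parallel_set_bounds(2)[OF B(1), of \<rho>] null_sets_coordinate_hyperplanes
    by (intro emeasure_Diff_null_set[symmetric]) auto
  also have "\<dots> = emeasure lborel (F 1) + emeasure lborel (F (-1))"
    unfolding L using F disj by (intro plus_emeasure[symmetric]) auto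
  also have "\<dots> = (\<integral>\<^sup>+x. ennreal (steiner_density \<rho> x) * indicator B x * indicator (C 1) x +
      ennreal (steiner_density \<rho> x) * indicator B x * indicator (C (-1)) x \<partial>?H)"
  proof -
    have [measurable]: "B \<in> sets borel" "C s \<in> sets borel" for s by (rule B(1), rule C)
    have m: "(\<lambda>x. ennreal (steiner_density \<rho> x) * indicator B x * indicator (C s) x) \<in> borel_measurable ?H" for s
      by (subst measurable_cong_sets[OF sets_hausdorff_measure refl]) measurable
    show ?thesis using F[of 1] F[of "-1"] by (simp add: nn_integral_add m)
  qed
  also have "\<dots> = (\<integral>\<^sup>+x. ennreal (steiner_density \<rho> x) * indicator B x \<partial>?H)"
  proof (rule nn_integral_cong_AE)
    have "AE x in ?H. x \<notin> {x \<in> frontier K. \<exists>r. x $ r = 0}"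
      using null_sets_frontier_hyperplanes[OF n] by (rule AE_not_in)
    then show "AE x in ?H. ennreal (steiner_density \<rho> x) * indicator B x * indicator (C 1) x +
      ennreal (steiner_density \<rho> x) * indicator B x * indicator (C (-1)) x = ennreal (steiner_density \<rho> x) * indicator B x"
    proof eventually_elim
      case (elim x)
      show ?case
      proof (cases "x \<in> B")
        case True
        then have "x \<in> frontier K" "\<And>r. x $ r \<noteq> 0" using elim B(2) by auto
        moreover have "sgn (x $ k) = 1 \<or> sgn (x $ k) = -1" using calculation(2)[of k] by (auto simp: sgn_if)
        ultimately have "x \<in> C 1 \<and> x \<notin> C (-1) \<or> x \<notin> C 1 \<and> x \<in> C (-1)" by (auto simp: C_def)
        then show ?thesis by (auto split: split_indicator)
      qed simp
    qed
  qed
  finally show ?thesis .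
qed

text \<open>The candidate for the curvature measure of index n - m, indexed by m as in the
  density.\<close>

definition density_measure :: "nat \<Rightarrow> (real^'n) measure" where
  "density_measure m = density (surface_measure K) (\<lambda>x. ennreal (cdensity m x))"

lemma sets_surface_measure: "sets (surface_measure K) = sets (restrict_space borel (frontier K))"
  unfolding surface_measure_def by (intro sets_restrict_space_cong) simp

lemma emeasure_density_measure:
  assumes B: "B \<in> sets borel" "B \<subseteq> frontier K"
  shows "emeasure (density_measure m) B =
    (\<integral>\<^sup>+x. ennreal (cdensity m x) * indicator B x \<partial>hausdorff_measure (CARD('n) - 1))"
proof -
  have "cdensity m \<in> borel_measurable (surface_measure K)"
    unfolding measurable_cong_sets[OF sets_surface_measure refl]
    by (rule measurable_restrict_space1) (rule borel_measurable_cdensity)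
  moreover have "B \<in> sets (surface_measure K)"
    using B by (auto simp: sets_surface_measure sets_restrict_space_iff)
  ultimately have "emeasure (density_measure m) B = (\<integral>\<^sup>+x. ennreal (cdensity m x) * indicator B x \<partial>surface_measure K)"
    unfolding density_measure_def by (intro emeasure_density) auto
  also have "\<dots> = (\<integral>\<^sup>+x. ennreal (cdensity m x) * indicator B x * indicator (frontier K) x \<partial>hausdorff_measure (CARD('n) - 1))"
    unfolding surface_measure_def by (rule nn_integral_restrict_space) simp
  also have "\<dots> = (\<integral>\<^sup>+x. ennreal (cdensity m x) * indicator B x \<partial>hausdorff_measure (CARD('n) - 1))"
    using B(2) by (intro nn_integral_cong) (auto split: split_indicator)
  finally show ?thesis .
qed

lemma emeasure_local_parallel_set_sum:
  assumes n: "2 \<le> CARD('n)" and B: "B \<in> sets borel" "B \<subseteq> frontier K" and \<rho>: "0 \<le> \<rho>"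
  shows "emeasure lborel (local_parallel_set K B \<rho>) =
    (\<Sum>l<CARD('n). ennreal (unit_ball_vol (real (Suc l)) * \<rho> ^ Suc l) * emeasure (density_measure (Suc l)) B)"
proof -
  let ?H = "hausdorff_measure (CARD('n) - 1) :: (real^'n) measure"
  have "emeasure lborel (local_parallel_set K B \<rho>) =
      (\<integral>\<^sup>+x. ennreal (steiner_density \<rho> x) * indicator B x \<partial>?H)"
    by (rule emeasure_local_parallel_set[OF assms])
  also have "\<dots> = (\<integral>\<^sup>+x. (\<Sum>l<CARD('n). ennreal (unit_ball_vol (real (Suc l)) * \<rho> ^ Suc l) *
      (ennreal (cdensity (Suc l) x) * indicator B x)) \<partial>?H)"
  proof (rule nn_integral_cong)
    fix x
    have "ennreal (steiner_density \<rho> x) = (\<Sum>l<CARD('n). ennreal (unit_ball_vol (real (Suc l)) * \<rho> ^ Suc l * cdensity (Suc l) x))"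
      unfolding steiner_density_def using \<rho> by (intro sum_ennreal[symmetric] mult_nonneg_nonneg cdensity_nonneg) auto
    also have "\<dots> = (\<Sum>l<CARD('n). ennreal (unit_ball_vol (real (Suc l)) * \<rho> ^ Suc l) * ennreal (cdensity (Suc l) x))"
      using \<rho> by (intro sum.cong refl ennreal_mult mult_nonneg_nonneg cdensity_nonneg) auto
    finally show "ennreal (steiner_density \<rho> x) * indicator B x =
        (\<Sum>l<CARD('n). ennreal (unit_ball_vol (real (Suc l)) * \<rho> ^ Suc l) * (ennreal (cdensity (Suc l) x) * indicator B x))"
      by (simp only: sum_distrib_right mult.assoc)
  qed
  also have "\<dots> = (\<Sum>l<CARD('n). ennreal (unit_ball_vol (real (Suc l)) * \<rho> ^ Suc l) * emeasure (density_measure (Suc l)) B)"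
  proof -
    have [measurable]: "B \<in> sets borel" by (rule B(1))
    have m: "(\<lambda>x. ennreal (cdensity l x) * indicator B x) \<in> borel_measurable ?H" for l
      by (subst measurable_cong_sets[OF sets_hausdorff_measure refl]) measurable
    show ?thesis
      unfolding emeasure_density_measure[OF B]
      by (subst nn_integral_sum) (auto intro!: m borel_measurable_times_ennreal sum.cong nn_integral_cmult)
  qed
  finally show ?thesis .
qed

text \<open>Every summand of the Steiner formula at radius 1 is at most the volume of the parallel
  set of the whole boundary, which is bounded.\<close>

lemma finite_density_measure:
  assumes n: "2 \<le> CARD('n)" and l: "l < CARD('n)"
  shows "finite_measure (density_measure (Suc l))"
proof (rule finite_measureI)
  have sp: "space (density_measure (Suc l)) = frontier K"
    by (simp add: density_measure_def surface_measure_def space_restrict_space)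
  have fr: "frontier K \<in> sets borel" by simp
  have "ennreal (unit_ball_vol (real (Suc l)) * 1 ^ Suc l) * emeasure (density_measure (Suc l)) (frontier K) \<le>
      (\<Sum>l<CARD('n). ennreal (unit_ball_vol (real (Suc l)) * 1 ^ Suc l) * emeasure (density_measure (Suc l)) (frontier K))"
    by (rule member_le_sum) (use l in auto)
  also have "\<dots> = emeasure lborel (local_parallel_set K (frontier K) 1)"
    by (rule emeasure_local_parallel_set_sum[OF n fr, symmetric]) auto
  also have "\<dots> < \<infinity>" using emeasure_bounded_finite[OF local_parallel_set_bounds(1)] by simp
  finally have "ennreal (unit_ball_vol (real (Suc l))) * emeasure (density_measure (Suc l)) (frontier K) < \<infinity>" by simp
  moreover have "0 < unit_ball_vol (real (Suc l))" by (rule unit_ball_vol_pos) simp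
  moreover have "y \<noteq> \<infinity>" if "ennreal v * y < \<infinity>" "0 < v" for v y
    using that by (auto simp: ennreal_mult_eq_top_iff)
  ultimately show "emeasure (density_measure (Suc l)) (space (density_measure (Suc l))) \<noteq> \<infinity>"
    unfolding sp by blast
qed

text \<open>Existence of a local Steiner family: once finiteness permits real-valued measures, the
  summed formula only has to be reindexed.\<close>

theorem local_steiner_density_measure:
  assumes n: "2 \<le> CARD('n)"
  shows "local_steiner K (\<lambda>j. density_measure (CARD('n) - j))"
  unfolding local_steiner_def
proof (intro conjI allI impI ballI)
  fix j assume "j < DIM(real^'n)"
  then have j: "CARD('n) - j = Suc (CARD('n) - Suc j)" "CARD('n) - Suc j < CARD('n)" by auto
  show "sets (density_measure (CARD('n) - j)) = sets (restrict_space borel (frontier K))"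
    by (simp add: density_measure_def sets_surface_measure)
  show "finite_measure (density_measure (CARD('n) - j))"
    unfolding j(1) by (rule finite_density_measure[OF n j(2)])
next
  fix \<rho> :: real and B :: "(real^'n) set"
  assume \<rho>: "0 \<le> \<rho>" and B: "B \<in> sets borel" "B \<subseteq> frontier K"
  have "emeasure lborel (local_parallel_set K B \<rho>) =
      (\<Sum>l<CARD('n). ennreal (unit_ball_vol (real (Suc l)) * \<rho> ^ Suc l) * emeasure (density_measure (Suc l)) B)"
    by (rule emeasure_local_parallel_set_sum[OF n B \<rho>])
  also have "\<dots> = (\<Sum>l<CARD('n). ennreal (unit_ball_vol (real (Suc l)) * \<rho> ^ Suc l * measure (density_measure (Suc l)) B))"
  proof (rule sum.cong[OF refl])
    fix l assume "l \<in> {..<CARD('n)}"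
    then interpret finite_measure "density_measure (Suc l)" using finite_density_measure[OF n] by simp
    show "ennreal (unit_ball_vol (real (Suc l)) * \<rho> ^ Suc l) * emeasure (density_measure (Suc l)) B =
        ennreal (unit_ball_vol (real (Suc l)) * \<rho> ^ Suc l * measure (density_measure (Suc l)) B)"
      unfolding emeasure_eq_measure using \<rho> by (intro ennreal_mult[symmetric]) auto
  qed
  also have "\<dots> = ennreal (\<Sum>l<CARD('n). unit_ball_vol (real (Suc l)) * \<rho> ^ Suc l * measure (density_measure (Suc l)) B)"
    using \<rho> by (intro sum_ennreal) auto
  \<comment> \<open>The order of summation is reversed: \<open>Suc l\<close> is the power of \<rho>,
    whereas \<open>j\<close> is its complement in the dimension.\<close>
  also have "(\<Sum>l<CARD('n). unit_ball_vol (real (Suc l)) * \<rho> ^ Suc l * measure (density_measure (Suc l)) B) =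
      (\<Sum>j<CARD('n). unit_ball_vol (real (Suc (CARD('n) - Suc j))) * \<rho> ^ Suc (CARD('n) - Suc j) *
        measure (density_measure (Suc (CARD('n) - Suc j))) B)"
    by (rule sum.nat_diff_reindex[symmetric])
  also have "\<dots> = (\<Sum>j<DIM(real^'n). unit_ball_vol (real (DIM(real^'n) - j)) * \<rho> ^ (DIM(real^'n) - j) *
        measure (density_measure (CARD('n) - j)) B)"
    by (intro sum.cong) (auto simp: Suc_diff_Suc simp del: of_nat_Suc power_Suc)
  finally show "emeasure lborel (local_parallel_set K B \<rho>) =
      ennreal (\<Sum>j<DIM(real^'n). unit_ball_vol (real (DIM(real^'n) - j)) * \<rho> ^ (DIM(real^'n) - j) *
        measure (density_measure (CARD('n) - j)) B)" .
qed

end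

subsection \<open>Uniqueness of the curvature measures\<close>

text \<open>The difference is a polynomial that vanishes on a half-line, so it has infinitely many
  roots.\<close>

lemma polynomial_coeffs_unique:
  fixes c d :: "nat \<Rightarrow> real"
  assumes eq: "\<And>t. 0 \<le> t \<Longrightarrow> (\<Sum>j<n. c j * t ^ (n - j)) = (\<Sum>j<n. d j * t ^ (n - j))" and j: "j < n"
  shows "c j = d j"
proof (rule ccontr)
  assume ne: "c j \<noteq> d j"
  \<comment> \<open>Coefficients of the difference in ascending order. The exponents
    \<open>n - j\<close> are at least 1, so the constant term is 0.\<close>
  define e where "e i = (if i = 0 then 0 else c (n - i) - d (n - i))" for i
  have "finite {t. (\<Sum>i\<le>n. e i * t ^ i) = 0}"
    using polyfun_finite_roots[of e n] ne j by (auto simp: e_def intro!: exI[of _ "n - j"])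
  moreover have "{0..} \<subseteq> {t. (\<Sum>i\<le>n. e i * t ^ i) = 0}"
  proof
    fix t :: real assume t: "t \<in> {0..}"
    have "(\<Sum>i\<le>n. e i * t ^ i) = (\<Sum>i<n. e (Suc i) * t ^ Suc i)"
    proof -
      have "(\<Sum>i\<le>n. e i * t ^ i) = e 0 * t ^ 0 + (\<Sum>i<n. e (Suc i) * t ^ Suc i)"
        unfolding lessThan_Suc_atMost[symmetric] by (rule sum.lessThan_Suc_shift)
      then show ?thesis by (simp add: e_def)
    qed
    also have "\<dots> = (\<Sum>j<n. e (Suc (n - Suc j)) * t ^ Suc (n - Suc j))"
      by (rule sum.nat_diff_reindex[symmetric])
    also have "\<dots> = (\<Sum>j<n. c j * t ^ (n - j) - d j * t ^ (n - j))"
    proof (rule sum.cong[OF refl])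
      fix j assume "j \<in> {..<n}"
      then have "Suc (n - Suc j) = n - j" "n - j \<noteq> 0" "n - (n - j) = j" by auto
      then show "e (Suc (n - Suc j)) * t ^ Suc (n - Suc j) = c j * t ^ (n - j) - d j * t ^ (n - j)"
        by (simp add: e_def left_diff_distrib)
    qed
    also have "\<dots> = 0" using eq[of t] t by (simp add: sum_subtractf)
    finally show "t \<in> {t. (\<Sum>i\<le>n. e i * t ^ i) = 0}" by simp
  qed
  ultimately have "finite {0 :: real..}" by (rule finite_subset[rotated])
  then show False using infinite_Ici by blast
qed

text \<open>For fixed \<open>B\<close> both Steiner sums are nonnegative polynomials in the radius
  with the same values. Their coefficients agree, and the ball volumes, being positive, can be
  cancelled.\<close>

lemma local_steiner_unique:
  fixes K :: "'a::euclidean_space set"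
  assumes \<Phi>: "local_steiner K \<Phi>" and \<Psi>: "local_steiner K \<Psi>" and j: "j < DIM('a)"
  shows "\<Phi> j = \<Psi> j"
proof (rule measure_eqI)
  have sets: "sets (\<Phi> j) = sets (restrict_space borel (frontier K))" "sets (\<Psi> j) = sets (restrict_space borel (frontier K))"
    using \<Phi> \<Psi> j by (auto simp: local_steiner_def)
  then show "sets (\<Phi> j) = sets (\<Psi> j)" by simp
  fix B assume "B \<in> sets (\<Phi> j)"
  then have B: "B \<in> sets borel" "B \<subseteq> frontier K"
    by (auto simp: sets sets_restrict_space_iff)
  have "unit_ball_vol (real (DIM('a) - j)) * measure (\<Phi> j) B = unit_ball_vol (real (DIM('a) - j)) * measure (\<Psi> j) B"
  proof (rule polynomial_coeffs_unique[where n = "DIM('a)" and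
        c = "\<lambda>j. unit_ball_vol (real (DIM('a) - j)) * measure (\<Phi> j) B" and
        d = "\<lambda>j. unit_ball_vol (real (DIM('a) - j)) * measure (\<Psi> j) B", OF _ j])
    fix t :: real assume t: "0 \<le> t"
    have vol: "emeasure lborel (local_parallel_set K B t) =
        ennreal (\<Sum>j<DIM('a). unit_ball_vol (real (DIM('a) - j)) * t ^ (DIM('a) - j) * measure (\<Omega> j) B)"
      if "local_steiner K \<Omega>" for \<Omega>
      using that t B unfolding local_steiner_def by blast
    have "ennreal (\<Sum>j<DIM('a). unit_ball_vol (real (DIM('a) - j)) * t ^ (DIM('a) - j) * measure (\<Phi> j) B) =
        ennreal (\<Sum>j<DIM('a). unit_ball_vol (real (DIM('a) - j)) * t ^ (DIM('a) - j) * measure (\<Psi> j) B)"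
      using vol[OF \<Phi>] vol[OF \<Psi>] by (rule trans[OF sym])
    moreover have "0 \<le> (\<Sum>j<DIM('a). unit_ball_vol (real (DIM('a) - j)) * t ^ (DIM('a) - j) * measure (\<Phi> j) B)"
      "0 \<le> (\<Sum>j<DIM('a). unit_ball_vol (real (DIM('a) - j)) * t ^ (DIM('a) - j) * measure (\<Psi> j) B)"
      using t by (auto intro!: sum_nonneg)
    ultimately show "(\<Sum>j<DIM('a). unit_ball_vol (real (DIM('a) - j)) * measure (\<Phi> j) B * t ^ (DIM('a) - j)) =
        (\<Sum>j<DIM('a). unit_ball_vol (real (DIM('a) - j)) * measure (\<Psi> j) B * t ^ (DIM('a) - j))"
      by (simp add: mult.commute mult.left_commute)
  qed
  moreover have "unit_ball_vol (real (DIM('a) - j)) \<noteq> 0"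
    by (rule less_imp_neq[symmetric], rule unit_ball_vol_pos) simp
  ultimately have "measure (\<Phi> j) B = measure (\<Psi> j) B" by simp
  moreover have "finite_measure (\<Phi> j)" "finite_measure (\<Psi> j)"
    using \<Phi> \<Psi> j by (auto simp: local_steiner_def)
  ultimately show "emeasure (\<Phi> j) B = emeasure (\<Psi> j) B"
    by (simp add: finite_measure.emeasure_eq_measure)
qed

lemma curvature_measure_eqI:
  fixes K :: "'a::euclidean_space set"
  assumes "local_steiner K \<Phi>" "j < DIM('a)"
  shows "curvature_measure K j = \<Phi> j"
  unfolding curvature_measure_def
  by (rule the_equality) (use assms local_steiner_unique[OF _ assms(1,2)] in blast)+

theorem proposition4p7:
  fixes p :: real and a :: "real ^ 'n" and m :: nat
  assumes "CARD('n) \<ge> 2" and "1 < p" and "\<And>r. a $ r > 0"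
    and "1 \<le> m" and "m \<le> CARD('n)"
  shows "absolutely_continuous (surface_measure (weighted_lp_ball p a))
           (curvature_measure (weighted_lp_ball p a) (CARD('n) - m)) \<and>
         curvature_measure (weighted_lp_ball p a) (CARD('n) - m) =
           density (surface_measure (weighted_lp_ball p a))
             (\<lambda>x. ennreal (lp_curvature_density p a m x))"
proof -
  interpret weighted_lp p a using assms by unfold_locales auto
  have "curvature_measure K (CARD('n) - m) = density_measure (CARD('n) - (CARD('n) - m))"
    using assms by (intro curvature_measure_eqI[OF local_steiner_density_measure]) auto
  also have "CARD('n) - (CARD('n) - m) = m" using assms by simp
  finally have eq: "curvature_measure K (CARD('n) - m) = density (surface_measure K) (\<lambda>x. ennreal (cdensity m x))"
    unfolding density_measure_def .
  have "cdensity m \<in> borel_measurable (surface_measure K)"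
    unfolding measurable_cong_sets[OF sets_surface_measure refl]
    by (rule measurable_restrict_space1) (rule borel_measurable_cdensity)
  then show ?thesis unfolding eq by (auto intro!: absolutely_continuousI_density)
qed

end
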